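(* Let $G=(V,E)$ be a co-chordal graph and let $E^c$ be the edge set of its complement. Algorithm B applied to $G$, with the perfect elimination ordering of $G^c$ computed as the reverse of a lexicographic breadth-first search ordering (implemented in $O(|V|+|E^c|)$ time via partition refinement), runs in $O[|V|(|V|+|E^c|)]$ time.
   Context: Graphs are finite and simple; $G$ is co-chordal if $G^c$ is chordal. A perfect elimination ordering $\sigma(1),\dots,\sigma(n)$ of a graph $H$ is one in which each $\sigma(i)$ has a clique as neighborhood in $H(\{\sigma(i),\dots,\sigma(n)\})$. Lexicographic breadth-first search: start with a chosen vertex labelled $\{n\}$ and all others with empty label; for $i=n,n-1,\dots,1$ pick an unnumbered vertex $u$ with lexicographically largest label, set it as the $(n+1-i)$-th vertex of the ordering, and add $i$ to the label of each unnumbered neighbor of $u$; the reverse of this ordering is a perfect elimination ordering of a chordal graph. Algorithm B: set $\mathrm{bp}=\emptyset$, $G'=G^c$; compute a perfect elimination ordering $\sigma$ of $G'$; let $S$ be the vertex set ordered by $\sigma$. While $S\neq\emptyset$: let $v$ be the first element of $S$; $L\leftarrow S\setminus(\{v\}\cup N_{G'}(v))$; $R\leftarrow\{v\}\cup\{u\in N_{G'}(v): N_{G'}(u)\cap L=\emptyset\}$; if $L\neq\emptyset$, add the biclique $\{L,R\}$ to $\mathrm{bp}$; set $S\leftarrow S\setminus R$ and delete the vertices of $R$ from $G'$. Return $\mathrm{bp}$. *)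

theory Defs
  imports Main
begin

section \<open>Finite simple graphs\<close>

definition simple_graph :: "'a set \<Rightarrow> 'a set set \<Rightarrow> bool" where
  "simple_graph V E \<longleftrightarrow> finite V \<and> (\<forall>e\<in>E. e \<subseteq> V \<and> card e = 2)"

definition complement_edges :: "'a set \<Rightarrow> 'a set set \<Rightarrow> 'a set set" where
  "complement_edges V E = {e. e \<subseteq> V \<and> card e = 2 \<and> e \<notin> E}"

definition nbrs :: "'a set set \<Rightarrow> 'a \<Rightarrow> 'a set" where
  "nbrs E v = {u. {v, u} \<in> E}"

definition is_clique :: "'a set set \<Rightarrow> 'a set \<Rightarrow> bool" where
  "is_clique E K \<longleftrightarrow> (\<forall>u\<in>K. \<forall>w\<in>K. u \<noteq> w \<longrightarrow> {u, w} \<in> E)"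

definition is_cycle :: "'a set set \<Rightarrow> 'a list \<Rightarrow> bool" where
  "is_cycle E c \<longleftrightarrow> length c \<ge> 3 \<and> distinct c \<and>
     (\<forall>i<length c. {c ! i, c ! (Suc i mod length c)} \<in> E)"

definition has_chord :: "'a set set \<Rightarrow> 'a list \<Rightarrow> bool" where
  "has_chord E c \<longleftrightarrow> (\<exists>i j. i < j \<and> j < length c \<and> j \<noteq> Suc i \<and>
     \<not> (i = 0 \<and> Suc j = length c) \<and> {c ! i, c ! j} \<in> E)"

definition chordal :: "'a set \<Rightarrow> 'a set set \<Rightarrow> bool" where
  "chordal V E \<longleftrightarrow> simple_graph V E \<and>
     (\<forall>c. is_cycle E c \<and> length c \<ge> 4 \<longrightarrow> has_chord E c)"

definition co_chordal :: "'a set \<Rightarrow> 'a set set \<Rightarrow> bool" where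
  "co_chordal V E \<longleftrightarrow> simple_graph V E \<and> chordal V (complement_edges V E)"

definition perfect_elimination_ordering :: "'a set \<Rightarrow> 'a set set \<Rightarrow> 'a list \<Rightarrow> bool" where
  "perfect_elimination_ordering V E \<sigma> \<longleftrightarrow> distinct \<sigma> \<and> set \<sigma> = V \<and>
     (\<forall>i<length \<sigma>. is_clique E (nbrs E (\<sigma> ! i) \<inter> set (drop i \<sigma>)))"


section \<open>Lexicographic breadth-first search\<close>

text \<open>Labels are finite sets of numbers, compared as words listing their elements in
  decreasing order.\<close>

definition label_less :: "nat set \<Rightarrow> nat set \<Rightarrow> bool" where
  "label_less A B \<longleftrightarrow>
     (rev (sorted_list_of_set A), rev (sorted_list_of_set B)) \<in> lexord {(x, y). x < y}"

text \<open>\<open>lexbfs_run V E r xs lab\<close>: starting from the chosen vertex \<open>r\<close>, the search can number the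
  vertices \<open>xs\<close>, in this order, and then have the labels \<open>lab\<close>. Ties are broken arbitrarily.
  The loop counter \<open>i = n, n - 1, \<dots>\<close> is \<open>card V - length xs\<close>.\<close>

inductive lexbfs_run ::
  "'a set \<Rightarrow> 'a set set \<Rightarrow> 'a \<Rightarrow> 'a list \<Rightarrow> ('a \<Rightarrow> nat set) \<Rightarrow> bool" for V E r where
  init: "r \<in> V \<Longrightarrow> lexbfs_run V E r [] (\<lambda>w. if w = r then {card V} else {})"
| step: "\<lbrakk>lexbfs_run V E r xs lab;
          u \<in> V - set xs; \<forall>w\<in>V - set xs. \<not> label_less (lab u) (lab w)\<rbrakk>
   \<Longrightarrow> lexbfs_run V E r (xs @ [u])
        (\<lambda>w. if w \<in> V - set (xs @ [u]) \<and> w \<in> nbrs E u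
             then insert (card V - length xs) (lab w) else lab w)"

definition lexbfs_ordering :: "'a set \<Rightarrow> 'a set set \<Rightarrow> 'a \<Rightarrow> 'a list \<Rightarrow> bool" where
  "lexbfs_ordering V E r xs \<longleftrightarrow> (\<exists>lab. lexbfs_run V E r xs lab) \<and> length xs = card V"


section \<open>Algorithm B on abstract graphs\<close>

text \<open>\<open>algB_loop E' S bp bp'\<close>: the while loop, entered with the edge set \<open>E'\<close> of \<open>G'\<close>, the ordered
  vertex set \<open>S\<close> (which is also the vertex set of \<open>G'\<close>) and the collection \<open>bp\<close>, ends with \<open>bp'\<close>.\<close>

inductive algB_loop ::
  "'a set set \<Rightarrow> 'a list \<Rightarrow> 'a set set set \<Rightarrow> 'a set set set \<Rightarrow> bool" where
  finish: "algB_loop E' [] bp bp"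
| iterate: "\<lbrakk>S \<noteq> []; v = hd S;
             L = set S - ({v} \<union> nbrs E' v);
             R = {v} \<union> {u \<in> nbrs E' v. nbrs E' u \<inter> L = {}};
             algB_loop {e \<in> E'. e \<inter> R = {}} (filter (\<lambda>u. u \<notin> R) S)
               (if L \<noteq> {} then insert {L, R} bp else bp) bp'\<rbrakk>
   \<Longrightarrow> algB_loop E' S bp bp'"

definition algorithm_B :: "'a set \<Rightarrow> 'a set set \<Rightarrow> 'a list \<Rightarrow> 'a set set set \<Rightarrow> bool" where
  "algorithm_B V E \<sigma> bp \<longleftrightarrow>
     perfect_elimination_ordering V (complement_edges V E) \<sigma> \<and>
     algB_loop (complement_edges V E) \<sigma> {} bp"


section \<open>A uniform-cost random access machine\<close>

text \<open>A program works on finitely many registers and arrays of natural numbers. Every literal,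
  register access, array access, arithmetic operation, comparison, assignment and branch costs
  one time unit. The only arithmetic is addition and truncated subtraction.\<close>

type_synonym vname = string

datatype aexp =
    Lit nat
  | Var vname
  | Get vname aexp (\<open>_\<langle>_\<rangle>\<close> [1000, 0] 999)
  | Plus aexp aexp (infixl \<open>\<oplus>\<close> 65)
  | Minus aexp aexp (infixl \<open>\<ominus>\<close> 65)

datatype bexp =
    Less aexp aexp (infix \<open>\<prec>\<close> 50)
  | Equal aexp aexp (infix \<open>\<doteq>\<close> 50)

datatype com =
    SKIP
  | Assign vname aexp (\<open>_ ::= _\<close> [1000, 61] 61)
  | Put vname aexp aexp (\<open>_\<langle>_\<rangle> ::= _\<close> [1000, 0, 61] 61)
  | Seq com com (\<open>_;;/ _\<close> [60, 61] 60)
  | Cond bexp com com (\<open>(IF _/ THEN _/ ELSE _)\<close> [0, 0, 61] 61)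
  | While bexp com (\<open>(WHILE _/ DO _)\<close> [0, 61] 61)

record state =
  reg :: "vname \<Rightarrow> nat"
  arr :: "vname \<Rightarrow> nat \<Rightarrow> nat"

fun aval :: "aexp \<Rightarrow> state \<Rightarrow> nat" where
  "aval (Lit k) s = k"
| "aval (Var x) s = reg s x"
| "aval (Get a i) s = arr s a (aval i s)"
| "aval (Plus a b) s = aval a s + aval b s"
| "aval (Minus a b) s = aval a s - aval b s"

fun acost :: "aexp \<Rightarrow> nat" where
  "acost (Lit k) = 1"
| "acost (Var x) = 1"
| "acost (Get a i) = acost i + 1"
| "acost (Plus a b) = acost a + acost b + 1"
| "acost (Minus a b) = acost a + acost b + 1"

fun bval :: "bexp \<Rightarrow> state \<Rightarrow> bool" where
  "bval (Less a b) s \<longleftrightarrow> aval a s < aval b s"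
| "bval (Equal a b) s \<longleftrightarrow> aval a s = aval b s"

fun bcost :: "bexp \<Rightarrow> nat" where
  "bcost (Less a b) = acost a + acost b + 1"
| "bcost (Equal a b) = acost a + acost b + 1"

text \<open>\<open>exec c s t s'\<close>: started in \<open>s\<close>, the program \<open>c\<close> halts in \<open>s'\<close> after exactly \<open>t\<close> time units.\<close>

inductive exec :: "com \<Rightarrow> state \<Rightarrow> nat \<Rightarrow> state \<Rightarrow> bool" where
  Skip: "exec SKIP s 1 s"
| Assign: "exec (x ::= a) s (acost a + 1) (s\<lparr>reg := (reg s)(x := aval a s)\<rparr>)"
| Put: "exec (x\<langle>i\<rangle> ::= a) s (acost i + acost a + 1)
          (s\<lparr>arr := (arr s)(x := (arr s x)(aval i s := aval a s))\<rparr>)"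
| Seq: "\<lbrakk>exec c1 s t1 s1; exec c2 s1 t2 s2\<rbrakk> \<Longrightarrow> exec (c1;; c2) s (t1 + t2) s2"
| IfTrue: "\<lbrakk>bval b s; exec c1 s t s'\<rbrakk> \<Longrightarrow> exec (IF b THEN c1 ELSE c2) s (bcost b + 1 + t) s'"
| IfFalse: "\<lbrakk>\<not> bval b s; exec c2 s t s'\<rbrakk> \<Longrightarrow> exec (IF b THEN c1 ELSE c2) s (bcost b + 1 + t) s'"
| WhileFalse: "\<not> bval b s \<Longrightarrow> exec (WHILE b DO c) s (bcost b + 1) s"
| WhileTrue: "\<lbrakk>bval b s; exec c s t1 s1; exec (WHILE b DO c) s1 t2 s2\<rbrakk>
   \<Longrightarrow> exec (WHILE b DO c) s (bcost b + 1 + t1 + t2) s2"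

abbreviation Incr :: "vname \<Rightarrow> com" where
  "Incr x \<equiv> x ::= Var x \<oplus> Lit 1"

abbreviation For :: "vname \<Rightarrow> aexp \<Rightarrow> aexp \<Rightarrow> com \<Rightarrow> com"
  (\<open>(FOR _/ FROM _/ TO _/ DO _)\<close> [1000, 0, 0, 61] 61) where
  "FOR x FROM a TO b DO c \<equiv> x ::= a;; WHILE (Var x \<prec> b) DO (c;; Incr x)"


section \<open>Algorithm B as a machine program\<close>

text \<open>The graph stored in the machine has vertex set \<open>{..<n}\<close>; the neighbors of \<open>v\<close> are listed
  without repetition, in any order, in the cells \<open>off v, \<dots>, off (v + 1) - 1\<close> of the array \<open>adj\<close>.\<close>

definition adjacency_lists ::
  "vname \<Rightarrow> vname \<Rightarrow> state \<Rightarrow> nat set \<Rightarrow> nat set set \<Rightarrow> bool" where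
  "adjacency_lists off adj s V E \<longleftrightarrow> V = {..<reg s ''n''} \<and>
     (\<forall>v\<in>V. arr s off v \<le> arr s off (v + 1) \<and>
        inj_on (arr s adj) {arr s off v..<arr s off (v + 1)} \<and>
        arr s adj ` {arr s off v..<arr s off (v + 1)} = nbrs E v)"

text \<open>From the adjacency lists \<open>off\<close>, \<open>adj\<close> of \<open>G\<close>, compute adjacency lists \<open>coff\<close>, \<open>cadj\<close> of its
  complement.\<close>

definition complement_prog :: com where
  "complement_prog =
    ''p'' ::= Lit 0;;
    ''coff''\<langle>Lit 0\<rangle> ::= Lit 0;;
    FOR ''v'' FROM Lit 0 TO Var ''n'' DO (
      FOR ''i'' FROM Lit 0 TO Var ''n'' DO ''mark''\<langle>Var ''i''\<rangle> ::= Lit 0;;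
      ''mark''\<langle>Var ''v''\<rangle> ::= Lit 1;;
      FOR ''j'' FROM ''off''\<langle>Var ''v''\<rangle> TO ''off''\<langle>Var ''v'' \<oplus> Lit 1\<rangle> DO
        ''mark''\<langle>''adj''\<langle>Var ''j''\<rangle>\<rangle> ::= Lit 1;;
      FOR ''i'' FROM Lit 0 TO Var ''n'' DO
        (IF ''mark''\<langle>Var ''i''\<rangle> \<doteq> Lit 0
         THEN (''cadj''\<langle>Var ''p''\<rangle> ::= Var ''i'';; Incr ''p'')
         ELSE SKIP);;
      ''coff''\<langle>Var ''v'' \<oplus> Lit 1\<rangle> ::= Var ''p'')"

text \<open>Lexicographic breadth-first search by partition refinement. The array \<open>ord\<close> is a permutation
  of the vertices with inverse \<open>pos\<close>; its first \<open>i\<close> entries are numbered. The unnumbered vertices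
  with equal labels form one class, occupying a contiguous block of \<open>ord\<close>, the blocks in order of
  decreasing label: \<open>cls u\<close> is the class of \<open>u\<close> and \<open>beg c\<close> the beginning of the block of \<open>c\<close>. A pivot
  splits each class \<open>c\<close> meeting its neighborhood: the neighbors move to a new class \<open>new c\<close> placed
  directly in front of \<open>c\<close>; \<open>stamp c = i + 1\<close> records that \<open>c\<close> has been split by the current pivot.\<close>

definition lexbfs_prog :: com where
  "lexbfs_prog =
    FOR ''i'' FROM Lit 0 TO Var ''n'' DO (
      ''ord''\<langle>Var ''i''\<rangle> ::= Var ''i'';;
      ''pos''\<langle>Var ''i''\<rangle> ::= Var ''i'';;
      ''cls''\<langle>Var ''i''\<rangle> ::= Lit 0);;
    ''ord''\<langle>Var ''start''\<rangle> ::= Lit 0;;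
    ''ord''\<langle>Lit 0\<rangle> ::= Var ''start'';;
    ''pos''\<langle>Lit 0\<rangle> ::= Var ''start'';;
    ''pos''\<langle>Var ''start''\<rangle> ::= Lit 0;;
    ''beg''\<langle>Lit 0\<rangle> ::= Lit 0;;
    ''stamp''\<langle>Lit 0\<rangle> ::= Lit 0;;
    ''k'' ::= Lit 1;;
    FOR ''i'' FROM Lit 0 TO Var ''n'' DO (
      ''v'' ::= ''ord''\<langle>Var ''i''\<rangle>;;
      ''beg''\<langle>''cls''\<langle>Var ''v''\<rangle>\<rangle> ::= Var ''i'' \<oplus> Lit 1;;
      FOR ''j'' FROM ''coff''\<langle>Var ''v''\<rangle> TO ''coff''\<langle>Var ''v'' \<oplus> Lit 1\<rangle> DO (
        ''u'' ::= ''cadj''\<langle>Var ''j''\<rangle>;;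
        ''x'' ::= ''pos''\<langle>Var ''u''\<rangle>;;
        (IF Var ''i'' \<prec> Var ''x''
         THEN (
           ''c'' ::= ''cls''\<langle>Var ''u''\<rangle>;;
           ''q'' ::= ''beg''\<langle>Var ''c''\<rangle>;;
           (IF ''stamp''\<langle>Var ''c''\<rangle> \<doteq> Var ''i'' \<oplus> Lit 1
            THEN SKIP
            ELSE (
              ''stamp''\<langle>Var ''c''\<rangle> ::= Var ''i'' \<oplus> Lit 1;;
              ''new''\<langle>Var ''c''\<rangle> ::= Var ''k'';;
              ''beg''\<langle>Var ''k''\<rangle> ::= Var ''q'';;
              ''stamp''\<langle>Var ''k''\<rangle> ::= Lit 0;;
              Incr ''k''));;
           ''w'' ::= ''ord''\<langle>Var ''q''\<rangle>;;
           ''ord''\<langle>Var ''x''\<rangle> ::= Var ''w'';;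
           ''pos''\<langle>Var ''w''\<rangle> ::= Var ''x'';;
           ''ord''\<langle>Var ''q''\<rangle> ::= Var ''u'';;
           ''pos''\<langle>Var ''u''\<rangle> ::= Var ''q'';;
           ''beg''\<langle>Var ''c''\<rangle> ::= Var ''q'' \<oplus> Lit 1;;
           ''cls''\<langle>Var ''u''\<rangle> ::= ''new''\<langle>Var ''c''\<rangle>)
         ELSE SKIP)))"

definition peo_prog :: com where
  "peo_prog =
    lexbfs_prog;;
    FOR ''i'' FROM Lit 0 TO Var ''n'' DO
      ''sigma''\<langle>Var ''i''\<rangle> ::= ''ord''\<langle>Var ''n'' \<ominus> Lit 1 \<ominus> Var ''i''\<rangle>"

text \<open>The while loop. \<open>S\<close> is \<open>{u. alive u = 1}\<close>, of size \<open>size\<close>, and the first \<open>h\<close> entries of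
  \<open>sigma\<close> are not in \<open>S\<close>. The \<open>k\<close>-th biclique is stored in the cells \<open>loff k, \<dots>, loff (k + 1) - 1\<close> of \<open>lout\<close> and
  \<open>roff k, \<dots>, roff (k + 1) - 1\<close> of \<open>rout\<close>; \<open>m\<close> counts the bicliques found so far.\<close>

definition loop_prog :: com where
  "loop_prog =
    FOR ''i'' FROM Lit 0 TO Var ''n'' DO ''alive''\<langle>Var ''i''\<rangle> ::= Lit 1;;
    ''size'' ::= Var ''n'';;
    ''h'' ::= Lit 0;;
    ''m'' ::= Lit 0;;
    ''loff''\<langle>Lit 0\<rangle> ::= Lit 0;;
    ''roff''\<langle>Lit 0\<rangle> ::= Lit 0;;
    WHILE Lit 0 \<prec> Var ''size'' DO (
      (WHILE ''alive''\<langle>''sigma''\<langle>Var ''h''\<rangle>\<rangle> \<doteq> Lit 0 DO Incr ''h'');;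
      ''v'' ::= ''sigma''\<langle>Var ''h''\<rangle>;;

      FOR ''i'' FROM Lit 0 TO Var ''n'' DO ''mark''\<langle>Var ''i''\<rangle> ::= Lit 0;;
      ''mark''\<langle>Var ''v''\<rangle> ::= Lit 1;;
      FOR ''j'' FROM ''coff''\<langle>Var ''v''\<rangle> TO ''coff''\<langle>Var ''v'' \<oplus> Lit 1\<rangle> DO
        ''mark''\<langle>''cadj''\<langle>Var ''j''\<rangle>\<rangle> ::= Lit 1;;
      ''p'' ::= ''loff''\<langle>Var ''m''\<rangle>;;
      FOR ''i'' FROM Lit 0 TO Var ''n'' DO
        (IF ''mark''\<langle>Var ''i''\<rangle> \<prec> ''alive''\<langle>Var ''i''\<rangle>
         THEN (
           ''inL''\<langle>Var ''i''\<rangle> ::= Lit 1;;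
           ''lout''\<langle>Var ''p''\<rangle> ::= Var ''i'';;
           Incr ''p'')
         ELSE ''inL''\<langle>Var ''i''\<rangle> ::= Lit 0);;

      ''q'' ::= ''roff''\<langle>Var ''m''\<rangle>;;
      ''rout''\<langle>Var ''q''\<rangle> ::= Var ''v'';;
      Incr ''q'';;
      FOR ''j'' FROM ''coff''\<langle>Var ''v''\<rangle> TO ''coff''\<langle>Var ''v'' \<oplus> Lit 1\<rangle> DO (
        ''u'' ::= ''cadj''\<langle>Var ''j''\<rangle>;;
        ''ok'' ::= ''alive''\<langle>Var ''u''\<rangle>;;
        FOR ''l'' FROM ''coff''\<langle>Var ''u''\<rangle> TO ''coff''\<langle>Var ''u'' \<oplus> Lit 1\<rangle> DO
          (IF ''inL''\<langle>''cadj''\<langle>Var ''l''\<rangle>\<rangle> \<doteq> Lit 1 THEN ''ok'' ::= Lit 0 ELSE SKIP);;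
        (IF Var ''ok'' \<doteq> Lit 1
         THEN (''rout''\<langle>Var ''q''\<rangle> ::= Var ''u'';; Incr ''q'')
         ELSE SKIP));;

      FOR ''i'' FROM ''roff''\<langle>Var ''m''\<rangle> TO Var ''q'' DO (
        ''alive''\<langle>''rout''\<langle>Var ''i''\<rangle>\<rangle> ::= Lit 0;;
        ''size'' ::= Var ''size'' \<ominus> Lit 1);;
      (IF ''loff''\<langle>Var ''m''\<rangle> \<prec> Var ''p''
       THEN (
         Incr ''m'';;
         ''loff''\<langle>Var ''m''\<rangle> ::= Var ''p'';;
         ''roff''\<langle>Var ''m''\<rangle> ::= Var ''q'')
       ELSE SKIP))"

definition algorithm_B_prog :: com where
  "algorithm_B_prog = complement_prog;; peo_prog;; loop_prog"

definition stored_ordering :: "state \<Rightarrow> nat list" where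
  "stored_ordering s = map (arr s ''sigma'') [0..<reg s ''n'']"

definition stored_bicliques :: "state \<Rightarrow> nat set set set" where
  "stored_bicliques s =
    {{arr s ''lout'' ` {arr s ''loff'' k..<arr s ''loff'' (k + 1)},
      arr s ''rout'' ` {arr s ''roff'' k..<arr s ''roff'' (k + 1)}} | k. k < reg s ''m''}"

end

theory Submission
  imports Defs
begin

text \<open>
  Reading the adjacency of a vertex to the first \<open>i\<close> visited vertices as an \<open>i\<close>-bit number turns the
  lexicographic order of labels into the order of natural numbers: the search always visits a vertex
  of largest key. Partition refinement keeps the unvisited vertices sorted by key, with the sets of
  equal key as classes; a pivot doubles all keys and adds one to those of its neighbors, which moves
  each of them to the front of its block. The work on a pivot is proportional to its degree, which
  gives linear time by amortization.

  In such an order, if \<open>a\<close>, \<open>b\<close>, \<open>c\<close> are visited in this order and \<open>a\<close> is adjacent to \<open>c\<close> but not to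
  \<open>b\<close>, then some vertex visited before \<open>a\<close> is adjacent to \<open>b\<close> but not to \<open>c\<close>. If the reverse order
  were not a perfect elimination ordering, there would be an induced path whose interior is visited
  after both of its ends. In a chordal graph the property above turns such a path into one whose later
  end is visited earlier, an infinite descent (Tarjan and Yannakakis).

  In the while loop the deleted vertices need not be removed from the adjacency lists: it suffices to
  ignore dead vertices. Every round costs \<open>O(|V| + |E\<^sup>c|)\<close> and deletes at least one vertex.
\<close>

section \<open>Perfect elimination orderings of chordal graphs\<close>

text \<open>The main obstacle is the state in the middle of a pivot, when some neighbors have been
  moved and others have not, so that the blocks belong to neither the old nor the new labels.
  Doubling frees the odd numbers: with \<open>2 * K u + 1\<close> for treated neighbors and
  \<open>2 * K u\<close> for all other vertices, every intermediate state is again sorted by keys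
  with classes of equal key, and parity records who has been treated. Moving one neighbor thus
  preserves a single invariant, which at the end of the pivot speaks of the next lexicographic key.

  Nothing is assumed about the initial memory beyond the input graph and start vertex, so fresh
  classes get their stamps written. The linear bound concerns the search alone; building the
  complement is quadratic, which the final bound absorbs in its \<open>|V|^2\<close> term. All
  bounds are explicit step counts, and the constant 1000 merely exceeds what they add up to.\<close>

lemma edge_commute: "{a, b} \<in> E \<longleftrightarrow> {b, a} \<in> E"
  by (simp add: insert_commute)

lemma simple_graph_no_loop: "simple_graph V E \<Longrightarrow> {v, v} \<notin> E"
  unfolding simple_graph_def by force

lemma simple_graph_edgeD: "simple_graph V E \<Longrightarrow> {u, v} \<in> E \<Longrightarrow> u \<in> V \<and> v \<in> V \<and> u \<noteq> v"
  unfolding simple_graph_def by force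

lemma finite_edges: "simple_graph V E \<Longrightarrow> finite E"
  unfolding simple_graph_def by (meson Pow_iff finite_Pow_iff finite_subset subsetI)

lemma nbrs_subset: "simple_graph V E \<Longrightarrow> nbrs E v \<subseteq> V"
  by (auto simp: nbrs_def dest: simple_graph_edgeD)

lemma nbrs_complement:
  assumes "v \<in> V"
  shows "nbrs (complement_edges V E) v = {u \<in> V. u \<noteq> v \<and> u \<notin> nbrs E v}"
  using assms by (auto simp: nbrs_def complement_edges_def card_insert_if)

text \<open>Counts pairs of a vertex and an edge through it in both orders. Neighbors inject into
  incident edges, which gives the direction that the running times need.\<close>

lemma sum_degrees_le:
  assumes "simple_graph V E"
  shows "(\<Sum>v\<in>V. card (nbrs E v)) \<le> 2 * card E"
proof -
  have fin: "finite V" "finite E" using assms finite_edges by (auto simp: simple_graph_def)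
  have "(\<Sum>v\<in>V. card (nbrs E v)) \<le> (\<Sum>v\<in>V. card {e \<in> E. v \<in> e})"
  proof (rule sum_mono)
    fix v
    have "inj_on (\<lambda>u. {v, u}) (nbrs E v)" by (auto simp: inj_on_def doubleton_eq_iff)
    moreover have "(\<lambda>u. {v, u}) ` nbrs E v \<subseteq> {e \<in> E. v \<in> e}" by (auto simp: nbrs_def)
    ultimately show "card (nbrs E v) \<le> card {e \<in> E. v \<in> e}"
      using fin by (intro card_inj_on_le) auto
  qed
  also have "\<dots> = (\<Sum>v\<in>V. \<Sum>e\<in>E. of_bool (v \<in> e))"
    using fin by (simp add: of_bool_def sum.If_cases Int_def)
  also have "\<dots> = (\<Sum>e\<in>E. \<Sum>v\<in>V. of_bool (v \<in> e))" by (rule sum.swap)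
  also have "\<dots> = (\<Sum>e\<in>E. card {v \<in> V. v \<in> e})"
    using fin by (simp add: of_bool_def sum.If_cases Int_def)
  also have "\<dots> = (\<Sum>e\<in>E. 2)"
  proof (rule sum.cong[OF refl])
    fix e assume "e \<in> E"
    then have "{v \<in> V. v \<in> e} = e" "card e = 2" using assms by (auto simp: simple_graph_def)
    then show "card {v \<in> V. v \<in> e} = 2" by simp
  qed
  finally show ?thesis by simp
qed

text \<open>Vertices are represented by their positions in the visiting order, and the path is oriented so
  that \<open>f 0\<close> is its later end.\<close>

definition late_interior_path :: "(nat \<Rightarrow> nat \<Rightarrow> bool) \<Rightarrow> nat \<Rightarrow> (nat \<Rightarrow> nat) \<Rightarrow> nat \<Rightarrow> bool" where
  "late_interior_path A n f k \<longleftrightarrow> 2 \<le> k \<and> (\<forall>i\<le>k. f i < n) \<and>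
     (\<forall>i j. i < j \<longrightarrow> j \<le> k \<longrightarrow> f i \<noteq> f j \<and> (A (f i) (f j) \<longleftrightarrow> j = Suc i)) \<and>
     f k < f 0 \<and> (\<forall>i. 0 < i \<longrightarrow> i < k \<longrightarrow> f 0 < f i)"

text \<open>Apply \<open>visit\<close> to \<open>f k\<close>, \<open>f 0\<close>,
  \<open>f (k - 1)\<close>: it yields \<open>d\<close> before the whole path, adjacent to
  \<open>f 0\<close> but not to \<open>f (k - 1)\<close>. Let \<open>f j\<close> be the last
  neighbor of \<open>d\<close> before \<open>f k\<close>. If \<open>d\<close> is adjacent to
  \<open>f k\<close>, then \<open>d, f j, ..., f k\<close> is a chordless cycle; if not,
  \<open>f k, ..., f j, d\<close> is a path of the same kind whose later end \<open>f k\<close>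
  precedes \<open>f 0\<close>.\<close>

lemma no_late_interior_path:
  fixes \<tau> :: "nat \<Rightarrow> 'a" and E :: "'a set set"
  defines "A \<equiv> \<lambda>i j. {\<tau> i, \<tau> j} \<in> E"
  assumes chordal: "chordal V E" and inj: "inj_on \<tau> {..<n}"
    and visit: "\<And>a b c. a < b \<Longrightarrow> b < c \<Longrightarrow> c < n \<Longrightarrow> A a c \<Longrightarrow> \<not> A a b \<Longrightarrow>
      \<exists>d<a. A d b \<and> \<not> A d c"
  shows "\<not> late_interior_path A n f k"
proof (induction "f 0" arbitrary: f k rule: less_induct)
  case less
  show ?case
  proof
    assume path: "late_interior_path A n f k"
    have k: "2 \<le> k" and fn: "\<And>i. i \<le> k \<Longrightarrow> f i < n"
      and neq: "\<And>i j. i < j \<Longrightarrow> j \<le> k \<Longrightarrow> f i \<noteq> f j"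
      and adj: "\<And>i j. i < j \<Longrightarrow> j \<le> k \<Longrightarrow> A (f i) (f j) \<longleftrightarrow> j = Suc i"
      and ends: "f k < f 0" and interior: "\<And>i. 0 < i \<Longrightarrow> i < k \<Longrightarrow> f 0 < f i"
      using path unfolding late_interior_path_def by blast+
    have sym: "A i j \<longleftrightarrow> A j i" for i j unfolding A_def by (rule edge_commute)
    have "\<exists>d<f k. A d (f 0) \<and> \<not> A d (f (k - 1))"
    proof (rule visit)
      show "f 0 < f (k - 1)" using interior[of "k - 1"] k by simp
      show "A (f k) (f (k - 1))" using adj[of "k - 1" k] k sym by auto
      show "\<not> A (f k) (f 0)" using adj[of 0 k] k sym by auto
    qed (use ends fn k in auto)
    then obtain d where d: "d < f k" "A d (f 0)" "\<not> A d (f (k - 1))" by blast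
    have dlt: "d < f i" if "i \<le> k" for i
      using d(1) ends interior[of i] that by (cases "i = 0"; cases "i = k") force+
    define j where "j = Max {j. j < k \<and> A d (f j)}"
    have jset: "finite {j. j < k \<and> A d (f j)}" "{j. j < k \<and> A d (f j)} \<noteq> {}"
      using d(2) k by (auto intro!: exI[of _ 0])
    have j: "j < k" "A d (f j)" using Max_in[OF jset] unfolding j_def by auto
    have jmax: "\<not> A d (f i)" if "j < i" "i < k" for i
      using Max_ge[OF jset(1), of i] that unfolding j_def by (metis (mono_tags, lifting) mem_Collect_eq not_le)
    \<comment> \<open>The choice of \<open>d\<close> excludes \<open>j = k - 1\<close>; hence the
      cycle below has \<open>k - j + 2 \<ge> 4\<close> vertices and the new path has length at least
      3.\<close>
    have j2: "j + 2 \<le> k" using j d(3) by (cases "j = k - 1") auto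
    show False
    proof (cases "A d (f k)")
      case True
      define g where "g = (\<lambda>i. if i = 0 then d else f (i - 1 + j))"
      define m where "m = k - j + 2"
      define c where "c = map (\<lambda>i. \<tau> (g i)) [0..<m]"
      have len: "length c = m" and nth: "\<And>i. i < m \<Longrightarrow> c ! i = \<tau> (g i)"
        unfolding c_def by simp_all
      have gn: "g i < n" if "i < m" for i
        using that fn less_trans[OF dlt[of 0] fn[of 0]] j unfolding g_def m_def by auto
      have ginj: "i = i'" if "i < m" "i' < m" "g i = g i'" for i i'
      proof (rule ccontr)
        have aux: "g a \<noteq> g b" if "a < b" "b < m" for a b
        proof -
          have "b - 1 + j \<le> k" "a \<noteq> 0 \<Longrightarrow> a - 1 + j < b - 1 + j" using that j(1) unfolding m_def by auto
          then show ?thesis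
            using dlt[of "b - 1 + j"] neq[of "a - 1 + j" "b - 1 + j"] that unfolding g_def
            by (cases "a = 0") (simp_all only: if_True if_False, auto)
        qed
        assume "i \<noteq> i'" then show False using aux[of i i'] aux[of i' i] that by fastforce
      qed
      have "distinct c"
        unfolding c_def distinct_map using ginj gn inj
        by (auto simp: inj_on_def)
      have gadj: "A (g a) (g b) \<longleftrightarrow> b = Suc a \<or> (a = 0 \<and> Suc b = m)" if "a < b" "b < m" for a b
      proof (cases "a = 0")
        case True
        have "A d (f (b - 1 + j)) \<longleftrightarrow> b = 1 \<or> Suc b = m"
        proof (cases "b = 1 \<or> Suc b = m")
          case True
          then show ?thesis using j \<open>A d (f k)\<close> unfolding m_def by auto
        next
          case False
          then have "j < b - 1 + j" "b - 1 + j < k" using that j(1) unfolding m_def by linarith+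
          then show ?thesis using jmax False by blast
        qed
        then show ?thesis using True that unfolding g_def by auto
      next
        case False
        then show ?thesis using adj[of "a - 1 + j" "b - 1 + j"] that j(1) unfolding g_def m_def by auto
      qed
      have "is_cycle E c"
        unfolding is_cycle_def
      proof (intro conjI allI impI)
        show "3 \<le> length c" using j2 unfolding len m_def by simp
        fix i assume "i < length c"
        then have i: "i < m" using len by simp
        show "{c ! i, c ! (Suc i mod length c)} \<in> E"
        proof (cases "Suc i = m")
          case True
          then have "A (g 0) (g i)" using gadj[of 0 i] j2 unfolding m_def by auto
          then show ?thesis using True nth i len sym unfolding A_def by (simp add: insert_commute)
        next
          case False
          then show ?thesis using gadj[of i "Suc i"] nth i len unfolding A_def by simp
        qed
      qed fact
      moreover have "4 \<le> length c" using j2 unfolding len m_def by simp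
      ultimately have "has_chord E c" using chordal unfolding chordal_def by blast
      then obtain a b where ab: "a < b" "b < m" "b \<noteq> Suc a" "\<not> (a = 0 \<and> Suc b = m)"
          "{c ! a, c ! b} \<in> E"
        unfolding has_chord_def len by blast
      then show False using gadj[of a b] nth unfolding A_def by auto
    next
      case False
      \<comment> \<open>The orientation is reversed: the former earlier end \<open>f k\<close>
        becomes the later end, and \<open>d\<close>, put last, precedes it.\<close>
      define g where "g = (\<lambda>i. if i \<le> k - j then f (k - i) else d)"
      have "late_interior_path A n g (k - j + 1)"
        unfolding late_interior_path_def
      proof (intro conjI allI impI)
        fix a b assume ab: "a < b" "b \<le> k - j + 1"
        have lt: "k - b < k - a" if "b \<le> k - j" using ab that by linarith
        show "g a \<noteq> g b"
          using ab neq[OF lt] dlt[of "k - a"] unfolding g_def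
          by (metis diff_le_self less_imp_le_nat less_irrefl_nat less_le_trans not_less_eq_eq add.commute plus_1_eq_Suc)
        show "A (g a) (g b) \<longleftrightarrow> b = Suc a"
        proof (cases "b = k - j + 1")
          case True
          have "A d (f (k - a)) \<longleftrightarrow> k - a = j"
            using False j jmax[of "k - a"] ab True by (cases "a = 0") force+
          then show ?thesis using True ab sym j unfolding g_def by auto
        next
          case False
          then have b: "b \<le> k - j" using ab by simp
          then have "k - a = Suc (k - b) \<longleftrightarrow> b = Suc a" using ab by linarith
          then show ?thesis using ab b adj[OF lt[OF b]] sym[of "f (k - a)"] unfolding g_def by simp
        qed
      next
        fix i assume i: "0 < i" "i < k - j + 1"
        then have "i = k \<or> 0 < k - i \<and> k - i < k" by linarith
        then show "g 0 < g i"
          using ends interior[of "k - i"] i unfolding g_def by auto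
      qed (use j2 fn d less_trans[OF d(1) fn[of k]] in \<open>auto simp: g_def\<close>)
      moreover have "g 0 < f 0" using ends unfolding g_def by simp
      ultimately show False using less by blast
    qed
  qed
qed

text \<open>Two nonadjacent neighbors of \<open>c\<close> that precede it form with \<open>c\<close>
  an induced path \<open>a, c, b\<close>, the case \<open>k = 2\<close> of the forbidden paths.
  Longer ones arise only within the descent.\<close>

lemma perfect_elimination_ordering_rev:
  fixes \<tau> :: "nat \<Rightarrow> 'a"
  assumes chordal: "chordal V E" and bij: "bij_betw \<tau> {..<n} V"
    and visit: "\<And>a b c. a < b \<Longrightarrow> b < c \<Longrightarrow> c < n \<Longrightarrow> {\<tau> a, \<tau> c} \<in> E \<Longrightarrow> {\<tau> a, \<tau> b} \<notin> E \<Longrightarrow>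
      \<exists>d<a. {\<tau> d, \<tau> b} \<in> E \<and> {\<tau> d, \<tau> c} \<notin> E"
  shows "perfect_elimination_ordering V E (rev (map \<tau> [0..<n]))"
proof -
  let ?A = "\<lambda>i j. {\<tau> i, \<tau> j} \<in> E"
  have inj: "inj_on \<tau> {..<n}" and img: "\<tau> ` {..<n} = V" using bij by (auto simp: bij_betw_def)
  have sg: "simple_graph V E" using chordal by (simp add: chordal_def)
  have no_path: "\<not> late_interior_path ?A n f k" for f k
    using chordal inj visit by (intro no_late_interior_path) auto
  have key: "?A a b" if "b < a" "a < c" "c < n" "?A c a" "?A c b" for a b c
  proof (rule ccontr)
    assume nadj: "\<not> ?A a b"
    have "{\<tau> b, \<tau> a} \<notin> E" "{\<tau> a, \<tau> c} \<in> E" using nadj that by (simp_all add: insert_commute)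
    then have "late_interior_path ?A n (\<lambda>i. if i = 0 then a else if i = 1 then c else b) 2"
      using that nadj unfolding late_interior_path_def by (auto simp: insert_commute)
    then show False using no_path by blast
  qed
  show ?thesis
    unfolding perfect_elimination_ordering_def
  proof (intro conjI allI impI)
    show "distinct (rev (map \<tau> [0..<n]))" using inj by (simp add: distinct_map atLeast0LessThan)
    show "set (rev (map \<tau> [0..<n])) = V" using img by (simp add: atLeast0LessThan)
    fix i assume "i < length (rev (map \<tau> [0..<n]))"
    then have i: "i < n" by simp
    \<comment> \<open>Position \<open>i\<close> of the reversed list is visit number
      \<open>c\<close>, and the list from there on consists of the vertices visited no later than
      \<open>c\<close>.\<close>
    define c where "c = n - 1 - i"
    have c: "c < n" "n - i = Suc c" using i unfolding c_def by auto
    have nthc: "rev (map \<tau> [0..<n]) ! i = \<tau> c"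
      using i by (simp add: rev_nth c_def)
    have dr: "set (drop i (rev (map \<tau> [0..<n]))) = \<tau> ` {..c}"
      using c by (simp add: drop_rev take_map atLeast0LessThan lessThan_Suc_atMost del: lessThan_Suc upt_Suc)
    show "is_clique E (nbrs E (rev (map \<tau> [0..<n]) ! i) \<inter> set (drop i (rev (map \<tau> [0..<n]))))"
      unfolding nthc dr is_clique_def
    proof (intro ballI impI)
      fix u w assume u: "u \<in> nbrs E (\<tau> c) \<inter> \<tau> ` {..c}" and w: "w \<in> nbrs E (\<tau> c) \<inter> \<tau> ` {..c}"
        and "u \<noteq> w"
      obtain a b where ab: "u = \<tau> a" "a \<le> c" "w = \<tau> b" "b \<le> c" using u w by auto
      have A: "?A c a" "?A c b" using u w ab by (auto simp: nbrs_def)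
      have lt: "a < c" "b < c" "a \<noteq> b"
        using A ab sg \<open>u \<noteq> w\<close> simple_graph_no_loop[of V E] by (metis le_neq_implies_less)+
      show "{u, w} \<in> E"
        using key[of a b c] key[of b a c] lt A c ab by (metis edge_commute linorder_neqE_nat)
    qed
  qed
qed

section \<open>Lexicographic breadth-first search\<close>

text \<open>The first \<open>i\<close> vertices \<open>\<tau> 0, \<dots>, \<tau> (i - 1)\<close> give every vertex \<open>u\<close> a word of \<open>i\<close> bits. Read as
  binary numbers, these words are ordered like the labels of the search.\<close>

fun lex_key :: "'a set set \<Rightarrow> (nat \<Rightarrow> 'a) \<Rightarrow> nat \<Rightarrow> 'a \<Rightarrow> nat" where
  "lex_key E \<tau> 0 u = 0"
| "lex_key E \<tau> (Suc i) u = 2 * lex_key E \<tau> i u + of_bool (u \<in> nbrs E (\<tau> i))"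

lemma lex_key_cong: "(\<And>j. j < i \<Longrightarrow> \<tau> j = \<tau>' j) \<Longrightarrow> lex_key E \<tau> i u = lex_key E \<tau>' i u"
  by (induction i) auto

lemma lex_key_eqD:
  "lex_key E \<tau> i u = lex_key E \<tau> i w \<Longrightarrow> j < i \<Longrightarrow> {\<tau> j, u} \<in> E \<longleftrightarrow> {\<tau> j, w} \<in> E"
proof (induction i)
  case (Suc i)
  have "lex_key E \<tau> i u = lex_key E \<tau> i w \<and> (u \<in> nbrs E (\<tau> i) \<longleftrightarrow> w \<in> nbrs E (\<tau> i))"
    using Suc.prems(1) by (auto simp: of_bool_def split: if_splits) presburger+
  then show ?case using Suc by (cases "j = i") (auto simp: nbrs_def)
qed simp

text \<open>The witness is the most significant bit in which the two words differ: doubling shifts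
  older bits up, so a difference created earlier outweighs all later ones.\<close>

lemma lex_key_lessD:
  "lex_key E \<tau> i w < lex_key E \<tau> i u \<Longrightarrow>
    \<exists>j<i. {\<tau> j, u} \<in> E \<and> {\<tau> j, w} \<notin> E \<and> (\<forall>l<j. {\<tau> l, u} \<in> E \<longleftrightarrow> {\<tau> l, w} \<in> E)"
proof (induction i)
  case (Suc i)
  show ?case
  proof (cases "lex_key E \<tau> i w < lex_key E \<tau> i u")
    case True
    then show ?thesis using Suc.IH less_Suc_eq by blast
  next
    case False
    then have "lex_key E \<tau> i u = lex_key E \<tau> i w \<and> u \<in> nbrs E (\<tau> i) \<and> w \<notin> nbrs E (\<tau> i)"
      using Suc.prems by (auto simp: of_bool_def split: if_splits)
    then show ?thesis using lex_key_eqD[of E \<tau> i u w] by (auto simp: nbrs_def)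
  qed
qed simp

text \<open>The loop counter \<open>n - j\<close> decreases as \<open>j\<close> grows, so a label in
  decreasing order lists the visited neighbors in visiting order. With \<open>i \<le> n\<close> the
  truncated subtraction is injective.\<close>

lemma rev_sorted_list_of_label:
  assumes "i \<le> n"
  shows "rev (sorted_list_of_set {n - j |j. j < i \<and> P j}) = map (\<lambda>j. n - j) (filter P [0..<i])"
proof -
  let ?xs = "rev (map (\<lambda>j. n - j) (filter P [0..<i]))"
  have inj: "inj_on (\<lambda>j. n - j) {..<i}" using assms by (auto simp: inj_on_def)
  have "set ?xs = {n - j |j. j < i \<and> P j}" by auto
  moreover have "sorted ?xs"
  proof -
    have "sorted_wrt (<) (filter P [0..<i])" by (rule sorted_wrt_filter) simp
    then have "sorted_wrt (\<lambda>a b. n - b \<le> n - a) (filter P [0..<i])"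
      by (rule sorted_wrt_mono_rel[rotated]) auto
    then show ?thesis by (simp add: sorted_wrt_rev sorted_wrt_map)
  qed
  moreover have "distinct ?xs"
    using inj by (auto simp: distinct_map intro: inj_on_subset)
  ultimately have "sorted_list_of_set {n - j |j. j < i \<and> P j} = ?xs"
    using sorted_list_of_set.idem_if_sorted_distinct[of ?xs] by metis
  then show ?thesis by simp
qed

lemma label_less_irrefl: "\<not> label_less A A"
  unfolding label_less_def using lexord_irreflexive[of "{(x, y :: nat). x < y}"] by simp

text \<open>Up to the first distinguishing vertex \<open>j\<close> both words agree. Then the word
  of \<open>u\<close> continues with \<open>n - j\<close>, while that of \<open>w\<close> ends or
  continues with a smaller number, because only later visits are left to be listed.\<close>

lemma not_label_less_of_lex_key:
  assumes "i \<le> n" and le: "lex_key E \<tau> i w \<le> lex_key E \<tau> i u"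
  shows "\<not> label_less {n - j |j. j < i \<and> {\<tau> j, u} \<in> E} {n - j |j. j < i \<and> {\<tau> j, w} \<in> E}"
proof (cases "lex_key E \<tau> i w = lex_key E \<tau> i u")
  case True
  then have "{n - j |j. j < i \<and> {\<tau> j, u} \<in> E} = {n - j |j. j < i \<and> {\<tau> j, w} \<in> E}"
    using lex_key_eqD[OF True] by blast
  then show ?thesis using label_less_irrefl by simp
next
  case False
  define P where "P = (\<lambda>u j. {\<tau> j, u} \<in> E)"
  obtain j where j: "j < i" "P u j" "\<not> P w j" "\<And>l. l < j \<Longrightarrow> P u l \<longleftrightarrow> P w l"
    using lex_key_lessD[of E \<tau> i w u] le False unfolding P_def by force
  have split: "[0..<i] = [0..<j] @ j # [Suc j..<i]"
    using j(1) upt_add_eq_append[of 0 j "i - j"] upt_conv_Cons[of j i] by simp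
  define ws where "ws = map ((-) n) (filter (P w) [0..<j])"
  have pre: "map ((-) n) (filter (P u) [0..<j]) = ws"
    unfolding ws_def using j(4) by (auto intro!: arg_cong[of _ _ "map _"] filter_cong)
  define us where "us = map ((-) n) (filter (P u) [Suc j..<i])"
  define zs where "zs = map ((-) n) (filter (P w) [Suc j..<i])"
  have zs: "z < n - j" if "z \<in> set zs" for z
    using that assms(1) unfolding zs_def by auto
  have "(ws @ (n - j) # us, ws @ zs) \<notin> lexord {(x, y). x < y}"
  proof
    assume "(ws @ (n - j) # us, ws @ zs) \<in> lexord {(x, y). x < y}"
    then have "((n - j) # us, zs) \<in> lexord {(x, y). x < y}"
      by (rule lexord_append_leftD) simp
    then show False using zs by (cases zs) fastforce+
  qed
  moreover have "rev (sorted_list_of_set {n - j |j. j < i \<and> P u j}) = ws @ (n - j) # us"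
    using rev_sorted_list_of_label[OF assms(1), of "P u"] j(2) pre us_def by (simp add: split)
  moreover have "rev (sorted_list_of_set {n - j |j. j < i \<and> P w j}) = ws @ zs"
    using rev_sorted_list_of_label[OF assms(1), of "P w"] j(3) ws_def zs_def by (simp add: split)
  ultimately show ?thesis unfolding label_less_def P_def by simp
qed

text \<open>Only the labels of unnumbered vertices are described, since numbered ones are never
  compared again. The start vertex carries its artificial label \<open>{card V}\<close> while
  nothing is numbered, which no bit word expresses; hence the separate case \<open>i = 0\<close> in
  the induction.\<close>

lemma lexbfs_ordering_of_lex_key:
  fixes \<tau> :: "nat \<Rightarrow> 'a"
  assumes bij: "bij_betw \<tau> {..<n} V" and "0 < n"
    and sorted: "\<And>x y. x < y \<Longrightarrow> y < n \<Longrightarrow> lex_key E \<tau> x (\<tau> y) \<le> lex_key E \<tau> x (\<tau> x)"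
  shows "lexbfs_ordering V E (\<tau> 0) (map \<tau> [0..<n])"
proof -
  have inj: "inj_on \<tau> {..<n}" and img: "V = \<tau> ` {..<n}" using bij by (auto simp: bij_betw_def)
  have cV: "card V = n" using inj img by (simp add: card_image)
  have outside: "V - set (map \<tau> [0..<i]) = \<tau> ` {i..<n}" if "i \<le> n" for i
  proof -
    have "V - \<tau> ` {..<i} = \<tau> ` ({..<n} - {..<i})"
      unfolding img using inj that by (subst inj_on_image_set_diff[of \<tau> "{..<n}"]) auto
    moreover have "{..<n} - {..<i} = {i..<n}" by auto
    ultimately show ?thesis by (simp add: atLeast0LessThan)
  qed
  have "\<exists>lab. lexbfs_run V E (\<tau> 0) (map \<tau> [0..<i]) lab \<and>
      (if i = 0 then lab = (\<lambda>w. if w = \<tau> 0 then {card V} else {})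
       else \<forall>w\<in>V - set (map \<tau> [0..<i]). lab w = {n - j |j. j < i \<and> {\<tau> j, w} \<in> E})"
    if "i \<le> n" for i
    using that
  proof (induction i)
    case 0
    have "\<tau> 0 \<in> V" using img \<open>0 < n\<close> by auto
    then show ?case using lexbfs_run.init[of "\<tau> 0" V E]
      by (intro exI[of _ "\<lambda>w. if w = \<tau> 0 then {card V} else {}"]) simp
  next
    case (Suc i)
    then have "i \<le> n" by simp
    from Suc.IH[OF this] obtain lab where run: "lexbfs_run V E (\<tau> 0) (map \<tau> [0..<i]) lab"
      and lab: "if i = 0 then lab = (\<lambda>w. if w = \<tau> 0 then {card V} else {})
       else \<forall>w\<in>V - set (map \<tau> [0..<i]). lab w = {n - j |j. j < i \<and> {\<tau> j, w} \<in> E}"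
      by blast
    let ?lab = "\<lambda>w. if w \<in> V - set (map \<tau> [0..<i] @ [\<tau> i]) \<and> w \<in> nbrs E (\<tau> i)
             then insert (card V - length (map \<tau> [0..<i])) (lab w) else lab w"
    have out: "V - set (map \<tau> [0..<i]) = \<tau> ` {i..<n}" using outside Suc.prems by simp
    have out': "V - set (map \<tau> [0..<i] @ [\<tau> i]) = \<tau> ` {Suc i..<n}"
      using outside[OF Suc.prems] by simp
    have maximal: "\<not> label_less (lab (\<tau> i)) (lab w)" if w: "w \<in> V - set (map \<tau> [0..<i])" for w
    proof (cases "i = 0")
      case True
      then show ?thesis using lab label_less_irrefl[of "{card V}"] by (auto simp: label_less_def)
    next
      case False
      obtain y where y: "w = \<tau> y" "i \<le> y" "y < n" using w unfolding out by (auto simp del: set_map)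
      have "lex_key E \<tau> i w \<le> lex_key E \<tau> i (\<tau> i)"
        using sorted[of i y] y by (cases "y = i") auto
      moreover have "\<tau> i \<in> V - set (map \<tau> [0..<i])" using Suc.prems unfolding out by simp
      ultimately show ?thesis
        using not_label_less_of_lex_key[of i n E \<tau> w "\<tau> i"] lab False that Suc.prems by simp
    qed
    have \<tau>i: "\<tau> i \<in> V - set (map \<tau> [0..<i])" using Suc.prems unfolding out by simp
    have run': "lexbfs_run V E (\<tau> 0) (map \<tau> [0..<i] @ [\<tau> i]) ?lab"
      using \<tau>i maximal by (intro lexbfs_run.step[OF run] ballI)
    have lab': "?lab w = {n - j |j. j < Suc i \<and> {\<tau> j, w} \<in> E}"
      if w: "w \<in> V - set (map \<tau> [0..<i] @ [\<tau> i])" for w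
    proof -
      obtain y where y: "w = \<tau> y" "i < y" "y < n" using w unfolding out' by (auto simp del: set_map set_append)
      have labw: "lab w = {n - j |j. j < i \<and> {\<tau> j, w} \<in> E}"
      proof (cases "i = 0")
        case True
        \<comment> \<open>The start vertex is the one being numbered, so \<open>w\<close> still has
          the empty label, as the formula for \<open>i = 0\<close> demands.\<close>
        have "w \<noteq> \<tau> 0" using w True by auto
        then show ?thesis using lab True by simp
      next
        case False
        have "w \<in> V - set (map \<tau> [0..<i])" using w by auto
        then show ?thesis using lab False by simp
      qed
      have "{n - j |j. j < Suc i \<and> {\<tau> j, w} \<in> E} =
          (if {\<tau> i, w} \<in> E then insert (n - i) (lab w) else lab w)"
        unfolding labw by (auto simp: less_Suc_eq)
      then show ?thesis using w by (simp add: cV nbrs_def)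
    qed
    have eq: "map \<tau> [0..<Suc i] = map \<tau> [0..<i] @ [\<tau> i]" by simp
    show ?case
      unfolding eq if_not_P[OF nat.distinct(2)]
      by (intro exI[of _ ?lab] conjI ballI run' lab')
  qed
  from this[of n] obtain lab where "lexbfs_run V E (\<tau> 0) (map \<tau> [0..<n]) lab" by blast
  then show ?thesis unfolding lexbfs_ordering_def by (auto simp: cV)
qed

text \<open>Since \<open>b\<close> was preferred to \<open>c\<close>, the first vertex that
  separates them is adjacent to \<open>b\<close>. As \<open>a\<close> separates them too, but in
  favor of \<open>c\<close>, that first vertex lies strictly before \<open>a\<close>.\<close>

lemma three_point_of_lex_key:
  assumes sorted: "\<And>x y. x < y \<Longrightarrow> y < n \<Longrightarrow> lex_key E \<tau> x (\<tau> y) \<le> lex_key E \<tau> x (\<tau> x)"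
    and "a < b" "b < c" "c < n" "{\<tau> a, \<tau> c} \<in> E" "{\<tau> a, \<tau> b} \<notin> E"
  shows "\<exists>d<a. {\<tau> d, \<tau> b} \<in> E \<and> {\<tau> d, \<tau> c} \<notin> E"
proof -
  have "lex_key E \<tau> b (\<tau> c) \<noteq> lex_key E \<tau> b (\<tau> b)"
    using lex_key_eqD[of E \<tau> b "\<tau> c" "\<tau> b" a] assms(2,5,6) by blast
  then have "lex_key E \<tau> b (\<tau> c) < lex_key E \<tau> b (\<tau> b)"
    using sorted[OF assms(3,4)] by linarith
  from lex_key_lessD[OF this] obtain j where j: "{\<tau> j, \<tau> b} \<in> E" "{\<tau> j, \<tau> c} \<notin> E"
      "\<forall>l<j. {\<tau> l, \<tau> b} \<in> E \<longleftrightarrow> {\<tau> l, \<tau> c} \<in> E"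
    by blast
  have "j \<noteq> a" "\<not> a < j" using j assms(5,6) by blast+
  then show ?thesis using j by (intro exI[of _ j]) simp
qed

section \<open>Timed execution\<close>

fun written_regs :: "com \<Rightarrow> vname set" where
  "written_regs SKIP = {}"
| "written_regs (x ::= a) = {x}"
| "written_regs (x\<langle>i\<rangle> ::= a) = {}"
| "written_regs (c1;; c2) = written_regs c1 \<union> written_regs c2"
| "written_regs (IF b THEN c1 ELSE c2) = written_regs c1 \<union> written_regs c2"
| "written_regs (WHILE b DO c) = written_regs c"

fun written_arrs :: "com \<Rightarrow> vname set" where
  "written_arrs SKIP = {}"
| "written_arrs (x ::= a) = {}"
| "written_arrs (x\<langle>i\<rangle> ::= a) = {x}"
| "written_arrs (c1;; c2) = written_arrs c1 \<union> written_arrs c2"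
| "written_arrs (IF b THEN c1 ELSE c2) = written_arrs c1 \<union> written_arrs c2"
| "written_arrs (WHILE b DO c) = written_arrs c"

definition frame :: "com \<Rightarrow> state \<Rightarrow> state \<Rightarrow> bool" where
  "frame c s s' \<longleftrightarrow> (\<forall>x. x \<notin> written_regs c \<longrightarrow> reg s' x = reg s x) \<and>
     (\<forall>a. a \<notin> written_arrs c \<longrightarrow> arr s' a = arr s a)"

lemma exec_frame: "exec c s t s' \<Longrightarrow> frame c s s'"
  by (induction rule: exec.induct) (auto simp: frame_def)

text \<open>The existential form includes termination, and the postcondition receives the exact
  time, so for straight-line code the simplifier computes end state and cost together.\<close>

definition wp :: "com \<Rightarrow> (nat \<Rightarrow> state \<Rightarrow> bool) \<Rightarrow> state \<Rightarrow> bool" where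
  "wp c Q s \<longleftrightarrow> (\<exists>t s'. exec c s t s' \<and> Q t s')"

abbreviation runs :: "com \<Rightarrow> state \<Rightarrow> nat \<Rightarrow> (state \<Rightarrow> bool) \<Rightarrow> bool" where
  "runs c s T P \<equiv> wp c (\<lambda>t s'. t \<le> T \<and> P s') s"

lemma runsE:
  assumes "runs c s T P"
  obtains t s' where "exec c s t s'" "t \<le> T" "P s'" "frame c s s'"
  using assms exec_frame unfolding wp_def by blast

lemma runsI: "exec c s t s' \<Longrightarrow> t \<le> T \<Longrightarrow> P s' \<Longrightarrow> runs c s T P"
  unfolding wp_def by blast

lemma wp_mono: "wp c Q s \<Longrightarrow> (\<And>t s'. frame c s s' \<Longrightarrow> Q t s' \<Longrightarrow> Q' t s') \<Longrightarrow> wp c Q' s"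
  unfolding wp_def using exec_frame by blast

text \<open>Keeps the simplifier out of the postcondition until the state that it is about is known.\<close>

lemma wp_weak_cong [cong]: "s = s' \<Longrightarrow> wp c Q s = wp c Q s'"
  by simp

inductive_cases SkipE: "exec SKIP s t s'"
inductive_cases AssignE: "exec (x ::= a) s t s'"
inductive_cases PutE: "exec (x\<langle>i\<rangle> ::= a) s t s'"
inductive_cases SeqE: "exec (c1;; c2) s t s'"
inductive_cases IfE: "exec (IF b THEN c1 ELSE c2) s t s'"

lemma wp_Skip: "wp SKIP Q s \<longleftrightarrow> Q 1 s"
proof
  show "wp SKIP Q s \<Longrightarrow> Q 1 s" unfolding wp_def by (auto elim!: SkipE)
  show "Q 1 s \<Longrightarrow> wp SKIP Q s" unfolding wp_def using exec.Skip by blast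
qed

lemma wp_Assign: "wp (x ::= a) Q s \<longleftrightarrow> Q (acost a + 1) (s\<lparr>reg := (reg s)(x := aval a s)\<rparr>)"
  (is "_ \<longleftrightarrow> ?R")
proof
  show "wp (x ::= a) Q s \<Longrightarrow> ?R" unfolding wp_def by (auto elim!: AssignE)
  show "?R \<Longrightarrow> wp (x ::= a) Q s" unfolding wp_def using exec.Assign by blast
qed

lemma wp_Put: "wp (x\<langle>i\<rangle> ::= a) Q s \<longleftrightarrow>
    Q (acost i + acost a + 1) (s\<lparr>arr := (arr s)(x := (arr s x)(aval i s := aval a s))\<rparr>)"
  (is "_ \<longleftrightarrow> ?R")
proof
  show "wp (x\<langle>i\<rangle> ::= a) Q s \<Longrightarrow> ?R" unfolding wp_def by (auto elim!: PutE)
  show "?R \<Longrightarrow> wp (x\<langle>i\<rangle> ::= a) Q s" unfolding wp_def using exec.Put by blast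
qed

lemma wp_Seq: "wp (c1;; c2) Q s \<longleftrightarrow> wp c1 (\<lambda>t1 s1. wp c2 (\<lambda>t2 s2. Q (t1 + t2) s2) s1) s"
proof
  assume "wp (c1;; c2) Q s"
  then obtain t s' where "exec (c1;; c2) s t s'" "Q t s'" unfolding wp_def by blast
  then show "wp c1 (\<lambda>t1 s1. wp c2 (\<lambda>t2 s2. Q (t1 + t2) s2) s1) s"
    unfolding wp_def by (elim SeqE) blast
next
  assume "wp c1 (\<lambda>t1 s1. wp c2 (\<lambda>t2 s2. Q (t1 + t2) s2) s1) s"
  then show "wp (c1;; c2) Q s" unfolding wp_def using exec.Seq by blast
qed

lemma wp_If: "wp (IF b THEN c1 ELSE c2) Q s \<longleftrightarrow>
    (if bval b s then wp c1 (\<lambda>t s'. Q (bcost b + 1 + t) s') s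
     else wp c2 (\<lambda>t s'. Q (bcost b + 1 + t) s') s)"
  proof
  assume "wp (IF b THEN c1 ELSE c2) Q s"
  then obtain t s' where "exec (IF b THEN c1 ELSE c2) s t s'" "Q t s'" unfolding wp_def by blast
  then show "if bval b s then wp c1 (\<lambda>t s'. Q (bcost b + 1 + t) s') s
     else wp c2 (\<lambda>t s'. Q (bcost b + 1 + t) s') s"
    unfolding wp_def by (elim IfE) auto
next
  assume "if bval b s then wp c1 (\<lambda>t s'. Q (bcost b + 1 + t) s') s
     else wp c2 (\<lambda>t s'. Q (bcost b + 1 + t) s') s"
  then show "wp (IF b THEN c1 ELSE c2) Q s"
    unfolding wp_def using exec.IfTrue[of b s c1 _ _ c2] exec.IfFalse[of b s c2 _ _ c1]
    by (cases "bval b s") (simp only: if_True if_False, blast)+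
qed

lemmas wp_simps = wp_Skip wp_Assign wp_Put wp_Seq wp_If

text \<open>Turns the symbolic execution of straight-line code into one run with a named end state;
  such runs are chained by \<open>exec.Seq\<close>.\<close>

lemma exec_of_wp: "wp c (\<lambda>t' s''. t' = t \<and> s'' = s') s \<Longrightarrow> exec c s t s'"
  unfolding wp_def by blast

section \<open>Time bounds for loops\<close>

lemma runs_While:
  assumes "I s" and
    step: "\<And>s. I s \<Longrightarrow> bval b s \<Longrightarrow> runs c s T (\<lambda>s'. I s' \<and> f s' < (f s :: nat))"
  shows "runs (WHILE b DO c) s (f s * (T + bcost b + 1) + bcost b + 1) (\<lambda>s'. I s' \<and> \<not> bval b s')"
  using assms(1)
proof (induction "f s" arbitrary: s rule: less_induct)
  case less
  show ?case
  proof (cases "bval b s")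
    case False
    then show ?thesis using less.prems by (intro runsI[OF exec.WhileFalse]) auto
  next
    case True
    obtain t1 s1 where 1: "exec c s t1 s1" "t1 \<le> T" "I s1" "f s1 < f s"
      using step[OF less.prems True] unfolding wp_def by auto
    obtain t2 s2 where 2: "exec (WHILE b DO c) s1 t2 s2"
        "t2 \<le> f s1 * (T + bcost b + 1) + bcost b + 1" "I s2" "\<not> bval b s2"
      using less.hyps[OF 1(4,3)] unfolding wp_def by auto
    \<comment> \<open>A round lowers \<open>f\<close> by at least one, so one of the
      \<open>f s\<close> shares of \<open>T + bcost b + 1\<close> pays for it.\<close>
    have "bcost b + 1 + t1 + t2 \<le> Suc (f s1) * (T + bcost b + 1) + bcost b + 1"
      using 1(2) 2(2) by simp
    also have "\<dots> \<le> f s * (T + bcost b + 1) + bcost b + 1"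
      using 1(4) by (intro add_right_mono mult_right_mono) auto
    finally show ?thesis using 2 by (intro runsI[OF exec.WhileTrue[OF True 1(1) 2(1)]]) auto
  qed
qed

text \<open>\<open>T i\<close> is the allowance of round \<open>i\<close> and \<open>\<Phi>\<close>
  a potential; its differences telescope, and the final potential is dropped. Loop control costs
  \<open>acost B + 7\<close> per round: \<open>acost B + 3\<close> for the test with its branch and
  4 for the increment. The frame assumption supplies in every round whatever the loop never writes,
  so that \<open>I\<close> need not repeat it.\<close>

lemma runs_For_amortized:
  fixes I :: "nat \<Rightarrow> state \<Rightarrow> bool" and \<Phi> :: "nat \<Rightarrow> state \<Rightarrow> nat"
  assumes init: "I (aval A s) (s\<lparr>reg := (reg s)(x := aval A s)\<rparr>)" and "aval A s \<le> b"
    and x: "x \<notin> written_regs c"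
    and B: "\<And>s'. frame (FOR x FROM A TO B DO c) s s' \<Longrightarrow> aval B s' = b"
    and step: "\<And>i s'. aval A s \<le> i \<Longrightarrow> i < b \<Longrightarrow> reg s' x = i \<Longrightarrow>
      frame (FOR x FROM A TO B DO c) s s' \<Longrightarrow> I i s' \<Longrightarrow>
      wp c (\<lambda>t s''. t + \<Phi> (Suc i) (s''\<lparr>reg := (reg s'')(x := Suc i)\<rparr>) \<le> T i + \<Phi> i s' \<and>
        I (Suc i) (s''\<lparr>reg := (reg s'')(x := Suc i)\<rparr>)) s'"
    and T': "(\<Sum>i = aval A s..<b. T i + (acost B + 7)) + acost A + acost B + 4 +
      \<Phi> (aval A s) (s\<lparr>reg := (reg s)(x := aval A s)\<rparr>) \<le> T'"
  shows "runs (FOR x FROM A TO B DO c) s T' (\<lambda>s'. I b s' \<and> reg s' x = b)"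
proof -
  let ?W = "WHILE Var x \<prec> B DO (c;; Incr x)"
  have loop: "runs ?W s' ((\<Sum>i = i..<b. T i + (acost B + 7)) + acost B + 3 + \<Phi> i s')
      (\<lambda>s'. I b s' \<and> reg s' x = b)"
    if "aval A s \<le> i" "i \<le> b" "reg s' x = i" "I i s'" "frame (FOR x FROM A TO B DO c) s s'" for i s'
    using that
  proof (induction "b - i" arbitrary: i s')
    case 0
    then have "\<not> bval (Var x \<prec> B) s'" using B by simp
    then show ?case using 0 by (intro runsI[OF exec.WhileFalse]) auto
  next
    case (Suc m)
    then have ib: "i < b" by simp
    then have true: "bval (Var x \<prec> B) s'" using Suc.prems B by simp
    obtain t1 s1 where 1: "exec c s' t1 s1"
        "t1 + \<Phi> (Suc i) (s1\<lparr>reg := (reg s1)(x := Suc i)\<rparr>) \<le> T i + \<Phi> i s'"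
        "I (Suc i) (s1\<lparr>reg := (reg s1)(x := Suc i)\<rparr>)"
      using step[OF Suc.prems(1) ib Suc.prems(3,5,4)] unfolding wp_def by blast
    have fr1: "frame c s' s1" using 1(1) by (rule exec_frame)
    let ?s = "s1\<lparr>reg := (reg s1)(x := Suc i)\<rparr>"
    have "reg s1 x = i" using fr1 x Suc.prems(3) by (simp add: frame_def)
    then have "exec (Incr x) s1 4 ?s" by (intro exec_of_wp) (simp add: wp_simps)
    note body = exec.Seq[OF 1(1) this]
    have fr: "frame (FOR x FROM A TO B DO c) s ?s"
      using Suc.prems(5) fr1 by (auto simp: frame_def)
    have "runs ?W ?s ((\<Sum>i = Suc i..<b. T i + (acost B + 7)) + acost B + 3 + \<Phi> (Suc i) ?s)
        (\<lambda>s'. I b s' \<and> reg s' x = b)"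
      by (rule Suc.hyps(1)) (use Suc.hyps(2) Suc.prems 1 fr ib in auto)
    then obtain t2 s2 where 2: "exec ?W ?s t2 s2" "I b s2 \<and> reg s2 x = b"
        "t2 \<le> (\<Sum>i = Suc i..<b. T i + (acost B + 7)) + acost B + 3 + \<Phi> (Suc i) ?s"
      unfolding wp_def by auto
    show ?case
      by (rule runsI[OF exec.WhileTrue[OF true body 2(1)]])
        (use 1(2) 2 ib in \<open>auto simp: sum.atLeast_Suc_lessThan\<close>)
  qed
  let ?s = "s\<lparr>reg := (reg s)(x := aval A s)\<rparr>"
  have "runs ?W ?s ((\<Sum>i = aval A s..<b. T i + (acost B + 7)) + acost B + 3 + \<Phi> (aval A s) ?s)
      (\<lambda>s'. I b s' \<and> reg s' x = b)"
    by (rule loop) (use assms in \<open>auto simp: frame_def\<close>)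
  then obtain t2 s2 where 2: "exec ?W ?s t2 s2" "I b s2 \<and> reg s2 x = b"
      "t2 \<le> (\<Sum>i = aval A s..<b. T i + (acost B + 7)) + acost B + 3 + \<Phi> (aval A s) ?s"
    unfolding wp_def by auto
  show ?thesis
    by (rule runsI[OF exec.Seq[OF exec.Assign 2(1)]]) (use 2 T' in auto)
qed

lemmas runs_For = runs_For_amortized[where \<Phi> = "\<lambda>_ _. 0", unfolded add_0_right]

section \<open>The complement\<close>

text \<open>Injectivity makes the length of the segment the cardinality of the set, which turns loop
  lengths into degrees. The inequality rules out an empty listing with \<open>q < p\<close>, so that
  \<open>q\<close> can serve as the next write position.\<close>

definition stores :: "(nat \<Rightarrow> nat) \<Rightarrow> nat \<Rightarrow> nat \<Rightarrow> nat set \<Rightarrow> bool" where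
  "stores f p q X \<longleftrightarrow> p \<le> q \<and> inj_on f {p..<q} \<and> f ` {p..<q} = X"

lemma stores_empty: "stores f p p {}"
  by (simp add: stores_def)

lemma stores_append:
  assumes "stores f p q X" "u \<notin> X"
  shows "stores (f(q := u)) p (Suc q) (insert u X)"
proof -
  have "{p..<Suc q} = insert q {p..<q}" using assms(1) by (auto simp: stores_def)
  moreover have "inj_on (f(q := u)) {p..<q} \<longleftrightarrow> inj_on f {p..<q}" by (rule inj_on_cong) auto
  moreover have "f(q := u) ` {p..<q} = f ` {p..<q}" by (rule image_cong) auto
  ultimately show ?thesis using assms by (auto simp: stores_def)
qed

lemma stores_cong:
  assumes "\<And>k. p \<le> k \<Longrightarrow> k < q \<Longrightarrow> f k = g k"
  shows "stores f p q X \<longleftrightarrow> stores g p q X"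
proof -
  have "inj_on f {p..<q} \<longleftrightarrow> inj_on g {p..<q}" by (rule inj_on_cong) (use assms in auto)
  moreover have "f ` {p..<q} = g ` {p..<q}" by (rule image_cong) (use assms in auto)
  ultimately show ?thesis by (simp add: stores_def)
qed

lemma stores_card: "stores f p q X \<Longrightarrow> card X = q - p"
  unfolding stores_def using card_image by fastforce

lemma adjacency_lists_iff:
  "adjacency_lists off adj s V E \<longleftrightarrow> V = {..<reg s ''n''} \<and>
     (\<forall>v<reg s ''n''. stores (arr s adj) (arr s off v) (arr s off (Suc v)) (nbrs E v))"
  unfolding adjacency_lists_def stores_def by auto

section \<open>Marking and scanning vertices\<close>

abbreviation clear_mark_prog :: com where
  "clear_mark_prog \<equiv> FOR ''i'' FROM Lit 0 TO Var ''n'' DO ''mark''\<langle>Var ''i''\<rangle> ::= Lit 0"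

text \<open>A round costs 3 for the assignment and 8 for loop control; entering and leaving the loop
  costs 6. In loops over an adjacency list the limits are themselves array accesses, and these
  numbers become 11 for loop control and 10 for entering and leaving. The later bounds are made up
  in the same way.\<close>

lemma clear_mark_runs:
  "runs clear_mark_prog s (11 * reg s ''n'' + 6) (\<lambda>s'. \<forall>k<reg s ''n''. arr s' ''mark'' k = 0)"
  by (rule wp_mono[OF runs_For[where I = "\<lambda>i s'. \<forall>k<i. arr s' ''mark'' k = 0"
        and T = "\<lambda>_. 3" and b = "reg s ''n''"]])
    (auto simp: wp_simps frame_def less_Suc_eq)

abbreviation mark_list_prog :: "vname \<Rightarrow> vname \<Rightarrow> com" where
  "mark_list_prog off adj \<equiv>
    FOR ''j'' FROM off\<langle>Var ''v''\<rangle> TO off\<langle>Var ''v'' \<oplus> Lit 1\<rangle> DO ''mark''\<langle>adj\<langle>Var ''j''\<rangle>\<rangle> ::= Lit 1"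

lemma mark_list_runs:
  assumes "stores (arr s adj) (arr s off (reg s ''v'')) (arr s off (Suc (reg s ''v''))) N"
    and "adj \<noteq> ''mark''" "off \<noteq> ''mark''"
  shows "runs (mark_list_prog off adj) s (15 * card N + 10)
    (\<lambda>s'. \<forall>k. arr s' ''mark'' k = (if k \<in> N then 1 else arr s ''mark'' k))"
proof -
  let ?p = "arr s off (reg s ''v'')" and ?q = "arr s off (Suc (reg s ''v''))"
  have N: "?p \<le> ?q" "N = arr s adj ` {?p..<?q}" "card N = ?q - ?p"
    using assms(1) stores_card by (auto simp: stores_def)
  show ?thesis
    by (rule wp_mono[OF runs_For[where I = "\<lambda>j s'. \<forall>k. arr s' ''mark'' k =
            (if k \<in> arr s adj ` {?p..<j} then 1 else arr s ''mark'' k)"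
          and T = "\<lambda>_. 4" and b = ?q]])
      (use assms(2,3) N in \<open>auto simp: wp_simps frame_def less_Suc_eq atLeastLessThanSuc\<close>)
qed

lemma collect_unmarked_runs:
  "runs (FOR ''i'' FROM Lit 0 TO Var ''n'' DO
        (IF ''mark''\<langle>Var ''i''\<rangle> \<doteq> Lit 0
         THEN (''cadj''\<langle>Var ''p''\<rangle> ::= Var ''i'';; Incr ''p'')
         ELSE SKIP)) s (20 * reg s ''n'' + 6)
    (\<lambda>s'. stores (arr s' ''cadj'') (reg s ''p'') (reg s' ''p'') {u. u < reg s ''n'' \<and> arr s ''mark'' u = 0} \<and>
       (\<forall>k<reg s ''p''. arr s' ''cadj'' k = arr s ''cadj'' k))"
  (is "runs ?F s _ _")
proof -
  let ?M = "\<lambda>i. {u. u < i \<and> arr s ''mark'' u = 0}"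
  have M: "?M (Suc i) = (if arr s ''mark'' i = 0 then insert i (?M i) else ?M i)" for i
    by (auto simp: less_Suc_eq)
  define I where "I = (\<lambda>i (s' :: state). stores (arr s' ''cadj'') (reg s ''p'') (reg s' ''p'') (?M i) \<and>
     (\<forall>k<reg s ''p''. arr s' ''cadj'' k = arr s ''cadj'' k))"
  have "runs ?F s (20 * reg s ''n'' + 6) (\<lambda>s'. I (reg s ''n'') s' \<and> reg s' ''i'' = reg s ''n'')"
  proof (rule runs_For[where T = "\<lambda>_. 12"])
    fix i s' assume i: "reg s' ''i'' = i" and "frame ?F s s'" and I: "I i s'"
    then have mark: "arr s' ''mark'' = arr s ''mark''" by (simp add: frame_def)
    have le: "reg s ''p'' \<le> reg s' ''p''" using I by (simp add: I_def stores_def)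
    have "stores ((arr s' ''cadj'')(reg s' ''p'' := i)) (reg s ''p'') (Suc (reg s' ''p'')) (insert i (?M i))"
      using I by (intro stores_append) (auto simp: I_def)
    then show "runs (IF ''mark''\<langle>Var ''i''\<rangle> \<doteq> Lit 0
         THEN (''cadj''\<langle>Var ''p''\<rangle> ::= Var ''i'';; Incr ''p'')
         ELSE SKIP) s' 12 (\<lambda>s''. I (Suc i) (s''\<lparr>reg := (reg s'')(''i'' := Suc i)\<rparr>))"
      using I i mark le M[of i] by (auto simp: wp_simps I_def)
  qed (auto simp: frame_def I_def stores_empty)
  then show ?thesis by (rule wp_mono) (auto simp: I_def)
qed

abbreviation complement_body :: com where
  "complement_body \<equiv>
      clear_mark_prog;;
      ''mark''\<langle>Var ''v''\<rangle> ::= Lit 1;;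
      mark_list_prog ''off'' ''adj'';;
      FOR ''i'' FROM Lit 0 TO Var ''n'' DO
        (IF ''mark''\<langle>Var ''i''\<rangle> \<doteq> Lit 0
         THEN (''cadj''\<langle>Var ''p''\<rangle> ::= Var ''i'';; Incr ''p'')
         ELSE SKIP);;
      ''coff''\<langle>Var ''v'' \<oplus> Lit 1\<rangle> ::= Var ''p''"

lemma complement_body_runs:
  assumes N: "stores (arr s ''adj'') (arr s ''off'' (reg s ''v'')) (arr s ''off'' (Suc (reg s ''v''))) N"
    and "N \<subseteq> {..<reg s ''n''}" and "reg s ''v'' < reg s ''n''"
  shows "runs complement_body s (46 * reg s ''n'' + 30)
    (\<lambda>s'. stores (arr s' ''cadj'') (reg s ''p'') (reg s' ''p'')
           {u. u < reg s ''n'' \<and> u \<noteq> reg s ''v'' \<and> u \<notin> N} \<and>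
       (\<forall>k<reg s ''p''. arr s' ''cadj'' k = arr s ''cadj'' k) \<and>
       arr s' ''coff'' = (arr s ''coff'')(Suc (reg s ''v'') := reg s' ''p''))"
proof -
  let ?n = "reg s ''n''" and ?v = "reg s ''v''"
  have cN: "card N \<le> ?n" using card_mono[OF _ assms(2)] by simp
  obtain t1 s1 where 1: "exec clear_mark_prog s t1 s1" "t1 \<le> 11 * ?n + 6"
      "\<forall>k<?n. arr s1 ''mark'' k = 0" "frame clear_mark_prog s s1"
    using clear_mark_runs by (rule runsE)
  let ?s2 = "s1\<lparr>arr := (arr s1)(''mark'' := (arr s1 ''mark'')(?v := 1))\<rparr>"
  have 2: "exec (''mark''\<langle>Var ''v''\<rangle> ::= Lit 1) s1 3 ?s2"
    by (rule exec_of_wp) (use 1(4) in \<open>simp add: wp_simps frame_def\<close>)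
  have "stores (arr ?s2 ''adj'') (arr ?s2 ''off'' (reg ?s2 ''v'')) (arr ?s2 ''off'' (Suc (reg ?s2 ''v''))) N"
    using N 1(4) by (simp add: frame_def)
  then obtain t3 s3 where 3: "exec (mark_list_prog ''off'' ''adj'') ?s2 t3 s3" "t3 \<le> 15 * card N + 10"
      "\<forall>k. arr s3 ''mark'' k = (if k \<in> N then 1 else arr ?s2 ''mark'' k)"
      "frame (mark_list_prog ''off'' ''adj'') ?s2 s3"
    by (rule runsE[OF mark_list_runs]) auto
  obtain t4 s4 where 4: "exec (FOR ''i'' FROM Lit 0 TO Var ''n'' DO
        (IF ''mark''\<langle>Var ''i''\<rangle> \<doteq> Lit 0
         THEN (''cadj''\<langle>Var ''p''\<rangle> ::= Var ''i'';; Incr ''p'')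
         ELSE SKIP)) s3 t4 s4" "t4 \<le> 20 * reg s3 ''n'' + 6"
    "stores (arr s4 ''cadj'') (reg s3 ''p'') (reg s4 ''p'') {u. u < reg s3 ''n'' \<and> arr s3 ''mark'' u = 0} \<and>
       (\<forall>k<reg s3 ''p''. arr s4 ''cadj'' k = arr s3 ''cadj'' k)"
    "frame (FOR ''i'' FROM Lit 0 TO Var ''n'' DO
        (IF ''mark''\<langle>Var ''i''\<rangle> \<doteq> Lit 0
         THEN (''cadj''\<langle>Var ''p''\<rangle> ::= Var ''i'';; Incr ''p'')
         ELSE SKIP)) s3 s4"
    using collect_unmarked_runs by (rule runsE)
  have r3: "reg s3 ''n'' = ?n" "reg s3 ''p'' = reg s ''p''" "reg s3 ''v'' = ?v"
      "arr s3 ''cadj'' = arr s ''cadj''" "arr s3 ''coff'' = arr s ''coff''"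
    using 1(4) 3(4) by (auto simp: frame_def)
  have "{u. u < ?n \<and> arr s3 ''mark'' u = 0} = {u. u < ?n \<and> u \<noteq> ?v \<and> u \<notin> N}"
    using 3(3) 1(3) by auto
  note e = exec.Seq[OF exec.Seq[OF exec.Seq[OF exec.Seq[OF 1(1) 2] 3(1)] 4(1)] exec.Put]
  show ?thesis
  proof (rule runsI[OF e])
    show "t1 + 3 + t3 + t4 + (acost (Var ''v'' \<oplus> Lit 1) + acost (Var ''p'') + 1) \<le> 46 * ?n + 30"
      using 1(2) 3(2) 4(2) cN r3 by simp
  qed (use 4 r3 \<open>_ = {u. u < ?n \<and> u \<noteq> ?v \<and> u \<notin> N}\<close> in \<open>auto simp: frame_def\<close>)
qed

text \<open>The quadratic term comes from clearing and scanning \<open>n\<close> marks for each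
  vertex.\<close>

lemma complement_prog_runs:
  assumes "simple_graph V E" and adj: "adjacency_lists ''off'' ''adj'' s V E"
  shows "runs complement_prog s (46 * (reg s ''n'' * reg s ''n'') + 38 * reg s ''n'' + 12)
    (\<lambda>s'. adjacency_lists ''coff'' ''cadj'' s' V (complement_edges V E))"
proof -
  let ?n = "reg s ''n''"
  let ?N = "nbrs (complement_edges V E)"
  have V: "V = {..<?n}" and lists: "\<And>v. v < ?n \<Longrightarrow>
      stores (arr s ''adj'') (arr s ''off'' v) (arr s ''off'' (Suc v)) (nbrs E v)"
    using adj by (auto simp: adjacency_lists_iff)
  have N: "?N v = {u. u < ?n \<and> u \<noteq> v \<and> u \<notin> nbrs E v}" if "v < ?n" for v
    using nbrs_complement[of v V E] that V by auto
  define s1 where "s1 = s\<lparr>reg := (reg s)(''p'' := 0), arr := (arr s)(''coff'' := (arr s ''coff'')(0 := 0))\<rparr>"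
  have 1: "exec (''p'' ::= Lit 0;; ''coff''\<langle>Lit 0\<rangle> ::= Lit 0) s 5 s1"
    by (rule exec_of_wp) (simp add: wp_simps s1_def)
  \<comment> \<open>Finished segments end at or below the write position \<open>p\<close>; a round
    changes \<open>cadj\<close> only from \<open>p\<close> on, so they survive.\<close>
  define I where "I = (\<lambda>v (s' :: state). arr s' ''coff'' v = reg s' ''p'' \<and>
      (\<forall>w<v. arr s' ''coff'' (Suc w) \<le> reg s' ''p'' \<and>
         stores (arr s' ''cadj'') (arr s' ''coff'' w) (arr s' ''coff'' (Suc w)) (?N w)))"
  have "runs (FOR ''v'' FROM Lit 0 TO Var ''n'' DO complement_body) s1
      (46 * (?n * ?n) + 38 * ?n + 6) (\<lambda>s'. I ?n s' \<and> reg s' ''v'' = ?n)"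
  proof (rule runs_For[where T = "\<lambda>_. 46 * ?n + 30"])
    show "I (aval (Lit 0) s1) (s1\<lparr>reg := (reg s1)(''v'' := aval (Lit 0) s1)\<rparr>)"
      by (simp add: I_def s1_def)
    fix v s'
    assume v: "v < ?n" "reg s' ''v'' = v" and I: "I v s'"
      and "frame (FOR ''v'' FROM Lit 0 TO Var ''n'' DO complement_body) s1 s'"
    then have fr: "reg s' ''n'' = ?n" "arr s' ''adj'' = arr s ''adj''" "arr s' ''off'' = arr s ''off''"
      by (auto simp: frame_def s1_def)
    have "nbrs E v \<subseteq> {..<?n}" using nbrs_subset[OF assms(1)] V by blast
    then have "runs complement_body s' (46 * reg s' ''n'' + 30)
     (\<lambda>s''. stores (arr s'' ''cadj'') (reg s' ''p'') (reg s'' ''p'')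
           {u. u < reg s' ''n'' \<and> u \<noteq> reg s' ''v'' \<and> u \<notin> nbrs E v} \<and>
       (\<forall>k<reg s' ''p''. arr s'' ''cadj'' k = arr s' ''cadj'' k) \<and>
       arr s'' ''coff'' = (arr s' ''coff'')(Suc (reg s' ''v'') := reg s'' ''p''))"
      using v fr lists by (intro complement_body_runs) auto
    then show "runs complement_body s' (46 * ?n + 30)
        (\<lambda>s''. I (Suc v) (s''\<lparr>reg := (reg s'')(''v'' := Suc v)\<rparr>))"
    proof (rule wp_mono, elim conjE, intro conjI)
      fix t and s'' :: state
      assume t: "t \<le> 46 * reg s' ''n'' + 30"
        and st: "stores (arr s'' ''cadj'') (reg s' ''p'') (reg s'' ''p'')
           {u. u < reg s' ''n'' \<and> u \<noteq> reg s' ''v'' \<and> u \<notin> nbrs E v}"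
        and same: "\<forall>k<reg s' ''p''. arr s'' ''cadj'' k = arr s' ''cadj'' k"
        and coff: "arr s'' ''coff'' = (arr s' ''coff'')(Suc (reg s' ''v'') := reg s'' ''p'')"
      show "t \<le> 46 * ?n + 30" using t fr by simp
      have le: "reg s' ''p'' \<le> reg s'' ''p''" using st by (simp add: stores_def)
      have "stores (arr s'' ''cadj'') (arr s' ''coff'' w) (arr s' ''coff'' (Suc w)) (?N w)" if "w < v" for w
      proof -
        have "arr s' ''coff'' (Suc w) \<le> reg s' ''p''" using I that by (simp add: I_def)
        then show ?thesis
          using I that same
            stores_cong[of "arr s' ''coff'' w" "arr s' ''coff'' (Suc w)" "arr s'' ''cadj''" "arr s' ''cadj''"]
          by (simp add: I_def)
      qed
      moreover have "stores (arr s'' ''cadj'') (arr s' ''coff'' v) (reg s'' ''p'') (?N v)"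
        using st fr v N I by (simp add: I_def)
      ultimately show "I (Suc v) (s''\<lparr>reg := (reg s'')(''v'' := Suc v)\<rparr>)"
        using I le coff v by (auto simp: I_def less_Suc_eq dest: le_trans)
    qed
  qed (auto simp: frame_def s1_def algebra_simps)
  then obtain t2 s2 where 2: "exec (FOR ''v'' FROM Lit 0 TO Var ''n'' DO complement_body) s1 t2 s2"
      "t2 \<le> 46 * (?n * ?n) + 38 * ?n + 6" "I ?n s2 \<and> reg s2 ''v'' = ?n"
      "frame (FOR ''v'' FROM Lit 0 TO Var ''n'' DO complement_body) s1 s2"
    by (rule runsE)
  have "reg s2 ''n'' = ?n" using 2(4) by (auto simp: frame_def s1_def)
  then have "adjacency_lists ''coff'' ''cadj'' s2 V (complement_edges V E)"
    using 2(3) V by (simp add: adjacency_lists_iff I_def)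
  then show ?thesis
    unfolding complement_prog_def using 2(2) by (intro runsI[OF exec.Seq[OF 1 2(1)]]) auto
qed

section \<open>Partition refinement\<close>

text \<open>Order and classes are constrained from position \<open>m\<close> on only, the part not
  yet numbered. Contiguity of the blocks is not stated: it follows from sortedness, because classes
  are the sets of equal key. The last clause makes \<open>beg\<close> the least position of a class,
  since it bounds the position of every member and is itself the position of one. All class numbers
  in use lie below \<open>k\<close>, so \<open>k\<close> is fresh.\<close>

definition key_partition ::
  "nat \<Rightarrow> nat \<Rightarrow> (nat \<Rightarrow> nat) \<Rightarrow> (nat \<Rightarrow> nat) \<Rightarrow> (nat \<Rightarrow> nat) \<Rightarrow> (nat \<Rightarrow> nat) \<Rightarrow> (nat \<Rightarrow> nat) \<Rightarrow> nat \<Rightarrow> bool"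
where
  "key_partition n m K ord pos cls beg k \<longleftrightarrow>
     (\<forall>x<n. ord x < n \<and> pos (ord x) = x) \<and> (\<forall>u<n. pos u < n \<and> ord (pos u) = u) \<and>
     (\<forall>x y. m \<le> x \<longrightarrow> x < y \<longrightarrow> y < n \<longrightarrow> K (ord y) \<le> K (ord x)) \<and>
     (\<forall>u<n. \<forall>w<n. m \<le> pos u \<longrightarrow> m \<le> pos w \<longrightarrow> (cls u = cls w \<longleftrightarrow> K u = K w)) \<and>
     (\<forall>u<n. m \<le> pos u \<longrightarrow>
        cls u < k \<and> m \<le> beg (cls u) \<and> beg (cls u) \<le> pos u \<and> cls (ord (beg (cls u))) = cls u)"

lemma key_partitionD:
  assumes "key_partition n m K ord pos cls beg k"
  shows "\<And>x. x < n \<Longrightarrow> ord x < n" "\<And>x. x < n \<Longrightarrow> pos (ord x) = x"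
    "\<And>u. u < n \<Longrightarrow> pos u < n" "\<And>u. u < n \<Longrightarrow> ord (pos u) = u"
    "\<And>x y. m \<le> x \<Longrightarrow> x \<le> y \<Longrightarrow> y < n \<Longrightarrow> K (ord y) \<le> K (ord x)"
    "\<And>u w. u < n \<Longrightarrow> w < n \<Longrightarrow> m \<le> pos u \<Longrightarrow> m \<le> pos w \<Longrightarrow> cls u = cls w \<longleftrightarrow> K u = K w"
    "\<And>u. u < n \<Longrightarrow> m \<le> pos u \<Longrightarrow> cls u < k"
    "\<And>u. u < n \<Longrightarrow> m \<le> pos u \<Longrightarrow> m \<le> beg (cls u)"
    "\<And>u. u < n \<Longrightarrow> m \<le> pos u \<Longrightarrow> beg (cls u) \<le> pos u"
    "\<And>u. u < n \<Longrightarrow> m \<le> pos u \<Longrightarrow> cls (ord (beg (cls u))) = cls u"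
  using assms unfolding key_partition_def by (auto simp: le_less)

lemma key_partition_cong:
  assumes "key_partition n m K ord pos cls beg k"
    and "\<And>u. u < n \<Longrightarrow> m \<le> pos u \<Longrightarrow> K u = K' u"
  shows "key_partition n m K' ord pos cls beg k"
proof -
  note D = key_partitionD[OF assms(1)]
  have K': "K' (ord x) = K (ord x)" if "m \<le> x" "x < n" for x
    using assms(2)[of "ord x"] D(1,2) that by simp
  show ?thesis
    unfolding key_partition_def
  proof (intro conjI allI impI)
    fix x y assume "m \<le> x" "x < y" "y < n"
    then show "K' (ord y) \<le> K' (ord x)" using D(5)[of x y] K' by simp
  next
    fix u w assume "u < n" "w < n" "m \<le> pos u" "m \<le> pos w"
    then show "cls u = cls w \<longleftrightarrow> K' u = K' w" using D(6) assms(2) by simp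
  qed (use D in auto)
qed

text \<open>The pivot sits at the first unnumbered position and therefore heads its block. If a
  vertex \<open>u\<close> of its class remains, sortedness squeezes the key of the vertex at
  \<open>Suc i\<close> between the keys of \<open>u\<close> and of the pivot, so the shortened block
  really begins at \<open>Suc i\<close>.\<close>

lemma key_partition_pivot:
  assumes part: "key_partition n i K ord pos cls beg k" and "i < n"
  shows "key_partition n (Suc i) K ord pos cls (beg(cls (ord i) := Suc i)) k"
proof -
  note D = key_partitionD[OF part]
  let ?v = "ord i"
  have v: "?v < n" "pos ?v = i" using D(1,2) \<open>i < n\<close> by auto
  then have begv: "beg (cls ?v) = i" using D(8,9)[of ?v] by auto
  show ?thesis
    unfolding key_partition_def
  proof (intro conjI allI impI)
    fix u assume u: "u < n" "Suc i \<le> pos u"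
    let ?b = "(beg(cls ?v := Suc i)) (cls u)"
    have *: "Suc i \<le> ?b \<and> ?b \<le> pos u \<and> cls (ord ?b) = cls u"
    proof (cases "cls u = cls ?v")
      case True
      have "K u = K ?v" using D(6)[of u ?v] True u v by simp
      moreover have "K u \<le> K (ord (Suc i))" using D(5)[of "Suc i" "pos u"] D(3,4) u by simp
      moreover have "K (ord (Suc i)) \<le> K ?v" using D(5)[of i "Suc i"] u D(3)[of u] by simp
      ultimately have "K (ord (Suc i)) = K u" by simp
      then have "cls (ord (Suc i)) = cls u"
        using D(6)[of "ord (Suc i)" u] D(1,2)[of "Suc i"] D(3)[of u] u by simp
      then show ?thesis using True u by simp
    next
      case False
      have "beg (cls u) \<noteq> i" using D(10)[of u] u False by auto
      then show ?thesis using False D(8,9,10)[of u] u by simp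
    qed
    show "cls u < k" "Suc i \<le> ?b" "?b \<le> pos u" "cls (ord ?b) = cls u"
      using * D(7) u by auto
  qed (use D in auto)
qed

text \<open>Raising the key of \<open>u\<close> by one moves \<open>u\<close> to the front of the block of its class \<open>c\<close>, and there
  into the class \<open>d\<close> of the vertices with the raised key, which may have to be created.\<close>

lemma key_partition_split:
  assumes part: "key_partition n m K ord pos cls beg k"
    and u: "u < n" "m \<le> pos u"
    and c: "c = cls u" and q: "q = beg c" and x: "x = pos u" and w: "w = ord q"
    and target: "(d = k \<and> k' = Suc k \<and> beg' = beg(k := q) \<and>
          \<not> (\<exists>w<n. m \<le> pos w \<and> K w = Suc (K u))) \<or>
        (k' = k \<and> beg' = beg \<and> (\<exists>w<n. m \<le> pos w \<and> K w = Suc (K u) \<and> d = cls w))"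
  shows "key_partition n m (K(u := Suc (K u))) (ord(x := w, q := u)) (pos(w := x, u := q))
    (cls(u := d)) (beg'(c := Suc q)) k'"
proof -
  note D = key_partitionD[OF part]
  have qx: "m \<le> q" "q \<le> x" "x < n" "cls w = c" using D u c q x w by auto
  have qn: "q < n" using qx by simp
  have ordx: "ord x = u" and w_n: "w < n" and posw: "pos w = q"
    using D(4)[OF u(1)] D(1,2)[OF qn] x w by auto
  have Kw: "K w = K u" using D(6)[of w u] w_n u posw qx c by simp
  have wu: "w = u \<longleftrightarrow> q = x" using posw x w ordx by auto
  let ?K = "K(u := Suc (K u))" and ?ord = "ord(x := w, q := u)" and ?pos = "pos(w := x, u := q)"
    and ?cls = "cls(u := d)" and ?beg = "beg'(c := Suc q)"
  have inj: "ord a = ord b \<longleftrightarrow> a = b" if "a < n" "b < n" for a b using D(2) that by metis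
  have ordu: "ord a = u \<longleftrightarrow> a = x" if "a < n" for a using inj[OF that qx(3)] ordx by simp
  have ordw: "ord a = w \<longleftrightarrow> a = q" if "a < n" for a using inj[OF that, of q] w qx by simp
  \<comment> \<open>The block of \<open>u\<close> begins at \<open>q\<close>, so every unnumbered
    vertex in front of \<open>q\<close> has a different, hence larger, key.\<close>
  have before: "Suc (K u) \<le> K (ord a)" if a: "m \<le> a" "a < q" for a
  proof -
    have "a < n" using a qx by simp
    then have "K u \<le> K (ord a)" using D(5)[of a q] a qx w Kw by simp
    moreover have "K (ord a) \<noteq> K u"
    proof
      assume "K (ord a) = K u"
      then have "cls (ord a) = c" using D(6)[of "ord a" u] D(1,2)[of a] \<open>a < n\<close> a u c by simp
      then have "q \<le> a" using D(9)[of "ord a"] D(1,2)[of a] \<open>a < n\<close> a q by simp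
      then show False using a by simp
    qed
    ultimately show ?thesis by simp
  qed
  have after: "K (ord a) \<le> K u" if "q \<le> a" "a < n" for a
    using D(5)[of q a] that qx w Kw by simp
  have Kq: "?K (?ord q) = Suc (K u)" by simp
  \<comment> \<open>As \<open>w\<close> and \<open>u\<close> have equal keys, swapping them and
    raising \<open>u\<close> changes the sequence of keys at position \<open>q\<close> only.\<close>
  have Kord: "?K (?ord a) = K (ord a)" if "a < n" "a \<noteq> q" for a
    using that ordu Kw wu ordx by (cases "a = x") auto
  have perm1: "?ord a < n \<and> ?pos (?ord a) = a" if "a < n" for a
    using that D(1,2)[of a] u w_n wu ordu ordw by (cases "a = q"; cases "a = x") auto
  have perm2: "?pos y < n \<and> ?ord (?pos y) = y" if "y < n" for y
    using that D(3,4)[of y] qx wu ordx w posw x by (cases "y = u"; cases "y = w") auto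
  have m_pos: "m \<le> ?pos y \<longleftrightarrow> m \<le> pos y" for y using qx posw u x by auto
  have sorted: "?K (?ord b) \<le> ?K (?ord a)" if ab: "m \<le> a" "a < b" "b < n" for a b
  proof (cases "b = q")
    case True
    then show ?thesis using before[of a] Kq Kord[of a] ab by simp
  next
    case False
    then have Kb: "?K (?ord b) = K (ord b)" using Kord ab by simp
    show ?thesis
    proof (cases "a = q")
      case True
      then show ?thesis using after[of b] Kq Kb ab by simp
    next
      case False
      then show ?thesis using D(5)[of a b] Kb Kord[of a] ab by simp
    qed
  qed
  have d_iff: "cls y = d \<longleftrightarrow> K y = Suc (K u)" if "y < n" "m \<le> pos y" for y
    using target D(6)[of y] D(7)[of y] that by (metis less_irrefl_nat)
  have classes: "?cls y = ?cls z \<longleftrightarrow> ?K y = ?K z"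
    if yz: "y < n" "z < n" "m \<le> pos y" "m \<le> pos z" for y z
    using d_iff[of y] d_iff[of z] D(6)[of y z] yz by (cases "y = u"; cases "z = u") auto
  have d: "d \<noteq> c" using d_iff[OF u] c by auto
  have blocks: "m \<le> ?beg (?cls y) \<and> ?beg (?cls y) \<le> ?pos y \<and> ?cls (?ord (?beg (?cls y))) = ?cls y"
    if y: "y < n" "m \<le> pos y" for y
  proof (cases "cls y = c \<and> y \<noteq> u")
    case True
    \<comment> \<open>Here \<open>y\<close> stays behind in \<open>c\<close>. It is not at
      \<open>q\<close>, so \<open>Suc q\<close> is no later than \<open>y\<close>, and sortedness
      gives the vertex at \<open>Suc q\<close> the key of \<open>y\<close>.\<close>
    have "q \<le> ?pos y" using D(9)[of y] y True q qx by auto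
    moreover have "?pos y \<noteq> q" using perm2[OF y(1)] True by auto
    ultimately have sq: "Suc q \<le> ?pos y" by simp
    then have sqn: "Suc q < n" using perm2[OF y(1)] by auto
    have "K y = K u" using D(6)[of y u] y u True c by simp
    have "?K y \<le> ?K (?ord (Suc q))"
      using sorted[of "Suc q" "?pos y"] sq perm2[OF y(1)] qx by (cases "?pos y = Suc q") auto
    moreover have "?K (?ord (Suc q)) \<le> K u" using after[of "Suc q"] Kord[of "Suc q"] sqn by simp
    ultimately have "?K (?ord (Suc q)) = ?K y" using \<open>K y = K u\<close> True by simp
    then have "?cls (?ord (Suc q)) = ?cls y"
      using classes[of "?ord (Suc q)" y] perm1[OF sqn] m_pos[of "?ord (Suc q)"] sqn qx y by simp
    then show ?thesis using True sq qx by simp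
  next
    case False
    have beg: "m \<le> beg (cls z) \<and> beg (cls z) \<le> ?pos z \<and> ?cls (?ord (beg (cls z))) = cls z"
      if z: "z < n" "m \<le> pos z" "cls z \<noteq> c" for z
    proof -
      let ?b = "beg (cls z)"
      have b: "m \<le> ?b" "?b \<le> pos z" "cls (ord ?b) = cls z" using D(8,9,10) z by auto
      have "?b \<noteq> q" "?b \<noteq> x" using b z qx w ordx c by auto
      moreover have "?b < n" using b D(3)[of z] z by simp
      moreover have "z \<noteq> u" "z \<noteq> w" using z c qx by auto
      ultimately show ?thesis using b ordu by simp
    qed
    show ?thesis
    proof (cases "y = u")
      case False
      then have yc: "cls y \<noteq> c" using \<open>\<not> (cls y = c \<and> y \<noteq> u)\<close> by simp
      moreover have "beg' (cls y) = beg (cls y)" using target D(7)[OF y] by auto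
      ultimately show ?thesis using beg[OF y yc] False by simp
    next
      case True
      show ?thesis
      proof (cases "beg' = beg")
        case False
        then have "beg' d = q" using target by auto
        then show ?thesis using True d qx by simp
      next
        case same: True
        show ?thesis
        proof (cases "\<exists>z<n. m \<le> pos z \<and> K z = Suc (K u) \<and> d = cls z")
          case True
          \<comment> \<open>A vertex with the raised key lies before \<open>q\<close>, so the block
            of its class begins before \<open>q\<close> and is not disturbed by the swap.\<close>
          then obtain z where z: "z < n" "m \<le> pos z" "K z = Suc (K u)" "d = cls z" by blast
          have "pos z < q" using after[of "pos z"] D(3,4)[of z] z by (metis Suc_n_not_le_n not_le)
          then have "beg d < q" using D(9)[of z] z by simp
          then show ?thesis using beg[of z] z d same \<open>y = u\<close> by simp
        next
          case False
          then have "d = k \<and> beg' = beg(k := q)" using target by blast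
          then show ?thesis using d qx \<open>y = u\<close> by simp
        qed
      qed
    qed
  qed
  have bound: "?cls y < k'" if "y < n" "m \<le> pos y" for y
    using target D(7) that by (auto intro: less_SucI)
  show ?thesis
    unfolding key_partition_def m_pos
    using perm1 perm2 sorted classes blocks bound by blast
qed

text \<open>Here \<open>i\<close> is the position of the pivot and \<open>D\<close> the set of its neighbors treated so far. The keys
  have already been doubled, so that they are odd exactly on \<open>D\<close>.\<close>

definition split_marks ::
  "nat \<Rightarrow> nat \<Rightarrow> nat set \<Rightarrow> (nat \<Rightarrow> nat) \<Rightarrow> (nat \<Rightarrow> nat) \<Rightarrow> (nat \<Rightarrow> nat) \<Rightarrow> (nat \<Rightarrow> nat) \<Rightarrow> (nat \<Rightarrow> nat) \<Rightarrow> bool"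
where
  "split_marks n i D K pos cls stamp new \<longleftrightarrow>
     (\<forall>u<n. i < pos u \<longrightarrow> stamp (cls u) \<le> Suc i) \<and>
     (\<forall>u<n. i < pos u \<longrightarrow> u \<notin> D \<longrightarrow> even (K u) \<and>
        (stamp (cls u) = Suc i \<longleftrightarrow> (\<exists>w<n. i < pos w \<and> K w = Suc (K u)))) \<and>
     (\<forall>u<n. \<forall>w<n. i < pos u \<longrightarrow> i < pos w \<longrightarrow> u \<notin> D \<longrightarrow> K w = Suc (K u) \<longrightarrow> new (cls u) = cls w)"

lemma split_marks_visited:
  assumes "split_marks n i D K pos cls stamp new" "pos u \<le> i"
    and "\<And>y. y \<noteq> u \<Longrightarrow> K' y = K y"
  shows "split_marks n i (insert u D) K' pos cls stamp new"
proof -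
  have "K' y = K y" if "i < pos y" for y using assms(2,3) that by force
  then show ?thesis
    using assms(1) unfolding split_marks_def
    by (smt (verit, best) insert_iff)
qed

text \<open>Once raised, \<open>u\<close> itself is the witness that the class it leaves has been
  split. For untreated vertices of other classes nothing changes: their keys and the old key of
  \<open>u\<close> are even, so \<open>u\<close> was no witness for them before, and it is none
  afterwards because their keys differ from its old one.\<close>

lemma split_marks_split:
  assumes part: "key_partition n (Suc i) K ord pos cls beg k"
    and marks: "split_marks n i D K pos cls stamp new"
    and u: "u < n" "i < pos u" "u \<notin> D" and c: "c = cls u"
    and pos': "\<And>y. i < pos' y \<longleftrightarrow> i < pos y"
    and cases: "if stamp c = Suc i then stamp' = stamp \<and> new' = new
        else stamp' = stamp(c := Suc i, k := 0) \<and> new' = new(c := k)"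
  shows "split_marks n i (insert u D) (K(u := Suc (K u))) pos' (cls(u := new' c)) stamp' new'"
proof -
  have same: "cls y = cls z \<longleftrightarrow> K y = K z" if "y < n" "z < n" "i < pos y" "i < pos z" for y z
    using key_partitionD(6)[OF part] that by simp
  have lt: "cls y < k" if "y < n" "i < pos y" for y
    using key_partitionD(7)[OF part] that by simp
  have stamp: "stamp (cls y) \<le> Suc i" if "y < n" "i < pos y" for y
    using marks that unfolding split_marks_def by blast
  have ev: "even (K y)" if "y < n" "i < pos y" "y \<notin> D" for y
    using marks that unfolding split_marks_def by blast
  have stamped: "stamp (cls y) = Suc i \<longleftrightarrow> (\<exists>w<n. i < pos w \<and> K w = Suc (K y))"
    if "y < n" "i < pos y" "y \<notin> D" for y
    using marks that unfolding split_marks_def by blast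
  have new: "new (cls y) = cls z" if "y < n" "z < n" "i < pos y" "i < pos z" "y \<notin> D" "K z = Suc (K y)" for y z
    using marks that unfolding split_marks_def by blast
  let ?K = "K(u := Suc (K u))" and ?cls = "cls(u := new' c)"
  have ck: "c < k" using lt u c by simp
  have stamp'_other: "stamp' b = stamp b" "new' b = new b" if "b < k" "b \<noteq> c" for b
    using cases that by (auto split: if_splits)
  have stamp'_c: "stamp' c = Suc i" using cases ck by (auto split: if_splits)
  show ?thesis
    unfolding split_marks_def pos'
  proof (intro conjI allI impI)
    fix y assume y: "y < n" "i < pos y"
    show "stamp' (?cls y) \<le> Suc i"
    proof (cases "y = u")
      case True
      show ?thesis
      proof (cases "stamp c = Suc i")
        case True
        then obtain z where "z < n" "i < pos z" "K z = Suc (K u)" using stamped[OF u] c by auto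
        moreover from this have "new c = cls z" using new u c by simp
        ultimately show ?thesis using stamp[of z] cases True \<open>y = u\<close> by simp
      next
        case False
        \<comment> \<open>The fresh class carries the stamp 0 written on its creation; the former
          content of that cell is arbitrary.\<close>
        then show ?thesis using cases ck \<open>y = u\<close> by simp
      qed
    next
      case False
      then show ?thesis using stamp[OF y] stamp'_c stamp'_other lt[OF y] by (cases "cls y = c") auto
    qed
  next
    fix y assume y: "y < n" "i < pos y" "y \<notin> insert u D"
    then have yD: "y \<noteq> u" "y \<notin> D" by auto
    show "even (?K y)" using ev[of y] y yD by simp
    show "stamp' (?cls y) = Suc i \<longleftrightarrow> (\<exists>w<n. i < pos w \<and> ?K w = Suc (?K y))"
    proof (cases "cls y = c")
      case True
      then have "K y = K u" using same[of y u] y u c by simp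
      then show ?thesis using True stamp'_c yD u by (auto intro!: exI[of _ u])
    next
      case False
      then have "K y \<noteq> K u" using same[of y u] y u c by simp
      moreover have "K u \<noteq> Suc (K y)" using ev[of y] ev[OF u] y yD by auto
      ultimately have "?K w = Suc (?K y) \<longleftrightarrow> K w = Suc (K y)" for w using yD by auto
      then show ?thesis using stamped[OF y(1,2) yD(2)] stamp'_other lt[of y] y False yD by simp
    qed
  next
    fix y z assume yz: "y < n" "z < n" "i < pos y" "i < pos z" "y \<notin> insert u D" "?K z = Suc (?K y)"
    then have yD: "y \<noteq> u" "y \<notin> D" by auto
    show "new' (?cls y) = ?cls z"
    proof (cases "z = u")
      case True
      then have "K y = K u" using yz yD by simp
      then have "cls y = c" using same[of y u] yz u c by simp
      then show ?thesis using True yD by simp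
    next
      case False
      then have Kz: "K z = Suc (K y)" using yz yD by simp
      then have nz: "new (cls y) = cls z" using new yz yD by simp
      show ?thesis
      proof (cases "cls y = c")
        case True
        then have "stamp c = Suc i" using stamped[of y] yz yD Kz by auto
        then show ?thesis using cases nz yD False by simp
      next
        case ne: False
        then show ?thesis using nz stamp'_other lt[of y] yz yD False by simp
      qed
    qed
  qed
qed

section \<open>The search program\<close>

abbreviation state_partition :: "nat \<Rightarrow> nat \<Rightarrow> (nat \<Rightarrow> nat) \<Rightarrow> state \<Rightarrow> bool" where
  "state_partition n m K s \<equiv> key_partition n m K (arr s ''ord'') (arr s ''pos'') (arr s ''cls'')
     (arr s ''beg'') (reg s ''k'')"

abbreviation state_marks :: "nat \<Rightarrow> nat \<Rightarrow> nat set \<Rightarrow> (nat \<Rightarrow> nat) \<Rightarrow> state \<Rightarrow> bool" where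
  "state_marks n i D K s \<equiv> split_marks n i D K (arr s ''pos'') (arr s ''cls'')
     (arr s ''stamp'') (arr s ''new'')"

abbreviation lexbfs_visit :: com where
  "lexbfs_visit \<equiv>
        ''u'' ::= ''cadj''\<langle>Var ''j''\<rangle>;;
        ''x'' ::= ''pos''\<langle>Var ''u''\<rangle>;;
        (IF Var ''i'' \<prec> Var ''x''
         THEN (
           ''c'' ::= ''cls''\<langle>Var ''u''\<rangle>;;
           ''q'' ::= ''beg''\<langle>Var ''c''\<rangle>;;
           (IF ''stamp''\<langle>Var ''c''\<rangle> \<doteq> Var ''i'' \<oplus> Lit 1
            THEN SKIP
            ELSE (
              ''stamp''\<langle>Var ''c''\<rangle> ::= Var ''i'' \<oplus> Lit 1;;
              ''new''\<langle>Var ''c''\<rangle> ::= Var ''k'';;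
              ''beg''\<langle>Var ''k''\<rangle> ::= Var ''q'';;
              ''stamp''\<langle>Var ''k''\<rangle> ::= Lit 0;;
              Incr ''k''));;
           ''w'' ::= ''ord''\<langle>Var ''q''\<rangle>;;
           ''ord''\<langle>Var ''x''\<rangle> ::= Var ''w'';;
           ''pos''\<langle>Var ''w''\<rangle> ::= Var ''x'';;
           ''ord''\<langle>Var ''q''\<rangle> ::= Var ''u'';;
           ''pos''\<langle>Var ''u''\<rangle> ::= Var ''q'';;
           ''beg''\<langle>Var ''c''\<rangle> ::= Var ''q'' \<oplus> Lit 1;;
           ''cls''\<langle>Var ''u''\<rangle> ::= ''new''\<langle>Var ''c''\<rangle>)
         ELSE SKIP)"

text \<open>Both cells of the swap lie beyond position \<open>i\<close>, which is why the numbered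
  part of \<open>ord\<close> stays fixed. The 100 is a generous bound on the longest branch.\<close>

lemma lexbfs_visit_runs:
  assumes part: "state_partition n (Suc i) K s" and marks: "state_marks n i D K s"
    and i: "reg s ''i'' = i" and u: "u = arr s ''cadj'' (reg s ''j'')" "u < n" "u \<notin> D"
  shows "runs lexbfs_visit s 100 (\<lambda>s'.
      state_partition n (Suc i) (K(u := Suc (K u))) s' \<and>
      state_marks n i (insert u D) (K(u := Suc (K u))) s' \<and>
      (\<forall>x\<le>i. arr s' ''ord'' x = arr s ''ord'' x))"
proof (cases "i < arr s ''pos'' u")
  case False
  \<comment> \<open>For a neighbor that is already numbered the program does nothing, but its key is
    raised all the same. No clause looks at the keys of numbered vertices, and the final keys then
    agree with \<open>lex_key\<close> on all vertices.\<close>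
  let ?K = "K(u := Suc (K u))"
  have "state_partition n (Suc i) ?K s"
    using False by (intro key_partition_cong[OF part]) auto
  moreover have "state_marks n i (insert u D) ?K s"
    using False by (intro split_marks_visited[OF marks]) auto
  ultimately show ?thesis
    using False i u(1) by (simp add: wp_simps)
next
  case True
  define c q x w where "c = arr s ''cls'' u" and "q = arr s ''beg'' c" and "x = arr s ''pos'' u"
    and "w = arr s ''ord'' q"
  note defs = c_def q_def x_def w_def
  note D = key_partitionD[OF part]
  have pos: "Suc i \<le> arr s ''pos'' u" using True by simp
  have q: "Suc i \<le> q" "Suc i \<le> x" using D(8)[OF u(2) pos] True by (auto simp: defs)
  have "q < n" using D(9)[OF u(2) pos] D(3)[OF u(2)] unfolding defs by linarith
  then have posw: "arr s ''pos'' w = q" using D(2) by (simp add: w_def)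
  have stamped: "arr s ''stamp'' c = Suc i \<longleftrightarrow> (\<exists>z<n. i < arr s ''pos'' z \<and> K z = Suc (K u))"
    using marks u True unfolding split_marks_def c_def by blast
  have newc: "arr s ''new'' c = arr s ''cls'' z" if "z < n" "i < arr s ''pos'' z" "K z = Suc (K u)" for z
    using marks u True that unfolding split_marks_def c_def by blast
  let ?pos = "(arr s ''pos'')(w := x, u := q)"
  have pos': "i < ?pos y \<longleftrightarrow> i < arr s ''pos'' y" for y using q True posw by auto
  show ?thesis
  proof (cases "arr s ''stamp'' c = Suc i")
    case st: True
    let ?new = "arr s ''new''"
    have "key_partition n (Suc i) (K(u := Suc (K u))) ((arr s ''ord'')(x := w, q := u)) ?pos
        ((arr s ''cls'')(u := ?new c)) ((arr s ''beg'')(c := Suc q)) (reg s ''k'')"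
      using st stamped newc by (intro key_partition_split[OF part u(2) pos c_def q_def x_def w_def]) fastforce
    moreover have "split_marks n i (insert u D) (K(u := Suc (K u))) ?pos
        ((arr s ''cls'')(u := ?new c)) (arr s ''stamp'') ?new"
      by (rule split_marks_split[OF part marks u(2) True u(3) c_def pos']) (use st in simp)
    ultimately show ?thesis
      using True st i q by (simp add: wp_simps u(1)[symmetric] c_def[symmetric] q_def[symmetric]
          x_def[symmetric] w_def[symmetric])
  next
    case st: False
    let ?k = "reg s ''k''"
    let ?new = "(arr s ''new'')(c := ?k)"
    have "key_partition n (Suc i) (K(u := Suc (K u))) ((arr s ''ord'')(x := w, q := u)) ?pos
        ((arr s ''cls'')(u := ?new c)) ((arr s ''beg'')(?k := q, c := Suc q)) (Suc ?k)"
      using st stamped by (intro key_partition_split[OF part u(2) pos c_def q_def x_def w_def]) fastforce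
    moreover have "split_marks n i (insert u D) (K(u := Suc (K u))) ?pos
        ((arr s ''cls'')(u := ?new c)) ((arr s ''stamp'')(c := Suc i, ?k := 0)) ?new"
      by (rule split_marks_split[OF part marks u(2) True u(3) c_def pos']) (use st in simp)
    ultimately show ?thesis
      using True st i q by (simp add: wp_simps u(1)[symmetric] c_def[symmetric] q_def[symmetric]
          x_def[symmetric] w_def[symmetric])
  qed
qed

text \<open>The keys are read off \<open>ord\<close> itself, whose first \<open>i\<close> entries
  are final. The bound on the stamps ensures that no live class looks as if the coming pivot, which
  writes \<open>i + 1\<close>, had already split it. The last clause records the greedy choices made
  so far; it ranges over vertices rather than positions, so that it survives later
  rearrangements.\<close>

definition lexbfs_inv :: "nat set set \<Rightarrow> nat \<Rightarrow> nat \<Rightarrow> nat \<Rightarrow> state \<Rightarrow> bool" where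
  "lexbfs_inv E n r i s \<longleftrightarrow>
     state_partition n i (lex_key E (arr s ''ord'') i) s \<and>
     (\<forall>u<n. i \<le> arr s ''pos'' u \<longrightarrow> arr s ''stamp'' (arr s ''cls'' u) \<le> i) \<and>
     arr s ''ord'' 0 = r \<and>
     (\<forall>x<i. \<forall>u<n. x < arr s ''pos'' u \<longrightarrow>
        lex_key E (arr s ''ord'') x u \<le> lex_key E (arr s ''ord'') x (arr s ''ord'' x))"

abbreviation lexbfs_pivot :: com where
  "lexbfs_pivot \<equiv>
      ''v'' ::= ''ord''\<langle>Var ''i''\<rangle>;;
      ''beg''\<langle>''cls''\<langle>Var ''v''\<rangle>\<rangle> ::= Var ''i'' \<oplus> Lit 1;;
      FOR ''j'' FROM ''coff''\<langle>Var ''v''\<rangle> TO ''coff''\<langle>Var ''v'' \<oplus> Lit 1\<rangle> DO lexbfs_visit"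

text \<open>The second conclusion, that a pivot does not change which vertices lie beyond it, lets
  the potential of the enclosing loop drop by exactly the degree of the pivot. The factor 111 is 100
  for a visit and 11 for loop control.\<close>

lemma lexbfs_pivot_runs:
  assumes inv: "lexbfs_inv E n r i s" and i: "i < n" "reg s ''i'' = i"
    and v: "v = arr s ''ord'' i"
    and adj: "stores (arr s ''cadj'') (arr s ''coff'' v) (arr s ''coff'' (Suc v)) (nbrs E v)"
    and N: "nbrs E v \<subseteq> {..<n}"
  shows "runs lexbfs_pivot s (111 * card (nbrs E v) + 20) (\<lambda>s'.
      lexbfs_inv E n r (Suc i) s' \<and> (\<forall>u<n. i < arr s' ''pos'' u \<longleftrightarrow> i < arr s ''pos'' u))"
proof -
  let ?o = "arr s ''ord''" and ?p = "arr s ''coff'' v" and ?q = "arr s ''coff'' (Suc v)"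
  let ?B = "lex_key E ?o i"
  \<comment> \<open>For empty \<open>D\<close> these are the doubled keys, with the same order and
    classes as the old ones; when \<open>D\<close> is the whole neighborhood they are the keys of
    the next round.\<close>
  let ?K = "\<lambda>D u. 2 * ?B u + of_bool (u \<in> D)"
  have part: "state_partition n i ?B s" and stamps: "\<And>u. u < n \<Longrightarrow> i \<le> arr s ''pos'' u \<Longrightarrow>
        arr s ''stamp'' (arr s ''cls'' u) \<le> i" and r: "?o 0 = r"
    and earlier: "\<And>x u. x < i \<Longrightarrow> u < n \<Longrightarrow> x < arr s ''pos'' u \<Longrightarrow>
        lex_key E ?o x u \<le> lex_key E ?o x (?o x)"
    using inv unfolding lexbfs_inv_def by blast+
  note P = key_partitionD[OF part]
  define s1 where "s1 = s\<lparr>reg := (reg s)(''v'' := v),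
    arr := (arr s)(''beg'' := (arr s ''beg'')(arr s ''cls'' v := Suc i))\<rparr>"
  have 1: "exec (''v'' ::= ''ord''\<langle>Var ''i''\<rangle>;; ''beg''\<langle>''cls''\<langle>Var ''v''\<rangle>\<rangle> ::= Var ''i'' \<oplus> Lit 1) s 9 s1"
    by (rule exec_of_wp) (simp add: wp_simps s1_def i v)
  define J where "J = (\<lambda>j (s' :: state). let D = arr s ''cadj'' ` {?p..<j} in
     state_partition n (Suc i) (?K D) s' \<and> state_marks n i D (?K D) s' \<and>
     (\<forall>x\<le>i. arr s' ''ord'' x = ?o x))"
  have pq: "?p \<le> ?q" "card (nbrs E v) = ?q - ?p" "arr s ''cadj'' ` {?p..<?q} = nbrs E v"
      "inj_on (arr s ''cadj'') {?p..<?q}"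
    using adj stores_card[OF adj] by (auto simp: stores_def)
  let ?F = "FOR ''j'' FROM ''coff''\<langle>Var ''v''\<rangle> TO ''coff''\<langle>Var ''v'' \<oplus> Lit 1\<rangle> DO lexbfs_visit"
  have "runs ?F s1 (111 * card (nbrs E v) + 10) (\<lambda>s'. J ?q s' \<and> reg s' ''j'' = ?q)"
  proof (rule runs_For[where T = "\<lambda>_. 100"])
    have part1: "state_partition n (Suc i) ?B s1"
      using key_partition_pivot[OF part i(1)] by (simp add: s1_def v)
    have "state_partition n (Suc i) (?K {}) s1"
      unfolding key_partition_def
      using part1 unfolding key_partition_def by simp
    moreover have "state_marks n i {} (?K {}) s1"
    proof -
      \<comment> \<open>Before the first neighbor no raised key exists, as all keys are even, and no
        live class is stamped \<open>Suc i\<close>: the two sides of the equivalence in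
        \<open>split_marks\<close> are both false.\<close>
      have parity: "2 * a \<noteq> Suc (2 * b)" for a b :: nat by presburger
      have "arr s1 ''stamp'' (arr s1 ''cls'' u) \<le> i" if "u < n" "i < arr s1 ''pos'' u" for u
        using stamps[of u] that by (simp add: s1_def)
      then have "arr s1 ''stamp'' (arr s1 ''cls'' u) \<le> Suc i \<and> arr s1 ''stamp'' (arr s1 ''cls'' u) \<noteq> Suc i"
        if "u < n" "i < arr s1 ''pos'' u" for u
        using that by fastforce
      then show ?thesis unfolding split_marks_def by (simp add: parity)
    qed
    ultimately show "J (aval (''coff''\<langle>Var ''v''\<rangle>) s1) (s1\<lparr>reg := (reg s1)(''j'' := aval (''coff''\<langle>Var ''v''\<rangle>) s1)\<rparr>)"
      by (simp add: J_def s1_def)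
  next
    fix j s'
    assume j: "aval (''coff''\<langle>Var ''v''\<rangle>) s1 \<le> j" "j < ?q" "reg s' ''j'' = j"
      and fr: "frame ?F s1 s'" and J: "J j s'"
    have fr': "reg s' ''i'' = i" "arr s' ''cadj'' = arr s ''cadj''"
      using fr i by (simp_all add: frame_def s1_def)
    have pj: "?p \<le> j" using j by (simp add: s1_def)
    let ?D = "arr s ''cadj'' ` {?p..<j}" and ?u = "arr s ''cadj'' j"
    have D': "arr s ''cadj'' ` {?p..<Suc j} = insert ?u ?D" using pj by (simp add: atLeastLessThanSuc)
    have uD: "?u \<notin> ?D" using inj_onD[OF pq(4), of j] pj j(2) by fastforce
    have un: "?u < n" using N pq(3) pj j(2) by force
    have K': "(?K ?D)(?u := Suc (?K ?D ?u)) = ?K (insert ?u ?D)" using uD by auto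
    have "runs lexbfs_visit s' 100 (\<lambda>s''.
      state_partition n (Suc i) (?K (insert ?u ?D)) s'' \<and>
      state_marks n i (insert ?u ?D) (?K (insert ?u ?D)) s'' \<and>
      (\<forall>x\<le>i. arr s'' ''ord'' x = arr s' ''ord'' x))"
      unfolding K'[symmetric]
      by (rule lexbfs_visit_runs) (use J fr' uD un j in \<open>auto simp: J_def Let_def\<close>)
    then show "runs lexbfs_visit s' 100 (\<lambda>s''. J (Suc j) (s''\<lparr>reg := (reg s'')(''j'' := Suc j)\<rparr>))"
      by (rule wp_mono) (use J in \<open>simp add: J_def D'\<close>)
  next
    show "(\<Sum>i = aval (''coff''\<langle>Var ''v''\<rangle>) s1..<?q. 100 + (acost (''coff''\<langle>Var ''v'' \<oplus> Lit 1\<rangle>) + 7)) +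
      acost (''coff''\<langle>Var ''v''\<rangle>) + acost (''coff''\<langle>Var ''v'' \<oplus> Lit 1\<rangle>) + 4 \<le> 111 * card (nbrs E v) + 10"
      by (simp add: s1_def pq(2))
  qed (use pq in \<open>auto simp: frame_def s1_def\<close>)
  then obtain t2 s2 where 2: "exec ?F s1 t2 s2" "t2 \<le> 111 * card (nbrs E v) + 10" "J ?q s2"
    unfolding wp_def by blast
  let ?N = "nbrs E v" and ?o2 = "arr s2 ''ord''"
  have part2: "state_partition n (Suc i) (?K ?N) s2" and marks2: "state_marks n i ?N (?K ?N) s2"
    and same: "\<And>x. x \<le> i \<Longrightarrow> ?o2 x = ?o x"
    using 2(3) pq(3) by (auto simp: J_def Let_def)
  note P2 = key_partitionD[OF part2]
  \<comment> \<open>The unchanged entries of \<open>ord\<close> up to \<open>i\<close> determine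
    which vertices sit there, hence also which ones come later, although the latter may have been
    permuted.\<close>
  have same_pos: "arr s2 ''pos'' u = x \<longleftrightarrow> arr s ''pos'' u = x" if "u < n" "x \<le> i" for u x
    using P(2,4)[of x] P(4)[of u] P2(2)[of x] P2(4)[of u] same[OF that(2)] that i(1)
    by (metis le_less_trans)
  have later: "x < arr s2 ''pos'' u \<longleftrightarrow> x < arr s ''pos'' u" if "u < n" "x \<le> i" for u x
    using same_pos[OF that(1), of "arr s2 ''pos'' u"] same_pos[OF that(1), of "arr s ''pos'' u"] that(2)
    by (cases "arr s2 ''pos'' u \<le> i"; cases "arr s ''pos'' u \<le> i") simp_all
  have keys: "lex_key E ?o2 x = lex_key E ?o x" if "x \<le> Suc i" for x
    using that same by (intro ext lex_key_cong) simp
  have key_Suc: "lex_key E ?o2 (Suc i) = ?K ?N"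
    using keys[of i] same[of i] v by (intro ext) simp
  have "lexbfs_inv E n r (Suc i) s2"
    unfolding lexbfs_inv_def key_Suc
  proof (intro conjI allI impI)
    show "?o2 0 = r" using same[of 0] r by simp
    fix u assume "u < n" "Suc i \<le> arr s2 ''pos'' u"
    then show "arr s2 ''stamp'' (arr s2 ''cls'' u) \<le> Suc i"
      using marks2 by (simp add: split_marks_def)
  next
    fix x u assume x: "x < Suc i" and u: "u < n" "x < arr s2 ''pos'' u"
    then have u': "x < arr s ''pos'' u" using later by simp
    have "lex_key E ?o x u \<le> lex_key E ?o x (?o x)"
    proof (cases "x = i")
      case True
      then show ?thesis using P(5)[of i "arr s ''pos'' u"] P(3,4)[OF u(1)] u' by simp
    next
      case False
      then show ?thesis using earlier x u(1) u' by simp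
    qed
    then show "lex_key E ?o2 x u \<le> lex_key E ?o2 x (?o2 x)" using keys same x by simp
  qed (fact part2)
  moreover have "\<forall>u<n. i < arr s2 ''pos'' u \<longleftrightarrow> i < arr s ''pos'' u" using later by simp
  ultimately show ?thesis
    by (intro runsI[OF exec.Seq[OF 1 2(1)]]) (use 2(2) in auto)
qed

section \<open>Initialization and complete run of the search\<close>

abbreviation lexbfs_identity :: com where
  "lexbfs_identity \<equiv>
    FOR ''i'' FROM Lit 0 TO Var ''n'' DO (
      ''ord''\<langle>Var ''i''\<rangle> ::= Var ''i'';;
      ''pos''\<langle>Var ''i''\<rangle> ::= Var ''i'';;
      ''cls''\<langle>Var ''i''\<rangle> ::= Lit 0)"

abbreviation lexbfs_init :: com where
  "lexbfs_init \<equiv>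
    lexbfs_identity;;
    ''ord''\<langle>Var ''start''\<rangle> ::= Lit 0;;
    ''ord''\<langle>Lit 0\<rangle> ::= Var ''start'';;
    ''pos''\<langle>Lit 0\<rangle> ::= Var ''start'';;
    ''pos''\<langle>Var ''start''\<rangle> ::= Lit 0;;
    ''beg''\<langle>Lit 0\<rangle> ::= Lit 0;;
    ''stamp''\<langle>Lit 0\<rangle> ::= Lit 0;;
    ''k'' ::= Lit 1"

text \<open>With no bits yet, all keys are 0 and there is a single class beginning at 0, so any
  vertex may come first; placing \<open>start\<close> there implements its initial label. The four
  writes exchange \<open>0\<close> and \<open>start\<close> in \<open>ord\<close> and
  \<open>pos\<close>, and their order also leaves the identity intact when \<open>start\<close> is
  0.\<close>

lemma lexbfs_init_runs:
  assumes r: "r = reg s ''start''" "r < n" and n: "n = reg s ''n''"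
  shows "runs lexbfs_init s (17 * n + 30) (\<lambda>s'. lexbfs_inv E n r 0 s')"
proof -
  have "runs lexbfs_identity s (17 * n + 6)
      (\<lambda>s'. \<forall>x<n. arr s' ''ord'' x = x \<and> arr s' ''pos'' x = x \<and> arr s' ''cls'' x = 0)"
    by (rule wp_mono[OF runs_For[where T = "\<lambda>_. 9" and b = n and T' = "17 * n + 6" and I = "\<lambda>i s'.
        \<forall>x<i. arr s' ''ord'' x = x \<and> arr s' ''pos'' x = x \<and> arr s' ''cls'' x = 0"]])
      (simp_all add: wp_simps frame_def less_Suc_eq n[symmetric])
  then obtain t1 s1 where 1: "exec lexbfs_identity s t1 s1" "t1 \<le> 17 * n + 6"
      "\<forall>x<n. arr s1 ''ord'' x = x \<and> arr s1 ''pos'' x = x \<and> arr s1 ''cls'' x = 0"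
      "frame lexbfs_identity s s1"
    by (rule runsE)
  have st: "reg s1 ''start'' = r" using 1(4) r by (simp add: frame_def)
  show ?thesis
    by (rule runsI[OF exec.Seq[OF exec.Seq[OF exec.Seq[OF exec.Seq[OF exec.Seq[OF exec.Seq[OF
              exec.Seq[OF 1(1) exec.Put] exec.Put] exec.Put] exec.Put] exec.Put] exec.Put] exec.Assign]])
      (use 1(2,3) st r in \<open>auto simp: lexbfs_inv_def key_partition_def\<close>)
qed

abbreviation lexbfs_main :: com where
  "lexbfs_main \<equiv> FOR ''i'' FROM Lit 0 TO Var ''n'' DO lexbfs_pivot"

text \<open>Which vertex comes at position \<open>i\<close> is decided during the run, so the cost
  of a round is no function of \<open>i\<close> fixed in advance. The potential is 111 times the sum
  of the degrees of the unnumbered vertices; it starts at no more than 222 times the number of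
  edges.\<close>

lemma lexbfs_main_runs:
  assumes inv: "lexbfs_inv E n r 0 s" and n: "n = reg s ''n''"
    and adj: "adjacency_lists ''coff'' ''cadj'' s V E" and sg: "simple_graph V E"
  shows "runs lexbfs_main s (28 * n + 222 * card E + 6) (lexbfs_inv E n r n)"
proof -
  have V: "V = {..<n}" and lists: "\<And>v. v < n \<Longrightarrow>
      stores (arr s ''cadj'') (arr s ''coff'' v) (arr s ''coff'' (Suc v)) (nbrs E v)"
    using adj n by (auto simp: adjacency_lists_iff)
  have N: "nbrs E v \<subseteq> {..<n}" for v using nbrs_subset[OF sg] V by blast
  let ?d = "\<lambda>u. card (nbrs E u)"
  let ?U = "\<lambda>i (s' :: state). {u. u < n \<and> i \<le> arr s' ''pos'' u}"
  have "runs lexbfs_main s (28 * n + 222 * card E + 6) (\<lambda>s'. lexbfs_inv E n r n s' \<and> reg s' ''i'' = n)"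
  proof (rule runs_For_amortized[where I = "lexbfs_inv E n r" and b = n and T = "\<lambda>_. 20" and \<Phi> = "\<lambda>i s'. 111 * (\<Sum>u\<in>?U i s'. ?d u)"])
    show "lexbfs_inv E n r (aval (Lit 0) s) (s\<lparr>reg := (reg s)(''i'' := aval (Lit 0) s)\<rparr>)"
      using inv by (simp add: lexbfs_inv_def)
  next
    fix i s'
    assume i: "i < n" "reg s' ''i'' = i" and fr: "frame lexbfs_main s s'" and I: "lexbfs_inv E n r i s'"
    let ?v = "arr s' ''ord'' i"
    have P: "state_partition n i (lex_key E (arr s' ''ord'') i) s'" using I by (simp add: lexbfs_inv_def)
    have v: "?v < n" "arr s' ''pos'' ?v = i" using key_partitionD(1,2)[OF P i(1)] by auto
    have vpos: "u = ?v" if "u < n" "arr s' ''pos'' u = i" for u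
      using key_partitionD(4)[OF P that(1)] that(2) by simp
    have U: "?U i s' = insert ?v {u. u < n \<and> i < arr s' ''pos'' u}" (is "_ = insert _ ?W")
    proof -
      have "{u. u < n \<and> arr s' ''pos'' u = i} = {?v}" using v vpos by blast
      moreover have "?U i s' = {u. u < n \<and> arr s' ''pos'' u = i} \<union> ?W" by auto
      ultimately show ?thesis by simp
    qed
    have "(\<Sum>u\<in>?U i s'. ?d u) = ?d ?v + (\<Sum>u\<in>?W. ?d u)"
      unfolding U using v by (subst sum.insert) auto
    then have sum: "111 * (\<Sum>u\<in>?U i s'. ?d u) = 111 * ?d ?v + 111 * (\<Sum>u\<in>?W. ?d u)" by simp
    have "arr s' ''cadj'' = arr s ''cadj''" "arr s' ''coff'' = arr s ''coff''"
      using fr by (simp_all add: frame_def)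
    then have "runs lexbfs_pivot s' (111 * ?d ?v + 20) (\<lambda>s''.
        lexbfs_inv E n r (Suc i) s'' \<and> (\<forall>u<n. i < arr s'' ''pos'' u \<longleftrightarrow> i < arr s' ''pos'' u))"
      using lists[OF v(1)] N by (intro lexbfs_pivot_runs[OF I i refl]) simp_all
    then show "wp lexbfs_pivot (\<lambda>t s''.
        t + 111 * (\<Sum>u\<in>?U (Suc i) (s''\<lparr>reg := (reg s'')(''i'' := Suc i)\<rparr>). ?d u)
          \<le> 20 + 111 * (\<Sum>u\<in>?U i s'. ?d u) \<and>
        lexbfs_inv E n r (Suc i) (s''\<lparr>reg := (reg s'')(''i'' := Suc i)\<rparr>)) s'"
    proof (rule wp_mono)
      fix t and s'' :: state
      assume *: "t \<le> 111 * ?d ?v + 20 \<and> lexbfs_inv E n r (Suc i) s'' \<and>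
        (\<forall>u<n. i < arr s'' ''pos'' u \<longleftrightarrow> i < arr s' ''pos'' u)"
      then have "?U (Suc i) s'' = ?W" by auto
      then show "t + 111 * (\<Sum>u\<in>?U (Suc i) (s''\<lparr>reg := (reg s'')(''i'' := Suc i)\<rparr>). ?d u)
          \<le> 20 + 111 * (\<Sum>u\<in>?U i s'. ?d u) \<and>
        lexbfs_inv E n r (Suc i) (s''\<lparr>reg := (reg s'')(''i'' := Suc i)\<rparr>)"
        using * unfolding sum by (simp add: lexbfs_inv_def)
    qed
  next
    have "(\<Sum>u\<in>?U 0 s. ?d u) = (\<Sum>u\<in>V. ?d u)" by (rule sum.cong) (auto simp: V)
    then show "(\<Sum>i = aval (Lit 0) s..<n. 20 + (acost (Var ''n'') + 7)) + acost (Lit 0) + acost (Var ''n'') + 4 +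
      111 * (\<Sum>u\<in>?U (aval (Lit 0) s) (s\<lparr>reg := (reg s)(''i'' := aval (Lit 0) s)\<rparr>). ?d u)
      \<le> 28 * n + 222 * card E + 6"
      using sum_degrees_le[OF sg] by simp
  qed (use n in \<open>auto simp: frame_def\<close>)
  then show ?thesis by (rule wp_mono) simp
qed

lemma reverse_ord_runs:
  "runs (FOR ''i'' FROM Lit 0 TO Var ''n'' DO
      ''sigma''\<langle>Var ''i''\<rangle> ::= ''ord''\<langle>Var ''n'' \<ominus> Lit 1 \<ominus> Var ''i''\<rangle>) s (16 * reg s ''n'' + 6)
    (\<lambda>s'. \<forall>i<reg s ''n''. arr s' ''sigma'' i = arr s ''ord'' (reg s ''n'' - 1 - i))"
  by (rule wp_mono[OF runs_For[where T = "\<lambda>_. 8" and b = "reg s ''n''" and I = "\<lambda>i s'.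
      \<forall>j<i. arr s' ''sigma'' j = arr s ''ord'' (reg s ''n'' - 1 - j)"]])
    (auto simp: wp_simps frame_def less_Suc_eq)

lemma peo_prog_runs:
  assumes adj: "adjacency_lists ''coff'' ''cadj'' s V E" and sg: "simple_graph V E"
    and r: "r = reg s ''start''" "r \<in> V" and n: "n = reg s ''n''"
  shows "runs peo_prog s (61 * n + 222 * card E + 42) (\<lambda>s'. \<exists>\<tau>.
      bij_betw \<tau> {..<n} V \<and> \<tau> 0 = r \<and>
      (\<forall>x y. x < y \<longrightarrow> y < n \<longrightarrow> lex_key E \<tau> x (\<tau> y) \<le> lex_key E \<tau> x (\<tau> x)) \<and>
      stored_ordering s' = rev (map \<tau> [0..<n]))"
proof -
  have V: "V = {..<n}" using adj n by (simp add: adjacency_lists_iff)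
  have "runs lexbfs_init s (17 * n + 30) (lexbfs_inv E n r 0)"
    using r V n by (intro lexbfs_init_runs) auto
  then obtain t1 s1 where 1: "exec lexbfs_init s t1 s1" "t1 \<le> 17 * n + 30" "lexbfs_inv E n r 0 s1"
      "frame lexbfs_init s s1"
    by (rule runsE)
  have n1: "n = reg s1 ''n''" "arr s1 ''cadj'' = arr s ''cadj''" "arr s1 ''coff'' = arr s ''coff''"
    using 1(4) n by (simp_all add: frame_def)
  then have "adjacency_lists ''coff'' ''cadj'' s1 V E" using adj n by (simp add: adjacency_lists_iff)
  then obtain t2 s2 where 2: "exec lexbfs_main s1 t2 s2" "t2 \<le> 28 * n + 222 * card E + 6"
      "lexbfs_inv E n r n s2" "frame lexbfs_main s1 s2"
    using lexbfs_main_runs[OF 1(3) n1(1) _ sg] by (blast elim: runsE)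
  have n2: "reg s2 ''n'' = n" using 2(4) n1 by (simp add: frame_def)
  let ?F = "FOR ''i'' FROM Lit 0 TO Var ''n'' DO
      ''sigma''\<langle>Var ''i''\<rangle> ::= ''ord''\<langle>Var ''n'' \<ominus> Lit 1 \<ominus> Var ''i''\<rangle>"
  obtain t3 s3 where 3: "exec ?F s2 t3 s3" "t3 \<le> 16 * n + 6"
      "\<forall>i<n. arr s3 ''sigma'' i = arr s2 ''ord'' (n - 1 - i)" "frame ?F s2 s3"
    by (rule runsE[OF reverse_ord_runs[of s2, unfolded n2]])
  have n3: "reg s3 ''n'' = n" using 3(4) n2 by (simp add: frame_def)
  let ?\<tau> = "arr s2 ''ord''"
  have P: "state_partition n n (lex_key E ?\<tau> n) s2" and r0: "?\<tau> 0 = r"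
    and sorted: "\<And>x u. x < n \<Longrightarrow> u < n \<Longrightarrow> x < arr s2 ''pos'' u \<Longrightarrow>
        lex_key E ?\<tau> x u \<le> lex_key E ?\<tau> x (?\<tau> x)"
    using 2(3) unfolding lexbfs_inv_def by blast+
  note D = key_partitionD[OF P]
  have "bij_betw ?\<tau> {..<n} V"
    unfolding V by (rule bij_betw_byWitness[where f' = "arr s2 ''pos''"]) (use D(1-4) in auto)
  moreover have "lex_key E ?\<tau> x (?\<tau> y) \<le> lex_key E ?\<tau> x (?\<tau> x)" if "x < y" "y < n" for x y
    using sorted[of x "?\<tau> y"] D(1,2)[OF that(2)] that by simp
  moreover have "stored_ordering s3 = rev (map ?\<tau> [0..<n])"
    unfolding stored_ordering_def n3 using 3(3) by (intro nth_equalityI) (simp_all add: rev_nth)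
  ultimately have post: "\<exists>\<tau>. bij_betw \<tau> {..<n} V \<and> \<tau> 0 = r \<and>
      (\<forall>x y. x < y \<longrightarrow> y < n \<longrightarrow> lex_key E \<tau> x (\<tau> y) \<le> lex_key E \<tau> x (\<tau> x)) \<and>
      stored_ordering s3 = rev (map \<tau> [0..<n])"
    using r0 by (intro exI[of _ ?\<tau>]) simp
  show ?thesis
    unfolding peo_prog_def lexbfs_prog_def
    by (rule runsI[OF exec.Seq[OF exec.Seq[OF 1(1) 2(1)] 3(1)]])
      (use 1(2) 2(2) 3(2) in linarith, fact post)
qed

section \<open>The while loop\<close>

lemma hd_filter_map_upt:
  assumes "x < n" "P (g x)" "\<And>y. y < x \<Longrightarrow> \<not> P (g y)"
  shows "filter P (map g [0..<n]) \<noteq> []" "hd (filter P (map g [0..<n])) = g x"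
proof -
  have "[0..<n] = [0..<x] @ x # [Suc x..<n]"
    using assms(1) upt_add_eq_append[of 0 x "n - x"] upt_conv_Cons[of x n] by simp
  then have "map g [0..<n] = map g [0..<x] @ g x # map g [Suc x..<n]" by simp
  moreover have "filter P (map g [0..<x]) = []" using assms(3) by (simp add: filter_empty_conv)
  ultimately have "filter P (map g [0..<n]) = g x # filter P (map g [Suc x..<n])"
    using assms(2) by simp
  then show "filter P (map g [0..<n]) \<noteq> []" "hd (filter P (map g [0..<n])) = g x" by simp_all
qed

text \<open>The current graph is the subgraph of \<open>E\<close> induced by \<open>A\<close>, whose
  neighborhoods are \<open>nbrs E u \<inter> A\<close>. Since \<open>L\<close> is contained in
  \<open>A\<close>, the emptiness test gives the same answer with the full neighborhood, so the
  adjacency lists can stay as they are.\<close>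

lemma algB_loop_step:
  assumes "set \<sigma> = V" "A \<subseteq> V" "v \<in> A" "filter (\<lambda>u. u \<in> A) \<sigma> \<noteq> []" "hd (filter (\<lambda>u. u \<in> A) \<sigma>) = v"
    and L: "L = {u \<in> A. u \<noteq> v \<and> u \<notin> nbrs E v}"
    and R: "R = insert v {u \<in> nbrs E v. u \<in> A \<and> nbrs E u \<inter> L = {}}"
    and rest: "algB_loop {e \<in> E. e \<subseteq> A - R} (filter (\<lambda>u. u \<in> A - R) \<sigma>)
      (if L \<noteq> {} then insert {L, R} bp else bp) bp'"
  shows "algB_loop {e \<in> E. e \<subseteq> A} (filter (\<lambda>u. u \<in> A) \<sigma>) bp bp'"
proof (rule algB_loop.iterate[OF assms(4) refl, unfolded assms(5)])
  let ?E = "{e \<in> E. e \<subseteq> A}"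
  have N: "nbrs ?E u = nbrs E u \<inter> A" if "u \<in> A" for u using that by (auto simp: nbrs_def)
  have "set (filter (\<lambda>u. u \<in> A) \<sigma>) = A" using assms(1,2) by auto
  then show "L = set (filter (\<lambda>u. u \<in> A) \<sigma>) - ({v} \<union> nbrs ?E v)"
    unfolding L N[OF assms(3)] by auto
  show "R = {v} \<union> {u \<in> nbrs ?E v. nbrs ?E u \<inter> L = {}}"
    unfolding R N[OF assms(3)] using N L by auto
  have "{e \<in> ?E. e \<inter> R = {}} = {e \<in> E. e \<subseteq> A - R}" by auto
  moreover have "filter (\<lambda>u. u \<notin> R) (filter (\<lambda>u. u \<in> A) \<sigma>) = filter (\<lambda>u. u \<in> A - R) \<sigma>"
    by (auto intro: filter_cong)
  ultimately show "algB_loop {e \<in> ?E. e \<inter> R = {}} (filter (\<lambda>u. u \<notin> R) (filter (\<lambda>u. u \<in> A) \<sigma>))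
      (if L \<noteq> {} then insert {L, R} bp else bp) bp'"
    using rest by simp
qed

section \<open>The pieces of one round\<close>

abbreviation find_alive_prog :: com where
  "find_alive_prog \<equiv> WHILE ''alive''\<langle>''sigma''\<langle>Var ''h''\<rangle>\<rangle> \<doteq> Lit 0 DO Incr ''h''"

text \<open>The bound ignores the progress of \<open>h\<close> in former rounds: a round scans all
  marks anyway, so a cost linear in \<open>x\<close> does no harm. Each step costs 6 for the test
  and 4 for the increment.\<close>

lemma find_alive_runs:
  assumes x: "arr s ''alive'' (arr s ''sigma'' x) \<noteq> 0"
      "\<And>y. y < x \<Longrightarrow> arr s ''alive'' (arr s ''sigma'' y) = 0"
    and "reg s ''h'' \<le> x"
  shows "runs find_alive_prog s (10 * x + 6) (\<lambda>s'. reg s' ''h'' = x)"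
proof -
  define I where "I = (\<lambda>s' :: state. arr s' = arr s \<and> reg s' ''h'' \<le> x)"
  have "runs find_alive_prog s ((x - reg s ''h'') * (4 + bcost (''alive''\<langle>''sigma''\<langle>Var ''h''\<rangle>\<rangle> \<doteq> Lit 0) + 1)
      + bcost (''alive''\<langle>''sigma''\<langle>Var ''h''\<rangle>\<rangle> \<doteq> Lit 0) + 1)
      (\<lambda>s'. I s' \<and> \<not> bval (''alive''\<langle>''sigma''\<langle>Var ''h''\<rangle>\<rangle> \<doteq> Lit 0) s')"
  proof (rule runs_While[where f = "\<lambda>s'. x - reg s' ''h''"])
    show "I s" using assms(3) by (simp add: I_def)
    fix s' :: state assume I: "I s'" and b: "bval (''alive''\<langle>''sigma''\<langle>Var ''h''\<rangle>\<rangle> \<doteq> Lit 0) s'"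
    then have "reg s' ''h'' \<noteq> x" using x(1) by (auto simp: I_def)
    then have "reg s' ''h'' < x" using I by (simp add: I_def)
    then show "runs (Incr ''h'') s' 4 (\<lambda>s''. I s'' \<and> x - reg s'' ''h'' < x - reg s' ''h'')"
      using I by (simp add: wp_simps I_def)
  qed
  then show ?thesis
  proof (rule wp_mono, intro conjI)
    fix t and s' :: state
    assume *: "t \<le> (x - reg s ''h'') * (4 + bcost (''alive''\<langle>''sigma''\<langle>Var ''h''\<rangle>\<rangle> \<doteq> Lit 0) + 1)
      + bcost (''alive''\<langle>''sigma''\<langle>Var ''h''\<rangle>\<rangle> \<doteq> Lit 0) + 1 \<and>
      I s' \<and> \<not> bval (''alive''\<langle>''sigma''\<langle>Var ''h''\<rangle>\<rangle> \<doteq> Lit 0) s'"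
    have "t \<le> (x - reg s ''h'') * 10 + 6" using conjunct1[OF *] by simp
    moreover have "(x - reg s ''h'') * 10 \<le> x * 10" by simp
    ultimately show "t \<le> 10 * x + 6" by linarith
    have "\<not> reg s' ''h'' < x" using * x(2) by (auto simp: I_def)
    then show "reg s' ''h'' = x" using * by (simp add: I_def)
  qed
qed

abbreviation collect_L_prog :: com where
  "collect_L_prog \<equiv>
      FOR ''i'' FROM Lit 0 TO Var ''n'' DO
        (IF ''mark''\<langle>Var ''i''\<rangle> \<prec> ''alive''\<langle>Var ''i''\<rangle>
         THEN (
           ''inL''\<langle>Var ''i''\<rangle> ::= Lit 1;;
           ''lout''\<langle>Var ''p''\<rangle> ::= Var ''i'';;
           Incr ''p'')
         ELSE ''inL''\<langle>Var ''i''\<rangle> ::= Lit 0)"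

text \<open>When both arrays have values 0 and 1, the single comparison of mark with alive means
  alive and unmarked. Every cell of \<open>inL\<close> below \<open>n\<close> is rewritten, so
  nothing is left over from earlier rounds.\<close>

lemma collect_L_runs:
  assumes n: "n = reg s ''n''" and p: "p = reg s ''p''"
    and L: "L = {u. u < n \<and> arr s ''mark'' u < arr s ''alive'' u}"
  shows "runs collect_L_prog s (24 * n + 6) (\<lambda>s'. stores (arr s' ''lout'') p (reg s' ''p'') L \<and>
     (\<forall>k<p. arr s' ''lout'' k = arr s ''lout'' k) \<and> (\<forall>u<n. arr s' ''inL'' u = of_bool (u \<in> L)))"
proof -
  let ?L = "\<lambda>i. {u. u < i \<and> arr s ''mark'' u < arr s ''alive'' u}"
  have L': "?L (Suc i) = (if arr s ''mark'' i < arr s ''alive'' i then insert i (?L i) else ?L i)" for i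
    by (auto simp: less_Suc_eq)
  define I where "I = (\<lambda>i (s' :: state). stores (arr s' ''lout'') p (reg s' ''p'') (?L i) \<and>
     (\<forall>k<p. arr s' ''lout'' k = arr s ''lout'' k) \<and>
     (\<forall>u<i. arr s' ''inL'' u = of_bool (arr s ''mark'' u < arr s ''alive'' u)))"
  have "runs collect_L_prog s (24 * n + 6) (\<lambda>s'. I n s' \<and> reg s' ''i'' = n)"
  proof (rule runs_For[where T = "\<lambda>_. 16"])
    fix i s' assume i: "reg s' ''i'' = i" and fr: "frame collect_L_prog s s'" and I: "I i s'"
    have same: "arr s' ''mark'' = arr s ''mark''" "arr s' ''alive'' = arr s ''alive''"
      using fr by (simp_all add: frame_def)
    have le: "p \<le> reg s' ''p''" using I by (simp add: I_def stores_def)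
    have "stores ((arr s' ''lout'')(reg s' ''p'' := i)) p (Suc (reg s' ''p'')) (insert i (?L i))"
      using I by (intro stores_append) (auto simp: I_def)
    then show "runs (IF ''mark''\<langle>Var ''i''\<rangle> \<prec> ''alive''\<langle>Var ''i''\<rangle>
         THEN (
           ''inL''\<langle>Var ''i''\<rangle> ::= Lit 1;;
           ''lout''\<langle>Var ''p''\<rangle> ::= Var ''i'';;
           Incr ''p'')
         ELSE ''inL''\<langle>Var ''i''\<rangle> ::= Lit 0) s' 16
         (\<lambda>s''. I (Suc i) (s''\<lparr>reg := (reg s'')(''i'' := Suc i)\<rparr>))"
      using I i same le L'[of i] by (simp add: wp_simps I_def less_Suc_eq)
  qed (use n p in \<open>simp_all add: frame_def I_def stores_empty\<close>)
  then show ?thesis by (rule wp_mono) (simp add: I_def L)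
qed

abbreviation check_prog :: com where
  "check_prog \<equiv>
        FOR ''l'' FROM ''coff''\<langle>Var ''u''\<rangle> TO ''coff''\<langle>Var ''u'' \<oplus> Lit 1\<rangle> DO
          (IF ''inL''\<langle>''cadj''\<langle>Var ''l''\<rangle>\<rangle> \<doteq> Lit 1 THEN ''ok'' ::= Lit 0 ELSE SKIP)"

lemma check_runs:
  assumes "stores (arr s ''cadj'') (arr s ''coff'' (reg s ''u'')) (arr s ''coff'' (Suc (reg s ''u''))) N"
  shows "runs check_prog s (19 * card N + 10)
    (\<lambda>s'. reg s' ''ok'' = (if \<exists>y\<in>N. arr s ''inL'' y = 1 then 0 else reg s ''ok''))"
proof -
  let ?p = "arr s ''coff'' (reg s ''u'')" and ?q = "arr s ''coff'' (Suc (reg s ''u''))"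
  have N: "?p \<le> ?q" "N = arr s ''cadj'' ` {?p..<?q}" "card N = ?q - ?p"
    using assms(1) stores_card by (auto simp: stores_def)
  define I where "I = (\<lambda>j (s' :: state). reg s' ''ok'' =
      (if \<exists>y\<in>arr s ''cadj'' ` {?p..<j}. arr s ''inL'' y = 1 then 0 else reg s ''ok''))"
  have "runs check_prog s (19 * card N + 10) (\<lambda>s'. I ?q s' \<and> reg s' ''l'' = ?q)"
  proof (rule runs_For[where T = "\<lambda>_. 8"])
    fix j s' assume j: "aval (''coff''\<langle>Var ''u''\<rangle>) s \<le> j" "reg s' ''l'' = j"
      and fr: "frame check_prog s s'" and I: "I j s'"
    have same: "arr s' = arr s" using fr by (auto simp: frame_def)
    have "{?p..<Suc j} = insert j {?p..<j}" using j(1) by auto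
    then show "runs (IF ''inL''\<langle>''cadj''\<langle>Var ''l''\<rangle>\<rangle> \<doteq> Lit 1 THEN ''ok'' ::= Lit 0 ELSE SKIP) s' 8
      (\<lambda>s''. I (Suc j) (s''\<lparr>reg := (reg s'')(''l'' := Suc j)\<rparr>))"
      using I j same by (simp add: wp_simps I_def)
  qed (use N in \<open>simp_all add: frame_def I_def\<close>)
  then show ?thesis by (rule wp_mono) (simp add: I_def N(2))
qed

abbreviation collect_R_step :: com where
  "collect_R_step \<equiv>
        ''u'' ::= ''cadj''\<langle>Var ''j''\<rangle>;;
        ''ok'' ::= ''alive''\<langle>Var ''u''\<rangle>;;
        check_prog;;
        (IF Var ''ok'' \<doteq> Lit 1
         THEN (''rout''\<langle>Var ''q''\<rangle> ::= Var ''u'';; Incr ''q'')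
         ELSE SKIP)"

abbreviation collect_R_prog :: com where
  "collect_R_prog \<equiv>
      FOR ''j'' FROM ''coff''\<langle>Var ''v''\<rangle> TO ''coff''\<langle>Var ''v'' \<oplus> Lit 1\<rangle> DO collect_R_step"

lemma collect_R_step_runs:
  assumes u: "u = arr s ''cadj'' (reg s ''j'')"
    and "stores (arr s ''cadj'') (arr s ''coff'' u) (arr s ''coff'' (Suc u)) N"
    and X: "stores (arr s ''rout'') q (reg s ''q'') X" "u \<notin> X"
  shows "runs collect_R_step s (19 * card N + 27) (\<lambda>s'.
      stores (arr s' ''rout'') q (reg s' ''q'')
        (if arr s ''alive'' u = 1 \<and> \<not> (\<exists>y\<in>N. arr s ''inL'' y = 1) then insert u X else X) \<and>
      (\<forall>k<q. arr s' ''rout'' k = arr s ''rout'' k))"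
proof -
  define s1 where "s1 = s\<lparr>reg := (reg s)(''u'' := u, ''ok'' := arr s ''alive'' u)\<rparr>"
  have 1: "exec (''u'' ::= ''cadj''\<langle>Var ''j''\<rangle>;; ''ok'' ::= ''alive''\<langle>Var ''u''\<rangle>) s 6 s1"
    by (rule exec_of_wp) (simp add: wp_simps s1_def u)
  obtain t2 s2 where 2: "exec check_prog s1 t2 s2" "t2 \<le> 19 * card N + 10"
      "reg s2 ''ok'' = (if \<exists>y\<in>N. arr s1 ''inL'' y = 1 then 0 else reg s1 ''ok'')"
      "frame check_prog s1 s2"
    by (rule runsE[OF check_runs[of s1 N]]) (use assms(2) in \<open>auto simp: s1_def\<close>)
  have same: "arr s2 = arr s" "reg s2 ''q'' = reg s ''q''" "reg s2 ''u'' = u"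
    using 2(4) by (auto simp: frame_def s1_def)
  have ok: "reg s2 ''ok'' = 1 \<longleftrightarrow> arr s ''alive'' u = 1 \<and> \<not> (\<exists>y\<in>N. arr s ''inL'' y = 1)"
    using 2(3) by (simp add: s1_def)
  have le: "q \<le> reg s ''q''" using X by (simp add: stores_def)
  have "runs (IF Var ''ok'' \<doteq> Lit 1
         THEN (''rout''\<langle>Var ''q''\<rangle> ::= Var ''u'';; Incr ''q'')
         ELSE SKIP) s2 11 (\<lambda>s'.
      stores (arr s' ''rout'') q (reg s' ''q'')
        (if arr s ''alive'' u = 1 \<and> \<not> (\<exists>y\<in>N. arr s ''inL'' y = 1) then insert u X else X) \<and>
      (\<forall>k<q. arr s' ''rout'' k = arr s ''rout'' k))"
    using X stores_append[OF X] same le unfolding ok[symmetric] by (simp add: wp_simps)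
  then obtain t3 s3 where 3: "exec (IF Var ''ok'' \<doteq> Lit 1
         THEN (''rout''\<langle>Var ''q''\<rangle> ::= Var ''u'';; Incr ''q'')
         ELSE SKIP) s2 t3 s3" "t3 \<le> 11"
      "stores (arr s3 ''rout'') q (reg s3 ''q'')
        (if arr s ''alive'' u = 1 \<and> \<not> (\<exists>y\<in>N. arr s ''inL'' y = 1) then insert u X else X) \<and>
      (\<forall>k<q. arr s3 ''rout'' k = arr s ''rout'' k)"
    by (rule runsE)
  show ?thesis
    by (rule runsI[OF exec.Seq[OF exec.Seq[OF 1 2(1)] 3(1)]]) (use 2(2) 3(2) in linarith, fact 3(3))
qed

text \<open>The nested loop runs through the lists of distinct neighbors of \<open>v\<close>, so its
  cost is governed by a sum of degrees, at most twice the number of edges, instead of a product of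
  two degrees. \<open>X\<close> is what has been written before the loop, later \<open>{v}\<close>;
  its disjointness from the neighborhood keeps the listing injective.\<close>

lemma collect_R_runs:
  assumes adj: "adjacency_lists ''coff'' ''cadj'' s V E" and sg: "simple_graph V E"
    and v: "v = reg s ''v''" "v \<in> V"
    and X: "stores (arr s ''rout'') q (reg s ''q'') X" "X \<inter> nbrs E v = {}"
  shows "runs collect_R_prog s (38 * card V + 38 * card E + 10) (\<lambda>s'.
      stores (arr s' ''rout'') q (reg s' ''q'') (X \<union>
        {u \<in> nbrs E v. arr s ''alive'' u = 1 \<and> \<not> (\<exists>y\<in>nbrs E u. arr s ''inL'' y = 1)}) \<and>
      (\<forall>k<q. arr s' ''rout'' k = arr s ''rout'' k))"
proof -
  have lists: "\<And>u. u \<in> V \<Longrightarrow>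
      stores (arr s ''cadj'') (arr s ''coff'' u) (arr s ''coff'' (Suc u)) (nbrs E u)"
    using adj by (auto simp: adjacency_lists_iff)
  let ?p = "arr s ''coff'' v" and ?q = "arr s ''coff'' (Suc v)" and ?g = "arr s ''cadj''"
  have N: "?p \<le> ?q" "nbrs E v = ?g ` {?p..<?q}" "card (nbrs E v) = ?q - ?p" "inj_on ?g {?p..<?q}"
    using lists[OF v(2)] stores_card[OF lists[OF v(2)]] by (auto simp: stores_def)
  have NV: "nbrs E v \<subseteq> V" by (rule nbrs_subset[OF sg])
  have "finite V" using sg by (simp add: simple_graph_def)
  define ok where "ok = (\<lambda>u. arr s ''alive'' u = 1 \<and> \<not> (\<exists>y\<in>nbrs E u. arr s ''inL'' y = 1))"
  let ?d = "\<lambda>u. card (nbrs E u)"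
  define I where "I = (\<lambda>j (s' :: state).
      stores (arr s' ''rout'') q (reg s' ''q'') (X \<union> {u \<in> ?g ` {?p..<j}. ok u}) \<and>
      (\<forall>k<q. arr s' ''rout'' k = arr s ''rout'' k))"
  have "runs collect_R_prog s (38 * card V + 38 * card E + 10) (\<lambda>s'. I ?q s' \<and> reg s' ''j'' = ?q)"
  proof (rule runs_For[where T = "\<lambda>j. 19 * ?d (?g j) + 27"])
    fix j s' assume "aval (''coff''\<langle>Var ''v''\<rangle>) s \<le> j" and j: "j < ?q" "reg s' ''j'' = j"
      and fr: "frame collect_R_prog s s'" and I: "I j s'"
    then have pj: "?p \<le> j" using v by simp
    have same: "arr s' ''cadj'' = ?g" "arr s' ''coff'' = arr s ''coff''" "arr s' ''alive'' = arr s ''alive''"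
        "arr s' ''inL'' = arr s ''inL''"
      using fr by (simp_all add: frame_def)
    have gN: "?g j \<in> nbrs E v" using N(2) pj j by auto
    have new: "?g j \<notin> X \<union> {u \<in> ?g ` {?p..<j}. ok u}"
      using X(2) gN inj_onD[OF N(4), of j] pj j by fastforce
    have upd: "X \<union> {u \<in> ?g ` {?p..<Suc j}. ok u} = (if ok (?g j)
        then insert (?g j) (X \<union> {u \<in> ?g ` {?p..<j}. ok u}) else X \<union> {u \<in> ?g ` {?p..<j}. ok u})"
      using pj by (auto simp: atLeastLessThanSuc)
    have ok_j: "ok (?g j) \<longleftrightarrow> arr s' ''alive'' (?g j) = 1 \<and> \<not> (\<exists>y\<in>nbrs E (?g j). arr s' ''inL'' y = 1)"
      by (simp add: ok_def same)
    have "runs collect_R_step s' (19 * ?d (?g j) + 27) (\<lambda>s''.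
      stores (arr s'' ''rout'') q (reg s'' ''q'')
        (if ok (?g j)
         then insert (?g j) (X \<union> {u \<in> ?g ` {?p..<j}. ok u}) else X \<union> {u \<in> ?g ` {?p..<j}. ok u}) \<and>
      (\<forall>k<q. arr s'' ''rout'' k = arr s' ''rout'' k))"
      unfolding ok_j by (rule collect_R_step_runs)
        (use same j lists[of "?g j"] gN NV new I in \<open>auto simp: I_def\<close>)
    then show "runs collect_R_step s' (19 * ?d (?g j) + 27)
        (\<lambda>s''. I (Suc j) (s''\<lparr>reg := (reg s'')(''j'' := Suc j)\<rparr>))"
      by (rule wp_mono) (use I in \<open>simp add: I_def upd\<close>)
  next
    have "(\<Sum>j = ?p..<?q. ?d (?g j)) = (\<Sum>u\<in>nbrs E v. ?d u)"
      unfolding N(2) using sum.reindex[OF N(4), of ?d] by simp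
    also have "\<dots> \<le> (\<Sum>u\<in>V. ?d u)" using NV \<open>finite V\<close> by (intro sum_mono2) auto
    also have "\<dots> \<le> 2 * card E" by (rule sum_degrees_le[OF sg])
    finally have sum: "(\<Sum>j = ?p..<?q. ?d (?g j)) \<le> 2 * card E" .
    have "card (nbrs E v) \<le> card V" by (rule card_mono[OF \<open>finite V\<close> NV])
    then show "(\<Sum>j = aval (''coff''\<langle>Var ''v''\<rangle>) s..<?q. 19 * ?d (?g j) + 27 + (acost (''coff''\<langle>Var ''v'' \<oplus> Lit 1\<rangle>) + 7)) +
      acost (''coff''\<langle>Var ''v''\<rangle>) + acost (''coff''\<langle>Var ''v'' \<oplus> Lit 1\<rangle>) + 4 \<le> 38 * card V + 38 * card E + 10"
      using sum N(3) v(1) by (simp add: sum.distrib sum_distrib_left[symmetric])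
  qed (use N v X in \<open>simp_all add: frame_def I_def\<close>)
  then show ?thesis
    by (rule wp_mono) (simp add: I_def N(2) ok_def)
qed

abbreviation remove_R_prog :: com where
  "remove_R_prog \<equiv>
      FOR ''i'' FROM ''roff''\<langle>Var ''m''\<rangle> TO Var ''q'' DO (
        ''alive''\<langle>''rout''\<langle>Var ''i''\<rangle>\<rangle> ::= Lit 0;;
        ''size'' ::= Var ''size'' \<ominus> Lit 1)"

lemma remove_R_runs:
  assumes R: "stores (arr s ''rout'') (arr s ''roff'' (reg s ''m'')) (reg s ''q'') R"
  shows "runs remove_R_prog s (16 * card R + 7) (\<lambda>s'.
      (\<forall>u. arr s' ''alive'' u = (if u \<in> R then 0 else arr s ''alive'' u)) \<and>
      reg s' ''size'' = reg s ''size'' - card R)"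
proof -
  let ?p = "arr s ''roff'' (reg s ''m'')" and ?q = "reg s ''q''" and ?g = "arr s ''rout''"
  have N: "?p \<le> ?q" "R = ?g ` {?p..<?q}" "card R = ?q - ?p"
    using R stores_card by (auto simp: stores_def)
  define I where "I = (\<lambda>j (s' :: state).
      (\<forall>u. arr s' ''alive'' u = (if u \<in> ?g ` {?p..<j} then 0 else arr s ''alive'' u)) \<and>
      reg s' ''size'' = reg s ''size'' - (j - ?p))"
  have "runs remove_R_prog s (16 * card R + 7) (\<lambda>s'. I ?q s' \<and> reg s' ''i'' = ?q)"
  proof (rule runs_For[where T = "\<lambda>_. 8"])
    fix j s' assume j: "aval (''roff''\<langle>Var ''m''\<rangle>) s \<le> j" "reg s' ''i'' = j"
      and fr: "frame remove_R_prog s s'" and I: "I j s'"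
    have "arr s' ''rout'' = ?g" using fr by (simp add: frame_def)
    moreover have "{?p..<Suc j} = insert j {?p..<j}" "Suc j - ?p = Suc (j - ?p)" using j(1) by auto
    ultimately show "runs (''alive''\<langle>''rout''\<langle>Var ''i''\<rangle>\<rangle> ::= Lit 0;;
        ''size'' ::= Var ''size'' \<ominus> Lit 1) s' 8
      (\<lambda>s''. I (Suc j) (s''\<lparr>reg := (reg s'')(''i'' := Suc j)\<rparr>))"
      using I j by (simp add: wp_simps I_def)
  qed (use N in \<open>simp_all add: frame_def I_def\<close>)
  then show ?thesis by (rule wp_mono) (simp add: I_def N(2)[symmetric] N(3))
qed

section \<open>Recorded bicliques and the loop invariant\<close>

definition biclique_at :: "state \<Rightarrow> nat \<Rightarrow> nat set set" where
  "biclique_at s k = {arr s ''lout'' ` {arr s ''loff'' k..<arr s ''loff'' (Suc k)},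
      arr s ''rout'' ` {arr s ''roff'' k..<arr s ''roff'' (Suc k)}}"

lemma stored_bicliques_eq: "stored_bicliques s = biclique_at s ` {..<reg s ''m''}"
  unfolding stored_bicliques_def biclique_at_def by auto

lemma biclique_at_cong:
  assumes "arr s' ''loff'' k = arr s ''loff'' k" "arr s' ''loff'' (Suc k) = arr s ''loff'' (Suc k)"
    "arr s' ''roff'' k = arr s ''roff'' k" "arr s' ''roff'' (Suc k) = arr s ''roff'' (Suc k)"
    "\<And>j. j < arr s ''loff'' (Suc k) \<Longrightarrow> arr s' ''lout'' j = arr s ''lout'' j"
    "\<And>j. j < arr s ''roff'' (Suc k) \<Longrightarrow> arr s' ''rout'' j = arr s ''rout'' j"
  shows "biclique_at s' k = biclique_at s k"
proof -
  have "arr s' ''lout'' ` {arr s ''loff'' k..<arr s ''loff'' (Suc k)} =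
      arr s ''lout'' ` {arr s ''loff'' k..<arr s ''loff'' (Suc k)}"
    "arr s' ''rout'' ` {arr s ''roff'' k..<arr s ''roff'' (Suc k)} =
      arr s ''rout'' ` {arr s ''roff'' k..<arr s ''roff'' (Suc k)}"
    by (rule image_cong; use assms(5,6) in simp)+
  then show ?thesis using assms(1-4) by (simp add: biclique_at_def)
qed

abbreviation alive_set :: "state \<Rightarrow> nat set" where
  "alive_set s \<equiv> {u. u < reg s ''n'' \<and> arr s ''alive'' u = 1}"

text \<open>The abstract loop is a big-step relation without intermediate states, so progress is
  recorded backwards: whatever it may return from the present graph, list and collection, it may
  also return from the initial ones. The clause on offsets keeps the cells of recorded bicliques
  below the next write positions.\<close>

definition loop_inv :: "nat set \<Rightarrow> nat set set \<Rightarrow> nat list \<Rightarrow> state \<Rightarrow> bool" where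
  "loop_inv V E \<sigma> s \<longleftrightarrow>
     adjacency_lists ''coff'' ''cadj'' s V E \<and> stored_ordering s = \<sigma> \<and>
     (\<forall>u\<in>V. arr s ''alive'' u \<le> 1) \<and> reg s ''size'' = card (alive_set s) \<and>
     (\<forall>y<reg s ''h''. arr s ''alive'' (arr s ''sigma'' y) = 0) \<and>
     (\<forall>k<reg s ''m''. arr s ''loff'' (Suc k) \<le> arr s ''loff'' (reg s ''m'') \<and>
        arr s ''roff'' (Suc k) \<le> arr s ''roff'' (reg s ''m'')) \<and>
     (\<forall>bp. algB_loop {e \<in> E. e \<subseteq> alive_set s} (filter (\<lambda>u. u \<in> alive_set s) \<sigma>) (stored_bicliques s) bp \<longrightarrow>
        algB_loop E \<sigma> {} bp)"

abbreviation record_prog :: com where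
  "record_prog \<equiv>
      (IF ''loff''\<langle>Var ''m''\<rangle> \<prec> Var ''p''
       THEN (
         Incr ''m'';;
         ''loff''\<langle>Var ''m''\<rangle> ::= Var ''p'';;
         ''roff''\<langle>Var ''m''\<rangle> ::= Var ''q'')
       ELSE SKIP)"

text \<open>If \<open>L\<close> is empty, neither \<open>m\<close> nor the offsets move, so the
  cells just written do not belong to any recorded biclique and are free for the next round.\<close>

lemma record_runs:
  assumes L: "stores (arr s ''lout'') (arr s ''loff'' (reg s ''m'')) (reg s ''p'') L"
    and R: "stores (arr s ''rout'') (arr s ''roff'' (reg s ''m'')) (reg s ''q'') R"
    and mono: "\<forall>k<reg s ''m''. arr s ''loff'' (Suc k) \<le> arr s ''loff'' (reg s ''m'') \<and>
        arr s ''roff'' (Suc k) \<le> arr s ''roff'' (reg s ''m'')"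
  shows "runs record_prog s 15 (\<lambda>s'.
      (\<forall>k<reg s' ''m''. arr s' ''loff'' (Suc k) \<le> arr s' ''loff'' (reg s' ''m'') \<and>
        arr s' ''roff'' (Suc k) \<le> arr s' ''roff'' (reg s' ''m'')) \<and>
      stored_bicliques s' = (if L \<noteq> {} then insert {L, R} (stored_bicliques s) else stored_bicliques s))"
proof (cases "L = {}")
  case True
  then have "\<not> arr s ''loff'' (reg s ''m'') < reg s ''p''" using L by (simp add: stores_def)
  then show ?thesis using True mono by (simp add: wp_simps)
next
  case False
  let ?m = "reg s ''m''"
  have lt: "arr s ''loff'' ?m < reg s ''p''" using L False by (auto simp: stores_def)
  define s' where "s' = s\<lparr>reg := (reg s)(''m'' := Suc ?m), arr := (arr s)(
      ''loff'' := (arr s ''loff'')(Suc ?m := reg s ''p''), ''roff'' := (arr s ''roff'')(Suc ?m := reg s ''q''))\<rparr>"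
  have e: "exec record_prog s 15 s'"
    by (rule exec_of_wp) (use lt in \<open>simp add: wp_simps s'_def\<close>)
  have "biclique_at s' k = biclique_at s k" if "k < ?m" for k
    by (rule biclique_at_cong) (use that in \<open>simp_all add: s'_def\<close>)
  moreover have "biclique_at s' ?m = {L, R}"
    using L R by (simp add: biclique_at_def s'_def stores_def)
  moreover have "reg s' ''m'' = Suc ?m" by (simp add: s'_def)
  ultimately have stored: "stored_bicliques s' = insert {L, R} (stored_bicliques s)"
    unfolding stored_bicliques_eq by (simp add: lessThan_Suc)
  have "arr s ''roff'' ?m \<le> reg s ''q''" using R by (simp add: stores_def)
  then have "\<forall>k<reg s' ''m''. arr s' ''loff'' (Suc k) \<le> arr s' ''loff'' (reg s' ''m'') \<and>
        arr s' ''roff'' (Suc k) \<le> arr s' ''roff'' (reg s' ''m'')"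
    using mono lt by (auto simp: s'_def less_Suc_eq dest: le_trans)
  then show ?thesis using stored False by (intro runsI[OF e]) auto
qed

section \<open>A whole round and the whole loop\<close>

abbreviation loop_body :: com where
  "loop_body \<equiv>
      find_alive_prog;;
      ''v'' ::= ''sigma''\<langle>Var ''h''\<rangle>;;
      clear_mark_prog;;
      ''mark''\<langle>Var ''v''\<rangle> ::= Lit 1;;
      mark_list_prog ''coff'' ''cadj'';;
      ''p'' ::= ''loff''\<langle>Var ''m''\<rangle>;;
      collect_L_prog;;
      ''q'' ::= ''roff''\<langle>Var ''m''\<rangle>;;
      ''rout''\<langle>Var ''q''\<rangle> ::= Var ''v'';;
      Incr ''q'';;
      collect_R_prog;;
      remove_R_prog;;
      record_prog"

lemma loop_body_runs:
  assumes inv: "loop_inv V E \<sigma> s" and sg: "simple_graph V E" and \<sigma>: "set \<sigma> = V"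
    and size: "0 < reg s ''size''"
  shows "runs loop_body s (114 * card V + 38 * card E + 79)
    (\<lambda>s'. loop_inv V E \<sigma> s' \<and> reg s' ''size'' < reg s ''size'')"
proof -
  let ?n = "reg s ''n''" and ?m = "reg s ''m''" and ?g = "arr s ''sigma''"
  let ?p0 = "arr s ''loff'' ?m" and ?q0 = "arr s ''roff'' ?m"
  define A where "A = alive_set s"
  have adj: "adjacency_lists ''coff'' ''cadj'' s V E" and ord: "\<sigma> = map ?g [0..<?n]"
    and alive: "\<And>u. u \<in> V \<Longrightarrow> arr s ''alive'' u \<le> 1" and card_A: "reg s ''size'' = card A"
    and dead: "\<And>y. y < reg s ''h'' \<Longrightarrow> arr s ''alive'' (?g y) = 0"
    and mono: "\<forall>k<?m. arr s ''loff'' (Suc k) \<le> ?p0 \<and> arr s ''roff'' (Suc k) \<le> ?q0"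
    and run: "\<And>bp. algB_loop {e \<in> E. e \<subseteq> A} (filter (\<lambda>u. u \<in> A) \<sigma>) (stored_bicliques s) bp \<Longrightarrow>
        algB_loop E \<sigma> {} bp"
    using inv unfolding loop_inv_def A_def stored_ordering_def by blast+
  have V: "V = {..<?n}" and lists: "\<And>u. u \<in> V \<Longrightarrow>
      stores (arr s ''cadj'') (arr s ''coff'' u) (arr s ''coff'' (Suc u)) (nbrs E u)"
    using adj by (auto simp: adjacency_lists_iff)
  have cV: "card V = ?n" and finV: "finite V" using V by auto
  have AV: "A \<subseteq> V" "finite A" unfolding A_def V by auto
  have A_iff: "u \<in> A \<longleftrightarrow> arr s ''alive'' u \<noteq> 0" if "u \<in> V" for u
    using alive[OF that] that unfolding A_def V by auto
  \<comment> \<open>The search for the least index ranges over all naturals, but \<open>size\<close>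
    is positive, so some member of \<open>A\<close> occurs among the first \<open>n\<close> entries.
    Hence \<open>x < n\<close>, whatever the arrays contain beyond.\<close>
  define x where "x = (LEAST x. arr s ''alive'' (?g x) \<noteq> 0)"
  obtain u0 where "u0 \<in> A" using size card_A by (metis card_gt_0_iff ex_in_conv)
  then obtain x' where x': "x' < ?n" "arr s ''alive'' (?g x') \<noteq> 0"
    using AV \<sigma> A_iff unfolding ord by force
  have x: "arr s ''alive'' (?g x) \<noteq> 0" "\<And>y. y < x \<Longrightarrow> arr s ''alive'' (?g y) = 0"
    unfolding x_def using LeastI[of "\<lambda>x. arr s ''alive'' (?g x) \<noteq> 0", OF x'(2)] not_less_Least by blast+
  have xn: "x < ?n" unfolding x_def using Least_le[of "\<lambda>x. arr s ''alive'' (?g x) \<noteq> 0", OF x'(2)] x'(1) by simp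
  have hx: "reg s ''h'' \<le> x" using dead[of x] x(1) by (metis not_le)
  define v where "v = ?g x"
  have gV: "?g y \<in> V" if "y < ?n" for y using \<sigma> that unfolding ord by auto
  have vV: "v \<in> V" and vA: "v \<in> A" using gV[OF xn] A_iff x(1) unfolding v_def by auto
  let ?N = "nbrs E v"
  have NV: "nbrs E u \<subseteq> V" for u by (rule nbrs_subset[OF sg])
  have vN: "v \<notin> ?N" using simple_graph_no_loop[OF sg] by (simp add: nbrs_def)
  have cN: "card ?N \<le> ?n" using card_mono[OF finV NV] cV by simp
  define L where "L = {u \<in> A. u \<noteq> v \<and> u \<notin> ?N}"
  define R where "R = insert v {u \<in> ?N. u \<in> A \<and> nbrs E u \<inter> L = {}}"
  have RA: "R \<subseteq> A" "v \<in> R" unfolding R_def using vA by auto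
  have cR: "card R \<le> ?n" using card_mono[OF finV, of R] RA AV cV by auto

  obtain t1 s1 where 1: "exec find_alive_prog s t1 s1" "t1 \<le> 10 * x + 6" "reg s1 ''h'' = x"
      "frame find_alive_prog s s1"
    by (rule runsE[OF find_alive_runs[OF x hx]])
  have arr1: "arr s1 = arr s" using 1(4) by (auto simp: frame_def)
  define s2 where "s2 = s1\<lparr>reg := (reg s1)(''v'' := v)\<rparr>"
  have 2: "exec (''v'' ::= ''sigma''\<langle>Var ''h''\<rangle>) s1 3 s2"
    by (rule exec_of_wp) (simp add: wp_simps s2_def arr1 1(3) v_def)
  have f2: "arr s2 = arr s" "reg s2 ''h'' = x" "reg s2 ''v'' = v" "reg s2 ''n'' = ?n" "reg s2 ''m'' = ?m"
      "reg s2 ''size'' = reg s ''size''"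
    using arr1 1(3,4) by (simp_all add: s2_def frame_def)
  obtain t3 s3 where 3: "exec clear_mark_prog s2 t3 s3" "t3 \<le> 11 * ?n + 6"
      "\<forall>k<?n. arr s3 ''mark'' k = 0" "frame clear_mark_prog s2 s3"
    by (rule runsE[OF clear_mark_runs[of s2, unfolded f2]])
  define s4 where "s4 = s3\<lparr>arr := (arr s3)(''mark'' := (arr s3 ''mark'')(v := 1))\<rparr>"
  have 4: "exec (''mark''\<langle>Var ''v''\<rangle> ::= Lit 1) s3 3 s4"
    by (rule exec_of_wp) (use 3(4) f2 in \<open>simp add: wp_simps s4_def frame_def\<close>)
  have f4: "\<And>a. a \<noteq> ''mark'' \<Longrightarrow> arr s4 a = arr s a" "\<And>y. y \<noteq> ''i'' \<Longrightarrow> reg s4 y = reg s2 y"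
    using 3(4) f2 by (simp_all add: s4_def frame_def)
  have "stores (arr s4 ''cadj'') (arr s4 ''coff'' (reg s4 ''v'')) (arr s4 ''coff'' (Suc (reg s4 ''v''))) ?N"
    using lists[OF vV] f4 f2 by simp
  then obtain t5 s5 where 5: "exec (mark_list_prog ''coff'' ''cadj'') s4 t5 s5" "t5 \<le> 15 * card ?N + 10"
      "\<forall>k. arr s5 ''mark'' k = (if k \<in> ?N then 1 else arr s4 ''mark'' k)"
      "frame (mark_list_prog ''coff'' ''cadj'') s4 s5"
    by (rule runsE[OF mark_list_runs]) auto
  define s6 where "s6 = s5\<lparr>reg := (reg s5)(''p'' := ?p0)\<rparr>"
  have f5: "\<And>a. a \<noteq> ''mark'' \<Longrightarrow> arr s5 a = arr s a"
      "\<And>y. y \<noteq> ''i'' \<Longrightarrow> y \<noteq> ''j'' \<Longrightarrow> reg s5 y = reg s2 y"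
    using 5(4) f4 by (simp_all add: frame_def)
  have 6: "exec (''p'' ::= ''loff''\<langle>Var ''m''\<rangle>) s5 3 s6"
    by (rule exec_of_wp) (simp add: wp_simps s6_def f5 f2)
  have f6: "\<And>a. a \<noteq> ''mark'' \<Longrightarrow> arr s6 a = arr s a" "reg s6 ''p'' = ?p0"
      "\<And>y. y \<noteq> ''i'' \<Longrightarrow> y \<noteq> ''j'' \<Longrightarrow> y \<noteq> ''p'' \<Longrightarrow> reg s6 y = reg s2 y"
    using f5 by (simp_all add: s6_def)
  have mark6: "arr s6 ''mark'' k = (if k = v \<or> k \<in> ?N then 1 else 0)" if "k < ?n" for k
    using 5(3) 3(3) that by (simp add: s6_def s4_def)
  have L6: "L = {u. u < reg s6 ''n'' \<and> arr s6 ''mark'' u < arr s6 ''alive'' u}"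
  proof -
    \<comment> \<open>Both arrays take only the values 0 and 1 on \<open>V\<close>.\<close>
    have "arr s6 ''mark'' u < arr s6 ''alive'' u \<longleftrightarrow> u \<in> A \<and> u \<noteq> v \<and> u \<notin> ?N" if "u \<in> V" for u
    proof -
      have "u < ?n" "arr s6 ''alive'' u = arr s ''alive'' u" using that V f6(1) by auto
      then show ?thesis using A_iff[OF that] alive[OF that] mark6[of u] by auto
    qed
    moreover have "{u. u < reg s6 ''n'' \<and> P u} = {u \<in> V. P u}" for P using f6(3) f2(4) V by simp
    ultimately show ?thesis using AV(1) unfolding L_def by blast
  qed
  obtain t7 s7 where 7: "exec collect_L_prog s6 t7 s7" "t7 \<le> 24 * ?n + 6"
      "stores (arr s7 ''lout'') ?p0 (reg s7 ''p'') L" "\<forall>k<?p0. arr s7 ''lout'' k = arr s6 ''lout'' k"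
      "\<forall>u<?n. arr s7 ''inL'' u = of_bool (u \<in> L)" "frame collect_L_prog s6 s7"
    by (rule runsE[OF collect_L_runs[OF refl refl L6]]) (use f6 f2 in simp)
  have f7: "\<And>a. a \<notin> {''mark'', ''lout'', ''inL''} \<Longrightarrow> arr s7 a = arr s a"
      "\<And>y. y \<notin> {''i'', ''j'', ''p''} \<Longrightarrow> reg s7 y = reg s2 y"
    using 7(6) f6 by (simp_all add: frame_def)
  define s8 where "s8 = s7\<lparr>reg := (reg s7)(''q'' := ?q0)\<rparr>"
  have 8: "exec (''q'' ::= ''roff''\<langle>Var ''m''\<rangle>) s7 3 s8"
    by (rule exec_of_wp) (simp add: wp_simps s8_def f7 f2)
  define s9 where "s9 = s8\<lparr>arr := (arr s8)(''rout'' := (arr s ''rout'')(?q0 := v))\<rparr>"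
  have 9: "exec (''rout''\<langle>Var ''q''\<rangle> ::= Var ''v'') s8 3 s9"
    by (rule exec_of_wp) (simp add: wp_simps s9_def s8_def f7 f2)
  define s10 where "s10 = s9\<lparr>reg := (reg s9)(''q'' := Suc ?q0)\<rparr>"
  have 10: "exec (Incr ''q'') s9 4 s10"
    by (rule exec_of_wp) (simp add: wp_simps s10_def s9_def s8_def)
  have f10: "\<And>a. a \<notin> {''mark'', ''lout'', ''inL'', ''rout''} \<Longrightarrow> arr s10 a = arr s a"
      "\<And>y. y \<notin> {''i'', ''j'', ''p'', ''q''} \<Longrightarrow> reg s10 y = reg s2 y"
      "reg s10 ''p'' = reg s7 ''p''" "arr s10 ''lout'' = arr s7 ''lout''" "arr s10 ''inL'' = arr s7 ''inL''"
      "reg s10 ''q'' = Suc ?q0" "arr s10 ''rout'' = (arr s ''rout'')(?q0 := v)"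
    using f7 by (simp_all add: s10_def s9_def s8_def)
  have adj10: "adjacency_lists ''coff'' ''cadj'' s10 V E"
    using adj f10 f2 by (simp add: adjacency_lists_iff)
  have st10: "stores (arr s10 ''rout'') ?q0 (reg s10 ''q'') {v}"
    using stores_append[OF stores_empty, of v "arr s ''rout''" ?q0] f10 by simp
  have R': "{v} \<union> {u \<in> ?N. arr s10 ''alive'' u = 1 \<and> \<not> (\<exists>y\<in>nbrs E u. arr s10 ''inL'' y = 1)} = R"
  proof -
    \<comment> \<open>\<open>inL\<close> is known only below \<open>n\<close>; neighbors lie there
      because the graph is simple on \<open>V\<close>.\<close>
    have "arr s10 ''inL'' y = 1 \<longleftrightarrow> y \<in> L" if "y \<in> nbrs E u" for y u
    proof -
      have "y < ?n" using NV that V by blast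
      then show ?thesis using 7(5) f10(5) by simp
    qed
    then have "(\<exists>y\<in>nbrs E u. arr s10 ''inL'' y = 1) \<longleftrightarrow> nbrs E u \<inter> L \<noteq> {}" for u by blast
    moreover have "arr s10 ''alive'' u = 1 \<longleftrightarrow> u \<in> A" if "u \<in> ?N" for u
      using that NV[of v] V f10 unfolding A_def by auto
    ultimately show ?thesis unfolding R_def by auto
  qed
  have v10: "v = reg s10 ''v''" using f10 f2 by simp
  obtain t11 s11 where 11: "exec collect_R_prog s10 t11 s11" "t11 \<le> 38 * card V + 38 * card E + 10"
      "stores (arr s11 ''rout'') ?q0 (reg s11 ''q'') R"
      "\<forall>k<?q0. arr s11 ''rout'' k = arr s10 ''rout'' k" "frame collect_R_prog s10 s11"
    by (rule runsE[OF collect_R_runs[OF adj10 sg v10 vV st10, unfolded R']]) (use vN in auto)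
  have f11: "\<And>a. a \<notin> {''mark'', ''lout'', ''inL'', ''rout''} \<Longrightarrow> arr s11 a = arr s a"
      "\<And>y. y \<notin> {''i'', ''j'', ''p'', ''q'', ''u'', ''ok'', ''l''} \<Longrightarrow> reg s11 y = reg s2 y"
      "reg s11 ''p'' = reg s7 ''p''" "arr s11 ''lout'' = arr s7 ''lout''"
    using 11(5) f10 by (simp_all add: frame_def)
  have "stores (arr s11 ''rout'') (arr s11 ''roff'' (reg s11 ''m'')) (reg s11 ''q'') R"
    using 11(3) f11 f2 by simp
  then obtain t12 s12 where 12: "exec remove_R_prog s11 t12 s12" "t12 \<le> 16 * card R + 7"
      "\<forall>u. arr s12 ''alive'' u = (if u \<in> R then 0 else arr s11 ''alive'' u)"
      "reg s12 ''size'' = reg s11 ''size'' - card R" "frame remove_R_prog s11 s12"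
    by (rule runsE[OF remove_R_runs]) auto
  have f12: "\<And>a. a \<notin> {''mark'', ''lout'', ''inL'', ''rout'', ''alive''} \<Longrightarrow> arr s12 a = arr s a"
      "\<And>y. y \<notin> {''i'', ''j'', ''p'', ''q'', ''u'', ''ok'', ''l'', ''size''} \<Longrightarrow> reg s12 y = reg s2 y"
      "reg s12 ''p'' = reg s7 ''p''" "arr s12 ''lout'' = arr s7 ''lout''" "reg s12 ''q'' = reg s11 ''q''"
      "arr s12 ''rout'' = arr s11 ''rout''"
      "\<And>u. arr s12 ''alive'' u = (if u \<in> R then 0 else arr s ''alive'' u)"
      "reg s12 ''size'' = card A - card R"
    using 12(3,4,5) f11 f2 card_A by (simp_all add: frame_def)
  have stored12: "stored_bicliques s12 = stored_bicliques s"
  proof -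
    \<comment> \<open>The round wrote to \<open>lout\<close> and \<open>rout\<close> only from the
      current offsets on, and earlier bicliques end at or below them.\<close>
    have "biclique_at s12 k = biclique_at s k" if "k < ?m" for k
    proof (rule biclique_at_cong)
      fix j assume "j < arr s ''loff'' (Suc k)"
      then have "j < ?p0" using mono that by (meson less_le_trans)
      then show "arr s12 ''lout'' j = arr s ''lout'' j" using 7(4) f12(4) f6 by simp
    next
      fix j assume "j < arr s ''roff'' (Suc k)"
      then have "j < ?q0" using mono that by (meson less_le_trans)
      then show "arr s12 ''rout'' j = arr s ''rout'' j" using 11(4) f12(6) f10(7) by simp
    qed (use f12(1) in simp_all)
    moreover have "reg s12 ''m'' = ?m" using f12(2) f2 by simp
    ultimately show ?thesis unfolding stored_bicliques_eq by simp
  qed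
  have m12: "reg s12 ''m'' = ?m" "arr s12 ''loff'' = arr s ''loff''" "arr s12 ''roff'' = arr s ''roff''"
    using f12(1,2) f2 by simp_all
  have "runs record_prog s12 15 (\<lambda>s'.
      (\<forall>k<reg s' ''m''. arr s' ''loff'' (Suc k) \<le> arr s' ''loff'' (reg s' ''m'') \<and>
        arr s' ''roff'' (Suc k) \<le> arr s' ''roff'' (reg s' ''m'')) \<and>
      stored_bicliques s' = (if L \<noteq> {} then insert {L, R} (stored_bicliques s12) else stored_bicliques s12))"
    by (rule record_runs) (use 7(3) 11(3) mono m12 f12(3-6) in simp_all)
  then obtain t13 s13 where 13: "exec record_prog s12 t13 s13" "t13 \<le> 15"
      "\<forall>k<reg s13 ''m''. arr s13 ''loff'' (Suc k) \<le> arr s13 ''loff'' (reg s13 ''m'') \<and>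
        arr s13 ''roff'' (Suc k) \<le> arr s13 ''roff'' (reg s13 ''m'')"
      "stored_bicliques s13 = (if L \<noteq> {} then insert {L, R} (stored_bicliques s) else stored_bicliques s)"
      "frame record_prog s12 s13"
    unfolding stored12 by (auto elim!: runsE)
  have f13: "arr s13 ''coff'' = arr s ''coff''" "arr s13 ''cadj'' = arr s ''cadj''"
      "arr s13 ''sigma'' = ?g" "reg s13 ''n'' = ?n" "reg s13 ''h'' = x"
      "\<And>u. arr s13 ''alive'' u = (if u \<in> R then 0 else arr s ''alive'' u)"
      "reg s13 ''size'' = card A - card R"
    using 13(5) f12(1,2,7,8) f2 by (simp_all add: frame_def)
  have A13: "alive_set s13 = A - R" using f13(4,6) by (auto simp: A_def)
  have cAR: "card (A - R) = card A - card R"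
    using RA AV by (intro card_Diff_subset) (auto intro: finite_subset)
  \<comment> \<open>Since \<open>v\<close> belongs to \<open>R\<close>, each round makes progress;
    \<open>size\<close> is the variant that bounds the number of rounds.\<close>
  have "0 < card R" using RA AV by (auto simp: card_gt_0_iff intro: finite_subset)
  then have smaller: "reg s13 ''size'' < reg s ''size''" using f13(7) size card_A by simp
  have filt: "filter (\<lambda>u. u \<in> A) \<sigma> \<noteq> []" "hd (filter (\<lambda>u. u \<in> A) \<sigma>) = v"
  proof -
    have "?g y \<notin> A" if "y < x" for y using x(2)[OF that] by (simp add: A_def)
    then show "filter (\<lambda>u. u \<in> A) \<sigma> \<noteq> []" "hd (filter (\<lambda>u. u \<in> A) \<sigma>) = v"
      using hd_filter_map_upt[of x ?n "\<lambda>u. u \<in> A" ?g] xn vA unfolding ord v_def by blast+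
  qed
  have "loop_inv V E \<sigma> s13"
    unfolding loop_inv_def A13
  proof (intro conjI allI impI)
    show "adjacency_lists ''coff'' ''cadj'' s13 V E" using adj f13 by (simp add: adjacency_lists_iff)
    show "stored_ordering s13 = \<sigma>" using f13 ord by (simp add: stored_ordering_def)
    show "\<forall>u\<in>V. arr s13 ''alive'' u \<le> 1" using alive f13(6) by simp
    show "reg s13 ''size'' = card (A - R)" using f13(7) cAR by simp
    show "arr s13 ''alive'' (arr s13 ''sigma'' y) = 0" if "y < reg s13 ''h''" for y
      using that x(2) f13 by simp
    fix bp
    assume "algB_loop {e \<in> E. e \<subseteq> A - R} (filter (\<lambda>u. u \<in> A - R) \<sigma>) (stored_bicliques s13) bp"
    then show "algB_loop E \<sigma> {} bp"
      using algB_loop_step[OF \<sigma> AV(1) vA filt L_def R_def] run unfolding 13(4) by blast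
  qed (use 13(3) in blast)+
  \<comment> \<open>The coefficient of the number of vertices is
    \<open>10 + 11 + 15 + 24 + 38 + 16 = 114\<close>, from search, clearing, marking,
    \<open>L\<close>, \<open>R\<close> and removal, using \<open>x < n\<close> and the bounds of
    \<open>card ?N\<close> and \<open>card R\<close> by \<open>n\<close>.\<close>
  moreover have "t1 + 3 + t3 + 3 + t5 + 3 + t7 + 3 + 3 + 4 + t11 + t12 + t13
      \<le> 114 * card V + 38 * card E + 79"
    using 1(2) 3(2) 5(2) 7(2) 11(2) 12(2) 13(2) xn cN cR cV by linarith
  moreover note smaller
  ultimately show ?thesis
    by (intro runsI[OF exec.Seq[OF exec.Seq[OF exec.Seq[OF exec.Seq[OF exec.Seq[OF exec.Seq[OF exec.Seq[OF
          exec.Seq[OF exec.Seq[OF exec.Seq[OF exec.Seq[OF exec.Seq[OF 1(1) 2] 3(1)] 4] 5(1)] 6] 7(1)]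
          8] 9] 10] 11(1)] 12(1)] 13(1)]] conjI)
qed

text \<open>At most \<open>card V\<close> rounds, each of \<open>79\<close> plus 4 for the outer
  test besides the terms in vertices and edges; the initialization of \<open>alive\<close>
  contributes 11 per vertex, which makes 94.\<close>

lemma loop_prog_runs:
  assumes adj: "adjacency_lists ''coff'' ''cadj'' s V E" and sg: "simple_graph V E"
    and ord: "stored_ordering s = \<sigma>" "set \<sigma> = V"
  shows "runs loop_prog s (card V * (114 * card V + 38 * card E + 94) + 22)
    (\<lambda>s'. algB_loop E \<sigma> {} (stored_bicliques s'))"
proof -
  let ?n = "reg s ''n''"
  have V: "V = {..<?n}" using adj by (simp add: adjacency_lists_iff)
  let ?F = "FOR ''i'' FROM Lit 0 TO Var ''n'' DO ''alive''\<langle>Var ''i''\<rangle> ::= Lit 1"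
  let ?I = "?F;; ''size'' ::= Var ''n'';; ''h'' ::= Lit 0;; ''m'' ::= Lit 0;;
    ''loff''\<langle>Lit 0\<rangle> ::= Lit 0;; ''roff''\<langle>Lit 0\<rangle> ::= Lit 0"
  have "runs ?F s (11 * ?n + 6) (\<lambda>s'. \<forall>u<?n. arr s' ''alive'' u = 1)"
    by (rule wp_mono[OF runs_For[where I = "\<lambda>i s'. \<forall>u<i. arr s' ''alive'' u = 1"
          and T = "\<lambda>_. 3" and b = ?n]])
      (auto simp: wp_simps frame_def less_Suc_eq)
  then obtain t0 s0 where 0: "exec ?F s t0 s0" "t0 \<le> 11 * ?n + 6" "\<forall>u<?n. arr s0 ''alive'' u = 1"
      "frame ?F s s0"
    by (rule runsE)
  have f0: "reg s0 ''n'' = ?n" "arr s0 ''coff'' = arr s ''coff''" "arr s0 ''cadj'' = arr s ''cadj''"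
      "arr s0 ''sigma'' = arr s ''sigma''"
    using 0(4) by (simp_all add: frame_def)
  define s1 where "s1 = s0\<lparr>reg := (reg s0)(''size'' := ?n, ''h'' := 0, ''m'' := 0),
    arr := (arr s0)(''loff'' := (arr s0 ''loff'')(0 := 0), ''roff'' := (arr s0 ''roff'')(0 := 0))\<rparr>"
  have "runs ?I s (11 * ?n + 18) (\<lambda>s'. s' = s1)"
    by (rule runsI[OF exec.Seq[OF exec.Seq[OF exec.Seq[OF exec.Seq[OF exec.Seq[OF
            0(1) exec.Assign] exec.Assign] exec.Assign] exec.Put] exec.Put]])
      (use 0(2) f0 in \<open>simp_all add: s1_def\<close>)
  then obtain t1 where 1: "exec ?I s t1 s1" "t1 \<le> 11 * ?n + 18" by (auto elim: runsE)
  have alive1: "alive_set s1 = V" using 0(3) f0 by (auto simp: s1_def V)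
  have "loop_inv V E \<sigma> s1"
    unfolding loop_inv_def alive1
  proof (intro conjI allI impI)
    show "adjacency_lists ''coff'' ''cadj'' s1 V E"
      using adj f0 by (simp add: adjacency_lists_iff s1_def)
    show "stored_ordering s1 = \<sigma>" using ord(1) f0 by (simp add: stored_ordering_def s1_def)
    show "\<forall>u\<in>V. arr s1 ''alive'' u \<le> 1" using 0(3) by (simp add: s1_def V)
    show "reg s1 ''size'' = card V" by (simp add: s1_def V)
    fix bp
    have "{e \<in> E. e \<subseteq> V} = E" using sg by (auto simp: simple_graph_def)
    moreover have "filter (\<lambda>u. u \<in> V) \<sigma> = \<sigma>" using ord(2) by (simp add: filter_id_conv)
    moreover have "stored_bicliques s1 = {}" by (simp add: stored_bicliques_eq s1_def)
    moreover assume "algB_loop {e \<in> E. e \<subseteq> V} (filter (\<lambda>u. u \<in> V) \<sigma>) (stored_bicliques s1) bp"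
    ultimately show "algB_loop E \<sigma> {} bp" by simp
  qed (simp_all add: s1_def)
  then have "runs (WHILE Lit 0 \<prec> Var ''size'' DO loop_body) s1
      (reg s1 ''size'' * (114 * card V + 38 * card E + 79 + bcost (Lit 0 \<prec> Var ''size'') + 1)
        + bcost (Lit 0 \<prec> Var ''size'') + 1)
      (\<lambda>s'. loop_inv V E \<sigma> s' \<and> \<not> bval (Lit 0 \<prec> Var ''size'') s')"
    by (rule runs_While[where f = "\<lambda>s'. reg s' ''size''"]) (rule loop_body_runs[OF _ sg ord(2)], simp_all)
  then obtain t2 s2 where 2: "exec (WHILE Lit 0 \<prec> Var ''size'' DO loop_body) s1 t2 s2"
      "t2 \<le> reg s1 ''size'' * (114 * card V + 38 * card E + 79 + bcost (Lit 0 \<prec> Var ''size'') + 1)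
        + bcost (Lit 0 \<prec> Var ''size'') + 1"
      "loop_inv V E \<sigma> s2" "reg s2 ''size'' = 0"
    by (auto elim: runsE)
  have "alive_set s2 = {}" using 2(3,4) by (simp add: loop_inv_def)
  then have "algB_loop {e \<in> E. e \<subseteq> alive_set s2} (filter (\<lambda>u. u \<in> alive_set s2) \<sigma>)
      (stored_bicliques s2) (stored_bicliques s2)"
    using algB_loop.finish by simp
  then have "algB_loop E \<sigma> {} (stored_bicliques s2)" using 2(3) unfolding loop_inv_def by blast
  moreover have "t1 + t2 \<le> card V * (114 * card V + 38 * card E + 94) + 22"
    using 1(2) 2(2) by (simp add: s1_def V algebra_simps)
  ultimately show ?thesis
    unfolding loop_prog_def by (intro runsI[OF exec.Seq[OF 1(1) 2(1)]])
qed

theorem theorem4: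
  shows "\<exists>C::nat. \<forall>(V::nat set) E s.
    co_chordal V E \<and> adjacency_lists ''off'' ''adj'' s V E \<and> reg s ''start'' \<in> V \<longrightarrow>
    (\<exists>t1 s1 t2 s2 t s' \<tau>.
       exec complement_prog s t1 s1 \<and>
       adjacency_lists ''coff'' ''cadj'' s1 V (complement_edges V E) \<and>
       exec peo_prog s1 t2 s2 \<and>
       t2 \<le> C * (card V + card (complement_edges V E)) \<and>
       exec algorithm_B_prog s t s' \<and>
       t \<le> C * (card V * (card V + card (complement_edges V E))) \<and>
       lexbfs_ordering V (complement_edges V E) (reg s ''start'') \<tau> \<and>
       stored_ordering s2 = rev \<tau> \<and>
       algorithm_B V E (rev \<tau>) (stored_bicliques s'))"
proof (rule exI[of _ 1000], intro allI impI, elim conjE)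
  fix V :: "nat set" and E s
  assume co: "co_chordal V E" and adj: "adjacency_lists ''off'' ''adj'' s V E"
    and start: "reg s ''start'' \<in> V"
  let ?E = "complement_edges V E" and ?n = "reg s ''n''" and ?r = "reg s ''start''"
  have sgE: "simple_graph V E" and chordal: "chordal V ?E" using co by (auto simp: co_chordal_def)
  then have sg: "simple_graph V ?E" by (simp add: chordal_def)
  have V: "V = {..<?n}" using adj by (simp add: adjacency_lists_iff)
  then have cV: "card V = ?n" and n: "0 < ?n" using start by auto
  obtain t1 s1 where 1: "exec complement_prog s t1 s1" "t1 \<le> 46 * (?n * ?n) + 38 * ?n + 12"
      "adjacency_lists ''coff'' ''cadj'' s1 V ?E" "frame complement_prog s s1"
    by (rule runsE[OF complement_prog_runs[OF sgE adj]])
  have r1: "?r = reg s1 ''start''" and n1: "?n = reg s1 ''n''"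
    using 1(4) by (simp_all add: frame_def complement_prog_def)
  obtain t2 s2 where 2: "exec peo_prog s1 t2 s2" "t2 \<le> 61 * ?n + 222 * card ?E + 42"
      "\<exists>\<tau>. bij_betw \<tau> {..<?n} V \<and> \<tau> 0 = ?r \<and>
        (\<forall>x y. x < y \<longrightarrow> y < ?n \<longrightarrow> lex_key ?E \<tau> x (\<tau> y) \<le> lex_key ?E \<tau> x (\<tau> x)) \<and>
        stored_ordering s2 = rev (map \<tau> [0..<?n])"
      "frame peo_prog s1 s2"
    by (rule runsE[OF peo_prog_runs[OF 1(3) sg r1 start n1]])
  then obtain \<tau> where bij: "bij_betw \<tau> {..<?n} V" and \<tau>0: "\<tau> 0 = ?r"
    and sorted: "\<And>x y. x < y \<Longrightarrow> y < ?n \<Longrightarrow> lex_key ?E \<tau> x (\<tau> y) \<le> lex_key ?E \<tau> x (\<tau> x)"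
    and ord: "stored_ordering s2 = rev (map \<tau> [0..<?n])"
    by blast
  have same: "reg s2 ''n'' = reg s1 ''n''" "arr s2 ''coff'' = arr s1 ''coff''" "arr s2 ''cadj'' = arr s1 ''cadj''"
    using 2(4) by (simp_all add: frame_def peo_prog_def lexbfs_prog_def)
  have adj2: "adjacency_lists ''coff'' ''cadj'' s2 V ?E"
    using 1(3) unfolding adjacency_lists_iff same .
  have peo: "perfect_elimination_ordering V ?E (rev (map \<tau> [0..<?n]))"
    by (rule perfect_elimination_ordering_rev[OF chordal bij three_point_of_lex_key[OF sorted]])
  then have "set (rev (map \<tau> [0..<?n])) = V" by (simp add: perfect_elimination_ordering_def)
  then obtain t3 s3 where 3: "exec loop_prog s2 t3 s3"
      "t3 \<le> card V * (114 * card V + 38 * card ?E + 94) + 22"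
      "algB_loop ?E (rev (map \<tau> [0..<?n])) {} (stored_bicliques s3)"
    by (rule runsE[OF loop_prog_runs[OF adj2 sg ord]])
  have total: "exec algorithm_B_prog s (t1 + t2 + t3) s3"
    unfolding algorithm_B_prog_def by (intro exec.Seq[OF exec.Seq[OF 1(1) 2(1)] 3(1)])
  \<comment> \<open>The start vertex makes the graph nonempty, so lower-order terms are absorbed by
    the products. The total is then at most 429 times \<open>?n * ?n\<close> plus 260 times
    \<open>?n * card ?E\<close>, well below 1000 times each.\<close>
  have "?n \<le> ?n * ?n" "card ?E \<le> ?n * card ?E" "0 < ?n * ?n" using n by simp_all
  moreover have "card V * (114 * card V + 38 * card ?E + 94) = 114 * (?n * ?n) + 38 * (?n * card ?E) + 94 * ?n"
    "1000 * (card V * (card V + card ?E)) = 1000 * (?n * ?n) + 1000 * (?n * card ?E)"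
    unfolding cV by (simp_all add: algebra_simps)
  ultimately have time: "t1 + t2 + t3 \<le> 1000 * (card V * (card V + card ?E))"
    using 1(2) 2(2) 3(2) by linarith
  have time2: "t2 \<le> 1000 * (card V + card ?E)" using 2(2) n unfolding cV by simp
  have "lexbfs_ordering V ?E ?r (map \<tau> [0..<?n])"
    using lexbfs_ordering_of_lex_key[OF bij n sorted] \<tau>0 by simp
  moreover have "algorithm_B V E (rev (map \<tau> [0..<?n])) (stored_bicliques s3)"
    using peo 3(3) by (simp add: algorithm_B_def)
  ultimately show "\<exists>t1 s1 t2 s2 t s' \<tau>.
       exec complement_prog s t1 s1 \<and>
       adjacency_lists ''coff'' ''cadj'' s1 V ?E \<and>
       exec peo_prog s1 t2 s2 \<and>
       t2 \<le> 1000 * (card V + card ?E) \<and>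
       exec algorithm_B_prog s t s' \<and>
       t \<le> 1000 * (card V * (card V + card ?E)) \<and>
       lexbfs_ordering V ?E ?r \<tau> \<and>
       stored_ordering s2 = rev \<tau> \<and>
       algorithm_B V E (rev \<tau>) (stored_bicliques s')"
    using 1(1,3) 2(1) total time time2 ord by blast
qed

end
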